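(* Let $d\mu = w(\theta)\,d\theta$ be an absolutely continuous positive measure on the unit circle $\mathbb{T}$, normalized by $\frac{1}{2\pi}\int_{-\pi}^{\pi} d\mu = 1$, with $w\in\mathcal{A}_1$, and let $\nu$ be a Beurling weight. Let $\alpha=\{\alpha_n\}_{n=0}^{\infty}$ be the sequence of recurrence (Verblunsky) coefficients of $\mu$ and let $\mathcal{S}$ be its scattering function. Then $$\alpha\in\ell_\nu \quad\Longleftrightarrow\quad \mathcal{P}_-(\mathcal{S})\in\mathcal{A}_\nu^-.$$
   Context: A Beurling weight is a two-sided sequence $\nu=\{\nu(n)\}_{n\in\mathbb{Z}}$ with $\nu(0)=1$, $\nu(n)\ge 1$, $\nu(n)=\nu(-n)$, and $\nu(n+m)\le\nu(n)\nu(m)$ for all $n,m\in\mathbb{Z}$. The space $\ell_\nu$ consists of two-sided sequences $f=\{f_n\}_{n\in\mathbb{Z}}$ of complex numbers with $\|f\|_\nu=\sum_{n\in\mathbb{Z}}\nu(n)|f_n|<\infty$; a one-sided sequence is regarded as two-sided by completing it with zeros. $\mathcal{A}_\nu$ is the space of functions $f(z)=\sum_{k\in\mathbb{Z}}f_kz^k$ with $\|f\|_\nu=\sum_k\nu(k)|f_k|<\infty$; $\mathcal{A}_1$ is the Wiener algebra ($\nu\equiv1$). For $f(z)=\sum_{k\in\mathbb{Z}}f_kz^k$, $\mathcal{P}_-(f)=\sum_{k\le0}f_kz^k$. $\mathcal{A}_\nu^-=\mathcal{P}_-(\mathcal{A}_\nu)$ is the set of $f\in\mathcal{A}_\nu$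 with $f_k=0$ for all $k>0$. Functions on $\mathbb{T}$ are written interchangeably as $w(\theta)$ and $w(e^{i\theta})$. For a positive measure $\mu$ on $\mathbb{T}$ with infinitely many points of increase, let $\Phi_n$ be its monic orthogonal polynomial of degree $n$, and let $\Phi_n^*(z)=z^n\overline{\Phi_n(1/\bar z)}$. The recurrence (Verblunsky) coefficients $\alpha_n$, $n\ge0$, are defined by $\Phi_{n+1}(z)=z\Phi_n(z)-\overline{\alpha_n}\,\Phi_n^*(z)$, i.e. $\alpha_n=-\overline{\Phi_{n+1}(0)}$. The Szegő function of $w$ is $$D(z)=\exp\left(\frac{1}{4\pi}\int_0^{2\pi}\log w(e^{i\theta})\,\frac{e^{i\theta}+z}{e^{i\theta}-z}\,d\theta\right),\quad |z|\ne1,$$ with $D_{\rm i}$ and $D_{\rm e}$ denoting its values for $|z|<1$ and $|z|>1$ respectively, extended to $\mathbb{T}$ by their boundary values. With $f_+=1/D_{\rm i}$ and $f_-=D_{\rm e}$, the scattering function is $\mathcal{S}=f_-/f_+=D_{\rm i}D_{\rm e}$ on $\mathbb{T}$; in terms of $c_k=\frac{1}{2\pi}\int_{-\pi}^{\pi}e^{-ik\theta}\log w(\theta)\,d\theta$, $\mathcal{S}(z)=\exp\left(\sum_{k=1}^\infty(c_kz^k-\overline{c_k}z^{-k})\right)$ for $|z|=1$.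
   Formalization: The formal theorem assumes that w is strictly positive at every point of the unit circle; without this the equivalence fails, e.g. for w = 1 − cos θ, where S(z) = −z and P_-(S) = 0 but the recurrence coefficients are not summable. *)

theory Defs
  imports "HOL-Analysis.Analysis" "HOL-Computational_Algebra.Polynomial"
begin

abbreviation unit_circle :: "complex set" where
  "unit_circle \<equiv> sphere 0 1"

subsection \<open>Beurling weights, weighted sequences and function algebras\<close>

definition beurling_weight :: "(int \<Rightarrow> real) \<Rightarrow> bool" where
  "beurling_weight \<nu> \<longleftrightarrow>
     \<nu> 0 = 1 \<and> (\<forall>n. \<nu> n \<ge> 1) \<and> (\<forall>n. \<nu> n = \<nu> (- n)) \<and> (\<forall>n m. \<nu> (n + m) \<le> \<nu> n * \<nu> m)"

definition ell :: "(int \<Rightarrow> real) \<Rightarrow> (int \<Rightarrow> complex) set" where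
  "ell \<nu> = {f. (\<lambda>n. \<nu> n * cmod (f n)) summable_on UNIV}"

definition two_sided :: "(nat \<Rightarrow> complex) \<Rightarrow> int \<Rightarrow> complex" where
  "two_sided a k = (if k \<ge> 0 then a (nat k) else 0)"

text \<open>A function on the circle is represented by a function on the whole plane.  Its values
  off the circle are never constrained, and membership in the sets below does not depend on them.\<close>

definition beurling_algebra :: "(int \<Rightarrow> real) \<Rightarrow> (complex \<Rightarrow> complex) set" where
  "beurling_algebra \<nu> =
     {f. \<exists>c\<in>ell \<nu>. \<forall>z\<in>unit_circle. ((\<lambda>k. c k * z powi k) has_sum f z) UNIV}"

abbreviation wiener_algebra :: "(complex \<Rightarrow> complex) set" where
  "wiener_algebra \<equiv> beurling_algebra (\<lambda>_. 1)"

text \<open>For a function in the Wiener algebra, the coefficients of its (unique) expansion are its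
  Fourier coefficients.\<close>

definition fourier_coeff :: "(complex \<Rightarrow> complex) \<Rightarrow> int \<Rightarrow> complex" where
  "fourier_coeff f k =
     (1 / (2 * pi)) * (LBINT \<theta>:{- pi..pi}. cis (- of_int k * \<theta>) * f (cis \<theta>))"

text \<open>This is meaningful only when the sum converges; every function in the Wiener algebra
  qualifies.\<close>

definition P_minus :: "(complex \<Rightarrow> complex) \<Rightarrow> complex \<Rightarrow> complex" where
  "P_minus f z = (\<Sum>\<^sub>\<infinity>k\<in>{..0}. fourier_coeff f k * z powi k)"

definition beurling_algebra_minus :: "(int \<Rightarrow> real) \<Rightarrow> (complex \<Rightarrow> complex) set" where
  "beurling_algebra_minus \<nu> = {f \<in> beurling_algebra \<nu>. \<forall>k>0. fourier_coeff f k = 0}"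

subsection \<open>Orthogonal polynomials on the unit circle\<close>

text \<open>The measure \<open>d\<theta>\<close> on the circle, of total mass \<open>2\<pi>\<close>.\<close>

definition arc_measure :: "complex measure" where
  "arc_measure = distr (restrict_space lborel {- pi..pi}) (restrict_space borel unit_circle) cis"

text \<open>The polynomial described here is unique if the support of the measure is infinite.\<close>

definition monic_OP :: "complex measure \<Rightarrow> nat \<Rightarrow> complex poly" where
  "monic_OP \<mu> n =
     (THE p. degree p = n \<and> lead_coeff p = 1 \<and>
        (\<forall>q. degree q < n \<longrightarrow> (\<integral>z. poly p z * cnj (poly q z) \<partial>\<mu>) = 0))"

text \<open>Since \<open>monic_OP \<mu> n\<close> has degree exactly \<open>n\<close>, this is
  \<open>z\<^sup>n cnj (\<Phi>\<^sub>n (1 / cnj z))\<close> as a polynomial.\<close>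

definition reversed_OP :: "complex measure \<Rightarrow> nat \<Rightarrow> complex poly" where
  "reversed_OP \<mu> n = reflect_poly (map_poly cnj (monic_OP \<mu> n))"

definition verblunsky :: "complex measure \<Rightarrow> nat \<Rightarrow> complex" where
  "verblunsky \<mu> n =
     (THE a. monic_OP \<mu> (Suc n) = pCons 0 (monic_OP \<mu> n) - smult (cnj a) (reversed_OP \<mu> n))"

lemma verblunsky_eq:
  assumes rec: "monic_OP \<mu> (Suc n) = pCons 0 (monic_OP \<mu> n) - smult (cnj a) (reversed_OP \<mu> n)"
    and monic: "lead_coeff (monic_OP \<mu> n) = 1"
  shows "verblunsky \<mu> n = a" and "a = - cnj (poly (monic_OP \<mu> (Suc n)) 0)"
proof -
  have "lead_coeff (map_poly cnj (monic_OP \<mu> n)) = 1"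
    using monic by (subst lead_coeff_map_poly_nz) auto
  hence "poly (reversed_OP \<mu> n) 0 = 1"
    by (simp add: reversed_OP_def poly_0_coeff_0)
  hence *: "b = - cnj (poly (monic_OP \<mu> (Suc n)) 0)"
    if "monic_OP \<mu> (Suc n) = pCons 0 (monic_OP \<mu> n) - smult (cnj b) (reversed_OP \<mu> n)" for b
    unfolding that by simp
  show a: "a = - cnj (poly (monic_OP \<mu> (Suc n)) 0)"
    by (rule *[OF rec])
  show "verblunsky \<mu> n = a"
    unfolding verblunsky_def
  proof (rule the_equality)
    show "b = a"
      if "monic_OP \<mu> (Suc n) = pCons 0 (monic_OP \<mu> n) - smult (cnj b) (reversed_OP \<mu> n)" for b
      using *[OF that] a by simp
  qed (rule rec)
qed

subsection \<open>The scattering function\<close>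

definition szego_function :: "(complex \<Rightarrow> real) \<Rightarrow> complex \<Rightarrow> complex" where
  "szego_function w z =
     exp ((1 / (4 * pi)) *
       (LBINT \<theta>:{0..2 * pi}. complex_of_real (ln (w (cis \<theta>))) * ((cis \<theta> + z) / (cis \<theta> - z))))"

text \<open>Radial boundary values at a point of the circle, from inside and from outside.\<close>

definition szego_inner :: "(complex \<Rightarrow> real) \<Rightarrow> complex \<Rightarrow> complex" where
  "szego_inner w \<zeta> = Lim (at_left 1) (\<lambda>r::real. szego_function w (r * \<zeta>))"

definition szego_outer :: "(complex \<Rightarrow> real) \<Rightarrow> complex \<Rightarrow> complex" where
  "szego_outer w \<zeta> = Lim (at_right 1) (\<lambda>r::real. szego_function w (r * \<zeta>))"

definition f_plus :: "(complex \<Rightarrow> real) \<Rightarrow> complex \<Rightarrow> complex" where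
  "f_plus w \<zeta> = 1 / szego_inner w \<zeta>"

definition f_minus :: "(complex \<Rightarrow> real) \<Rightarrow> complex \<Rightarrow> complex" where
  "f_minus w \<zeta> = szego_outer w \<zeta>"

definition scattering :: "(complex \<Rightarrow> real) \<Rightarrow> complex \<Rightarrow> complex" where
  "scattering w \<zeta> = f_minus w \<zeta> / f_plus w \<zeta>"

end

theory Submission
  imports Defs
begin

text \<open>
  Write \<open>log w = G + cnj G\<close> on the circle with \<open>G\<close> analytic in the disc; by the Wiener--Levy theorem
  \<open>G\<close> has an absolutely convergent expansion, \<open>w = D cnj D\<close> with \<open>D = exp G\<close>, and \<open>S = D / cnj D\<close>.
  Orthogonality says that \<open>\<Phi>\<^sub>n\<^sup>* w\<close> has no Fourier coefficients of index \<open>1, \<dots>, n\<close>, so that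
  \<open>\<Phi>\<^sub>n\<^sup>* w = a\<^sub>n cnj D - cnj b\<^sub>n D\<close> with \<open>a\<^sub>n\<close> and \<open>b\<^sub>n\<close> supported on indices \<open>\<le> 0\<close> and
  \<open>< - n\<close>.  Consequently \<open>S cnj a\<^sub>n - b\<^sub>n\<close> has no coefficients below \<open>- n\<close>, and
  \<open>a\<^sub>n - S cnj b\<^sub>n\<close> none below \<open>0\<close> (Marchenko equations), while the Szego recurrence becomes
  \<open>a\<^sub>n\<^sub>+\<^sub>1 = a\<^sub>n + \<alpha>\<^sub>n z\<^sup>n\<^sup>+\<^sup>1 b\<^sub>n\<close> and \<open>b\<^sub>n\<^sub>+\<^sub>1 = b\<^sub>n + cnj \<alpha>\<^sub>n z\<^sup>-\<^sup>n\<^sup>-\<^sup>1 a\<^sub>n\<close>.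

  Normalised by \<open>a\<^sub>n(\<infinity>) = 1\<close>, the leading coefficient of \<open>b\<^sub>n\<close> is \<open>- cnj \<alpha>\<^sub>n\<close>.  If the tail of the
  negative coefficients of \<open>S\<close> is small in the weighted norm, the Marchenko equations bound \<open>a\<^sub>n\<close>, \<open>b\<^sub>n\<close>
  uniformly in \<open>n\<close>, hence \<open>\<alpha>\<close>.  If the tail of \<open>\<alpha>\<close> is small, the recurrence, solved backwards, makes
  \<open>a\<^sub>n\<close> close to \<open>1\<close> uniformly, and the \<open>(n + 1)\<close>-st Marchenko equation can be solved for the
  coefficients of \<open>S\<close>.  All estimates are made for the bounded weights \<open>min \<nu> M\<close>, for which the norms
  are finite a priori, with constants independent of \<open>M\<close>.
\<close>

no_notation Infinite_Set_Sum.abs_summable_on (infix "abs'_summable'_on" 50)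

section \<open>Absolutely convergent Fourier expansions\<close>

text \<open>This is the unweighted Wiener algebra with its coefficients named. It is a relation, so
  that every operation on functions can be matched with an explicit operation on coefficient
  sequences.\<close>

definition fourier_expansion :: "(complex \<Rightarrow> complex) \<Rightarrow> (int \<Rightarrow> complex) \<Rightarrow> bool" where
  "fourier_expansion f c \<longleftrightarrow> c abs_summable_on UNIV \<and>
     (\<forall>z\<in>unit_circle. ((\<lambda>k. c k * z powi k) has_sum f z) UNIV)"

definition l1_norm :: "(int \<Rightarrow> complex) \<Rightarrow> real" where
  "l1_norm c = (\<Sum>\<^sub>\<infinity>k. cmod (c k))"

definition convolution :: "(int \<Rightarrow> complex) \<Rightarrow> (int \<Rightarrow> complex) \<Rightarrow> int \<Rightarrow> complex" where
  "convolution c d k = (\<Sum>\<^sub>\<infinity>l. c l * d (k - l))"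

lemma norm_powi_circle: "z \<in> unit_circle \<Longrightarrow> cmod (z powi k) = 1"
  by (simp add: norm_power_int)

lemma circle_nonzero: "z \<in> unit_circle \<Longrightarrow> z \<noteq> 0"
  by auto

lemma cnj_circle: "z \<in> unit_circle \<Longrightarrow> cnj z = inverse z"
  using complex_norm_square[of z] inverse_unique[of z "cnj z"] by simp

lemma l1_norm_nonneg: "l1_norm c \<ge> 0"
  unfolding l1_norm_def by (intro infsum_nonneg) auto

lemma fourier_expansionI:
  assumes "c abs_summable_on UNIV" "\<And>z. z \<in> unit_circle \<Longrightarrow> ((\<lambda>k. c k * z powi k) has_sum f z) UNIV"
  shows "fourier_expansion f c"
  using assms by (auto simp: fourier_expansion_def)

lemma fourier_expansion_abs: "fourier_expansion f c \<Longrightarrow> c abs_summable_on UNIV"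
  and fourier_expansion_has_sum:
    "fourier_expansion f c \<Longrightarrow> z \<in> unit_circle \<Longrightarrow> ((\<lambda>k. c k * z powi k) has_sum f z) UNIV"
  by (auto simp: fourier_expansion_def)

lemma fourier_expansion_cong:
  assumes "fourier_expansion f c" "\<And>z. z \<in> unit_circle \<Longrightarrow> f z = g z"
  shows "fourier_expansion g c"
  using assms by (auto simp: fourier_expansion_def)

lemma fourier_expansion_norm_le:
  assumes "fourier_expansion f c" "z \<in> unit_circle"
  shows "cmod (f z) \<le> l1_norm c"
  unfolding l1_norm_def
  by (rule norm_infsum_le[OF fourier_expansion_has_sum[OF assms] has_sum_infsum[OF fourier_expansion_abs[OF assms(1)]]])
    (simp add: norm_mult norm_powi_circle[OF assms(2)])

lemma fourier_expansion_continuous: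
  assumes "fourier_expansion f c"
  shows "continuous_on unit_circle f"
proof (rule uniform_limit_theorem)
  show "uniform_limit unit_circle (\<lambda>X z. \<Sum>k\<in>X. c k * z powi k) f (finite_subsets_at_top UNIV)"
    by (rule Weierstrass_m_test_general'[OF _ fourier_expansion_has_sum[OF assms] fourier_expansion_abs[OF assms]])
      (simp_all add: norm_mult norm_power_int)
  show "\<forall>\<^sub>F X in finite_subsets_at_top UNIV. continuous_on unit_circle (\<lambda>z. \<Sum>k\<in>X. c k * z powi k)"
    by (intro always_eventually allI continuous_intros) auto
qed simp

section \<open>Fourier coefficients as integrals over a period\<close>

text \<open>The starting point \<open>a\<close> is free because \<open>fourier_coeff\<close>
  integrates over \<open>{- pi..pi}\<close> and \<open>szego_function\<close> over
  \<open>{0..2 * pi}\<close>.\<close>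

lemma integral_cis:
  "(LBINT x:{a..a + 2 * pi}. cis (of_int k * x)) = (if k = 0 then 2 * pi else 0)"
proof (cases "k = 0")
  case True
  thus ?thesis by (simp add: set_lebesgue_integral_def scaleR_conv_of_real)
next
  case False
  let ?F = "\<lambda>x. cis (of_int k * x) / (\<i> * of_int k)"
  have "(LBINT x:{a..a + 2 * pi}. cis (of_int k * x)) = integral {a..a + 2 * pi} (\<lambda>x. cis (of_int k * x))"
    by (intro set_borel_integral_eq_integral borel_integrable_atLeastAtMost' continuous_intros)
  also have "((\<lambda>x. cis (of_int k * x)) has_integral (?F (a + 2 * pi) - ?F a)) {a..a + 2 * pi}"
  proof (rule fundamental_theorem_of_calculus)
    fix x :: real
    have "((\<lambda>z. exp (\<i> * (of_int k * z)) / (\<i> * of_int k)) has_field_derivative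
        exp (\<i> * (of_int k * of_real x))) (at (of_real x))"
      using False by (auto intro!: derivative_eq_intros simp: field_simps)
    from has_vector_derivative_real_field[OF this, of "{a..a + 2 * pi}"]
    show "(?F has_vector_derivative cis (of_int k * x)) (at x within {a..a + 2 * pi})"
      by (simp add: cis_conv_exp)
  qed simp
  hence "integral {a..a + 2 * pi} (\<lambda>x. cis (of_int k * x)) = ?F (a + 2 * pi) - ?F a"
    by (rule integral_unique)
  also have "cis (of_int k * (a + 2 * pi)) = cis (of_int k * a) * cis (2 * pi * of_int k)"
    by (simp add: cis_mult algebra_simps)
  also have "cis (2 * pi * of_int k) = 1" by (simp add: cis_multiple_2pi)
  finally show ?thesis using False by simp
qed

text \<open>The partial sums converge uniformly, so integration may be done term by term, and every
  nonconstant power integrates to 0.\<close>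

lemma fourier_expansion_integral:
  fixes f :: "complex \<Rightarrow> complex" and c :: "int \<Rightarrow> complex"
  assumes "fourier_expansion f c"
  shows "(LBINT x:{a..a + 2 * pi}. f (cis x)) = 2 * pi * c 0"
proof -
  let ?I = "{a..a + 2 * pi}"
  have cont: "continuous_on ?I (\<lambda>x. f (cis x))"
    by (rule continuous_on_compose2[OF fourier_expansion_continuous[OF assms]]) (auto intro!: continuous_intros)
  have int: "set_integrable lborel ?I (\<lambda>x. f (cis x))"
    using cont by (rule borel_integrable_atLeastAtMost')
  have intc: "set_integrable lborel ?I (\<lambda>x. c k * cis (of_int k * x))" for k
    by (intro borel_integrable_atLeastAtMost' continuous_intros)
  have "cmod ((LBINT x:?I. f (cis x)) - 2 * pi * c 0) \<le> 0 + e" if e: "e > 0" for e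
  proof -
    \<comment> \<open>Over an interval of length \<open>2 * pi\<close>, a uniform error
      \<open>e'\<close> contributes \<open>e\<close>.\<close>
    define e' where "e' = e / (2 * pi)"
    have e': "e' > 0" using e by (simp add: e'_def)
    have "uniform_limit unit_circle (\<lambda>X z. \<Sum>k\<in>X. c k * z powi k) f (finite_subsets_at_top UNIV)"
      by (rule Weierstrass_m_test_general'[OF _ fourier_expansion_has_sum[OF assms] fourier_expansion_abs[OF assms]])
        (simp_all add: norm_mult norm_power_int)
    hence "\<forall>\<^sub>F X in finite_subsets_at_top UNIV. \<forall>z\<in>unit_circle. dist (\<Sum>k\<in>X. c k * z powi k) (f z) < e'"
      using e' by (auto simp: uniform_limit_iff)
    \<comment> \<open>Index 0 is forced into \<open>X\<close>, so that the integral of the partial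
      sum is exactly \<open>2 * pi * c 0\<close>.\<close>
    moreover have "\<forall>\<^sub>F X in finite_subsets_at_top UNIV. finite X \<and> {0::int} \<subseteq> X"
      by (auto simp: eventually_finite_subsets_at_top intro!: exI[of _ "{0}"])
    ultimately have "\<forall>\<^sub>F X in finite_subsets_at_top UNIV. (finite X \<and> {0::int} \<subseteq> X) \<and>
        (\<forall>z\<in>unit_circle. dist (\<Sum>k\<in>X. c k * z powi k) (f z) < e')"
      by (rule eventually_conj[rotated])
    from eventually_happens'[OF finite_subsets_at_top_neq_bot this]
    obtain X where X: "finite X" "0 \<in> X" "\<And>z. z \<in> unit_circle \<Longrightarrow> dist (\<Sum>k\<in>X. c k * z powi k) (f z) < e'"
      by blast
    have intX: "set_integrable lborel ?I (\<lambda>x. \<Sum>k\<in>X. c k * cis (of_int k * x))"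
      by (intro borel_integrable_atLeastAtMost' continuous_intros)
    have "(LBINT x:?I. (\<Sum>k\<in>X. c k * cis (of_int k * x))) = (\<Sum>k\<in>X. LBINT x:?I. c k * cis (of_int k * x))"
      unfolding set_lebesgue_integral_def scaleR_sum_right
      using intc by (intro Bochner_Integration.integral_sum) (simp add: set_integrable_def)
    also have "\<dots> = (\<Sum>k\<in>X. if k = 0 then 2 * pi * c 0 else 0)"
      by (intro sum.cong refl) (simp add: integral_cis set_integral_mult_right)
    also have "\<dots> = 2 * pi * c 0" using X by simp
    finally have "(LBINT x:?I. f (cis x)) - 2 * pi * c 0 =
        (LBINT x:?I. f (cis x) - (\<Sum>k\<in>X. c k * cis (of_int k * x)))"
      using int intX by (simp add: set_integral_diff)
    also have "cmod \<dots> \<le> (LBINT x:?I. cmod (f (cis x) - (\<Sum>k\<in>X. c k * cis (of_int k * x))))"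
      using int intX by (intro set_integral_norm_bound set_integral_diff) auto
    also have "\<dots> \<le> (LBINT x:?I. e')"
    proof (rule set_integral_mono)
      show "set_integrable lborel ?I (\<lambda>x. cmod (f (cis x) - (\<Sum>k\<in>X. c k * cis (of_int k * x))))"
        using int intX by (intro set_integrable_norm set_integral_diff) auto
      show "cmod (f (cis x) - (\<Sum>k\<in>X. c k * cis (of_int k * x))) \<le> e'" for x
        using X(3)[of "cis x"] by (simp add: dist_norm norm_minus_commute cis_power_int less_imp_le)
    qed (intro borel_integrable_atLeastAtMost' continuous_intros)
    also have "\<dots> = e" by (simp add: set_lebesgue_integral_def e'_def)
    finally show ?thesis by simp
  qed
  hence "cmod ((LBINT x:?I. f (cis x)) - 2 * pi * c 0) \<le> 0" by (rule field_le_epsilon)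
  thus ?thesis by simp
qed

lemma fourier_expansion_shift:
  assumes "fourier_expansion f c"
  shows "fourier_expansion (\<lambda>z. z powi m * f z) (\<lambda>k. c (k - m))"
proof (rule fourier_expansionI)
  have bij: "bij_betw (\<lambda>k. k - m) UNIV UNIV"
    by (rule bij_betwI[of _ _ _ "\<lambda>k. k + m"]) auto
  show "(\<lambda>k. c (k - m)) abs_summable_on UNIV"
    using fourier_expansion_abs[OF assms] summable_on_reindex_bij_betw[OF bij, of "\<lambda>k. cmod (c k)"] by simp
  fix z assume z: "z \<in> unit_circle"
  have "((\<lambda>k. z powi m * (c k * z powi k)) has_sum (z powi m * f z)) UNIV"
    using fourier_expansion_has_sum[OF assms z] by (intro has_sum_cmult_right)
  hence "((\<lambda>k. z powi m * (c (k - m) * z powi (k - m))) has_sum (z powi m * f z)) UNIV"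
    using has_sum_reindex_bij_betw[OF bij, of "\<lambda>k. z powi m * (c k * z powi k)"] by simp
  moreover have "z powi m * (c (k - m) * z powi (k - m)) = c (k - m) * z powi k" for k
    using circle_nonzero[OF z] by (simp add: power_int_diff)
  ultimately show "((\<lambda>k. c (k - m) * z powi k) has_sum (z powi m * f z)) UNIV" by simp
qed

text \<open>Multiplication by \<open>z powi (-k)\<close> moves coefficient \<open>k\<close> to index
  0, where the mean value reads it off.\<close>

lemma fourier_coeff_eq:
  assumes "fourier_expansion f c"
  shows "fourier_coeff f k = c k"
proof -
  have "(LBINT x:{-pi..-pi + 2 * pi}. cis x powi (-k) * f (cis x)) = 2 * pi * c (0 - (-k))"
    by (rule fourier_expansion_integral[OF fourier_expansion_shift[OF assms]])
  thus ?thesis by (simp add: fourier_coeff_def cis_power_int)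
qed

lemma fourier_expansion_unique:
  assumes "fourier_expansion f c" "fourier_expansion g d" "\<And>z. z \<in> unit_circle \<Longrightarrow> f z = g z"
  shows "c = d"
proof
  have "fourier_expansion g c" by (rule fourier_expansion_cong[OF assms(1,3)])
  thus "c k = d k" for k using fourier_coeff_eq assms(2) by metis
qed

section \<open>Algebra operations and norm-convergent series\<close>

lemma fourier_expansion_add:
  assumes "fourier_expansion f c" "fourier_expansion g d"
  shows "fourier_expansion (\<lambda>z. f z + g z) (\<lambda>k. c k + d k)"
proof (rule fourier_expansionI)
  show "(\<lambda>k. c k + d k) abs_summable_on UNIV"
    by (rule Infinite_Sum.abs_summable_on_comparison_test'[OF summable_on_add[OF assms[THEN fourier_expansion_abs]]])
      (rule norm_triangle_ineq)
  show "((\<lambda>k. (c k + d k) * z powi k) has_sum f z + g z) UNIV" if z: "z \<in> unit_circle" for z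
    using has_sum_add[OF assms[THEN fourier_expansion_has_sum, OF z]] by (simp add: distrib_right)
qed

lemma fourier_expansion_cmult:
  assumes "fourier_expansion f c"
  shows "fourier_expansion (\<lambda>z. a * f z) (\<lambda>k. a * c k)"
proof (rule fourier_expansionI)
  show "(\<lambda>k. a * c k) abs_summable_on UNIV"
    using fourier_expansion_abs[OF assms] by (simp add: norm_mult summable_on_cmult_right)
  show "((\<lambda>k. a * c k * z powi k) has_sum a * f z) UNIV" if z: "z \<in> unit_circle" for z
    using has_sum_cmult_right[OF fourier_expansion_has_sum[OF assms z], of a] by (simp add: mult.assoc)
qed

lemma fourier_expansion_diff:
  assumes "fourier_expansion f c" "fourier_expansion g d"
  shows "fourier_expansion (\<lambda>z. f z - g z) (\<lambda>k. c k - d k)"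
  using fourier_expansion_add[OF assms(1) fourier_expansion_cmult[OF assms(2), of "-1"]] by simp

lemma fourier_expansion_const: "fourier_expansion (\<lambda>_. a) (\<lambda>k. if k = 0 then a else 0)"
proof (rule fourier_expansionI)
  show "(\<lambda>k. if k = 0 then a else 0) abs_summable_on (UNIV :: int set)"
    by (rule finite_nonzero_values_imp_summable_on) (auto intro: finite_subset[of _ "{0}"])
  fix z :: complex
  have "((\<lambda>k::int. (if k = 0 then a else 0) * z powi k) has_sum (\<Sum>k\<in>{0}. (if k = 0 then a else 0) * z powi k)) UNIV"
    by (rule has_sum_finite_neutralI[of "{0}"]) auto
  thus "((\<lambda>k::int. (if k = 0 then a else 0) * z powi k) has_sum a) UNIV" by simp
qed

lemma fourier_expansion_cnj:
  assumes "fourier_expansion f c"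
  shows "fourier_expansion (\<lambda>z. cnj (f z)) (\<lambda>k. cnj (c (- k)))"
proof (rule fourier_expansionI)
  have bij: "bij_betw uminus (UNIV :: int set) UNIV"
    by (rule bij_betwI[of _ _ _ uminus]) auto
  show "(\<lambda>k. cnj (c (- k))) abs_summable_on UNIV"
    using fourier_expansion_abs[OF assms] summable_on_reindex_bij_betw[OF bij, of "\<lambda>k. cmod (c k)"] by simp
  fix z assume z: "z \<in> unit_circle"
  have "((\<lambda>k. cnj (c k * z powi k)) has_sum cnj (f z)) UNIV"
    using fourier_expansion_has_sum[OF assms z] by (simp only: has_sum_cnj_iff)
  hence "((\<lambda>k. cnj (c (-k) * z powi (-k))) has_sum cnj (f z)) UNIV"
    using has_sum_reindex_bij_betw[OF bij, of "\<lambda>k. cnj (c k * z powi k)"] by simp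
  moreover have "cnj (z powi (-k)) = z powi k" for k
    using z by (simp add: cnj_circle power_int_minus power_int_inverse)
  ultimately show "((\<lambda>k. cnj (c (- k)) * z powi k) has_sum cnj (f z)) UNIV" by simp
qed

text \<open>Tonelli: for fixed \<open>l\<close> the inner sum over \<open>k\<close> is a translate
  of the sum for \<open>d\<close>. The pairs are ordered \<open>(k, l)\<close> in the result so that
  the inner sum over \<open>l\<close> is the convolution.\<close>

lemma convolution_pair:
  fixes c d :: "int \<Rightarrow> complex"
  assumes "c abs_summable_on UNIV" "d abs_summable_on UNIV"
  shows "(\<lambda>(k, l). c l * d (k - l)) abs_summable_on UNIV \<times> UNIV"
    and "((\<lambda>(k, l). cmod (c l * d (k - l))) has_sum (l1_norm c * l1_norm d)) (UNIV \<times> UNIV)"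
proof -
  have 1: "((\<lambda>(l, k). cmod (c l) * cmod (d (k - l))) has_sum (l1_norm c * l1_norm d)) (UNIV \<times> UNIV)"
  proof (rule has_sum_SigmaI)
    fix l :: int
    have bij: "bij_betw (\<lambda>k. k - l) UNIV UNIV"
      by (rule bij_betwI[of _ _ _ "\<lambda>k. k + l"]) auto
    have "((\<lambda>k. cmod (d k)) has_sum l1_norm d) UNIV"
      using assms by (simp add: l1_norm_def)
    hence "((\<lambda>k. cmod (d (k - l))) has_sum l1_norm d) UNIV"
      using has_sum_reindex_bij_betw[OF bij, of "\<lambda>k. cmod (d k)"] by simp
    hence *: "((\<lambda>k. cmod (c l) * cmod (d (k - l))) has_sum cmod (c l) * l1_norm d) UNIV"
      by (rule has_sum_cmult_right)
    thus "((\<lambda>k. case (l, k) of (l, k) \<Rightarrow> cmod (c l) * cmod (d (k - l))) has_sum cmod (c l) * l1_norm d) UNIV"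
      by simp
  next
    show s: "((\<lambda>l. cmod (c l) * l1_norm d) has_sum l1_norm c * l1_norm d) UNIV"
      using assms by (intro has_sum_cmult_left) (simp add: l1_norm_def)
    show "(\<lambda>(l, k). cmod (c l) * cmod (d (k - l))) summable_on UNIV \<times> UNIV"
    proof (rule summable_on_SigmaI)
      fix l :: int
      have bij: "bij_betw (\<lambda>k. k - l) UNIV UNIV"
        by (rule bij_betwI[of _ _ _ "\<lambda>k. k + l"]) auto
      have "((\<lambda>k. cmod (d k)) has_sum l1_norm d) UNIV"
        using assms by (simp add: l1_norm_def)
      hence "((\<lambda>k. cmod (d (k - l))) has_sum l1_norm d) UNIV"
        using has_sum_reindex_bij_betw[OF bij, of "\<lambda>k. cmod (d k)"] by simp
      hence *: "((\<lambda>k. cmod (c l) * cmod (d (k - l))) has_sum cmod (c l) * l1_norm d) UNIV"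
        by (rule has_sum_cmult_right)
      thus "((\<lambda>k. case (l, k) of (l, k) \<Rightarrow> cmod (c l) * cmod (d (k - l))) has_sum cmod (c l) * l1_norm d) UNIV"
        by simp
    qed (use s in \<open>auto simp: has_sum_iff\<close>)
  qed
  show "((\<lambda>(k, l). cmod (c l * d (k - l))) has_sum (l1_norm c * l1_norm d)) (UNIV \<times> UNIV)"
    using has_sum_swap[THEN iffD1, OF 1] by (simp add: norm_mult case_prod_unfold)
  thus "(\<lambda>(k, l). c l * d (k - l)) abs_summable_on UNIV \<times> UNIV"
    by (simp add: has_sum_iff case_prod_unfold)
qed

lemma convolution_abs_summable:
  fixes c d :: "int \<Rightarrow> complex"
  assumes "c abs_summable_on UNIV" "d abs_summable_on UNIV"
  shows "convolution c d abs_summable_on UNIV" "l1_norm (convolution c d) \<le> l1_norm c * l1_norm d"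
    "(\<lambda>l. c l * d (k - l)) abs_summable_on UNIV"
proof -
  note * = convolution_pair[OF assms]
  have 1: "(\<lambda>l. c l * d (k - l)) abs_summable_on UNIV" for k
    using *(1) by (auto simp: Infinite_Sum.abs_summable_on_Sigma_iff simp del: UNIV_Times_UNIV)
  thus "(\<lambda>l. c l * d (k - l)) abs_summable_on UNIV" .
  have 2: "((\<lambda>k. \<Sum>\<^sub>\<infinity>l. cmod (c l * d (k - l))) has_sum (l1_norm c * l1_norm d)) UNIV"
    using has_sum_Sigma'[OF *(2)] 1 by (auto simp: has_sum_infsum)
  have le: "cmod (convolution c d k) \<le> (\<Sum>\<^sub>\<infinity>l. cmod (c l * d (k - l)))" for k
    unfolding convolution_def by (rule norm_infsum_bound[OF 1])
  show 3: "convolution c d abs_summable_on UNIV"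
    using 2 le by (intro Infinite_Sum.abs_summable_on_comparison_test'[of "\<lambda>k. \<Sum>\<^sub>\<infinity>l. cmod (c l * d (k - l))"])
      (auto simp: has_sum_iff)
  show "l1_norm (convolution c d) \<le> l1_norm c * l1_norm d"
    unfolding l1_norm_def[of "convolution c d"]
    by (rule has_sum_mono[OF has_sum_infsum[OF 3] 2 le])
qed

text \<open>The absolutely summable family \<open>c l * d (k - l) * z powi k\<close> is summed in
  both orders: \<open>l\<close> first gives the convolution, \<open>k\<close> first gives
  \<open>c l * z powi l * g z\<close>.\<close>

lemma fourier_expansion_mult:
  assumes "fourier_expansion f c" "fourier_expansion g d"
  shows "fourier_expansion (\<lambda>z. f z * g z) (convolution c d)"
proof (rule fourier_expansionI)
  note abs = assms[THEN fourier_expansion_abs]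
  show "convolution c d abs_summable_on UNIV" by (rule convolution_abs_summable[OF abs])
  fix z assume z: "z \<in> unit_circle"
  let ?h = "\<lambda>(k, l). c l * d (k - l) * z powi k"
  have abs_h: "?h abs_summable_on UNIV \<times> UNIV"
    using convolution_pair(1)[OF abs] by (simp add: norm_mult norm_powi_circle[OF z] case_prod_unfold)
  hence sum_h: "?h summable_on UNIV \<times> UNIV" by (rule abs_summable_summable)
  define S where "S = infsum ?h (UNIV \<times> UNIV)"
  have S: "(?h has_sum S) (UNIV \<times> UNIV)" using sum_h by (simp add: S_def)
  have "((\<lambda>k. convolution c d k * z powi k) has_sum S) UNIV"
  proof (rule has_sum_Sigma'[OF S])
    fix k
    have "((\<lambda>l. c l * d (k - l)) has_sum convolution c d k) UNIV"
      unfolding convolution_def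
      by (rule has_sum_infsum[OF abs_summable_summable[OF convolution_abs_summable(3)[OF abs]]])
    from has_sum_cmult_left[OF this, of "z powi k"]
    show "((\<lambda>l. ?h (k, l)) has_sum convolution c d k * z powi k) UNIV" by simp
  qed
  moreover have "((\<lambda>l. c l * z powi l * g z) has_sum S) UNIV"
  proof (rule has_sum_Sigma'[where f = "\<lambda>(l, k). c l * d (k - l) * z powi k"])
    show "((\<lambda>(l, k). c l * d (k - l) * z powi k) has_sum S) (UNIV \<times> UNIV)"
      using has_sum_swap[THEN iffD1, OF S] by (simp add: case_prod_unfold)
    fix l
    have "((\<lambda>k. d (k - l) * z powi k) has_sum (z powi l * g z)) UNIV"
      by (rule fourier_expansion_has_sum[OF fourier_expansion_shift[OF assms(2)] z])
    from has_sum_cmult_right[OF this, of "c l"]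
    show "((\<lambda>k. case (l, k) of (l, k) \<Rightarrow> c l * d (k - l) * z powi k) has_sum c l * z powi l * g z) UNIV"
      by (simp add: mult_ac)
  qed
  hence "S = f z * g z"
    by (rule has_sum_unique) (rule has_sum_cmult_left[OF fourier_expansion_has_sum[OF assms(1) z]])
  ultimately show "((\<lambda>k. convolution c d k * z powi k) has_sum f z * g z) UNIV" by simp
qed

text \<open>Completeness of the Wiener algebra, by exchanging the sums over \<open>n\<close> and
  \<open>k\<close>. It serves for the exponential, logarithmic and geometric series.\<close>

lemma fourier_expansion_series:
  fixes f :: "nat \<Rightarrow> complex \<Rightarrow> complex" and c :: "nat \<Rightarrow> int \<Rightarrow> complex"
  assumes "\<And>n. fourier_expansion (f n) (c n)" and sum: "summable (\<lambda>n. l1_norm (c n))"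
  shows "fourier_expansion (\<lambda>z. \<Sum>n. f n z) (\<lambda>k. \<Sum>n. c n k)"
    and "z \<in> unit_circle \<Longrightarrow> summable (\<lambda>n. f n z)"
proof -
  have le: "cmod (c n k) \<le> l1_norm (c n)" for n k
  proof -
    have "(\<Sum>k\<in>{k}. cmod (c n k)) \<le> (\<Sum>\<^sub>\<infinity>k. cmod (c n k))"
      using assms(1)[of n] by (intro finite_sum_le_infsum) (auto simp: fourier_expansion_def)
    thus ?thesis by (simp add: l1_norm_def)
  qed
  have sum': "(\<lambda>n. l1_norm (c n)) summable_on UNIV"
    using sum l1_norm_nonneg by (simp add: summable_on_UNIV_nonneg_real_iff)
  have pair: "(\<lambda>(n, k). c n k) abs_summable_on UNIV \<times> UNIV"
    unfolding Infinite_Sum.abs_summable_on_Sigma_iff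
  proof (intro conjI ballI)
    have "(\<lambda>n. \<bar>l1_norm (c n)\<bar>) summable_on UNIV" using sum' l1_norm_nonneg by simp
    thus "(\<lambda>n. \<Sum>\<^sub>\<infinity>k. cmod (case (n, k) of (n, k) \<Rightarrow> c n k)) abs_summable_on UNIV"
      by (simp add: l1_norm_def)
  qed (use assms(1) in \<open>auto simp: fourier_expansion_def\<close>)
  have swap: "(\<lambda>(k, n). c n k) abs_summable_on UNIV \<times> UNIV"
    using pair summable_on_swap[of "\<lambda>(n, k). cmod (c n k)" UNIV UNIV] by (simp add: case_prod_unfold)
  have ck: "(\<lambda>n. c n k) abs_summable_on UNIV" for k
    using swap by (auto simp: Infinite_Sum.abs_summable_on_Sigma_iff simp del: UNIV_Times_UNIV)
  have ck': "((\<lambda>n. c n k) has_sum (\<Sum>n. c n k)) UNIV" for k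
    using norm_summable_imp_has_sum[OF summable_on_imp_summable[OF ck] summable_sums]
      summable_norm_cancel[OF summable_on_imp_summable[OF ck]] by blast
  have fz: "((\<lambda>n. f n z) has_sum (\<Sum>n. f n z)) UNIV" "summable (\<lambda>n. f n z)" if z: "z \<in> unit_circle" for z
  proof -
    have *: "summable (\<lambda>n. norm (f n z))"
      by (rule summable_comparison_test'[OF sum, of 0])
        (use fourier_expansion_norm_le[OF assms(1) z] in simp)
    show "summable (\<lambda>n. f n z)" by (rule summable_norm_cancel[OF *])
    thus "((\<lambda>n. f n z) has_sum (\<Sum>n. f n z)) UNIV"
      by (intro norm_summable_imp_has_sum[OF *] summable_sums)
  qed
  show "z \<in> unit_circle \<Longrightarrow> summable (\<lambda>n. f n z)" by (rule fz)
  show "fourier_expansion (\<lambda>z. \<Sum>n. f n z) (\<lambda>k. \<Sum>n. c n k)"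
  proof (rule fourier_expansionI)
    show "(\<lambda>k. \<Sum>n. c n k) abs_summable_on UNIV"
    proof (rule Infinite_Sum.abs_summable_on_comparison_test')
      show "(\<lambda>k. \<Sum>\<^sub>\<infinity>n. cmod (c n k)) summable_on UNIV"
        using swap by (auto simp: Infinite_Sum.abs_summable_on_Sigma_iff infsum_nonneg simp del: UNIV_Times_UNIV)
      show "cmod (\<Sum>n. c n k) \<le> (\<Sum>\<^sub>\<infinity>n. cmod (c n k))" for k
        using norm_infsum_bound[OF ck, of k] infsumI[OF ck', of k] by simp
    qed
    fix z assume z: "z \<in> unit_circle"
    let ?h = "\<lambda>(k, n). c n k * z powi k"
    have "?h abs_summable_on UNIV \<times> UNIV"
      using swap by (simp add: norm_mult norm_powi_circle[OF z] case_prod_unfold)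
    hence sum_h: "?h summable_on UNIV \<times> UNIV" by (rule abs_summable_summable)
    define S where "S = infsum ?h (UNIV \<times> UNIV)"
    have S: "(?h has_sum S) (UNIV \<times> UNIV)" using sum_h by (simp add: S_def)
    have "((\<lambda>k. (\<Sum>n. c n k) * z powi k) has_sum S) UNIV"
      using has_sum_cmult_left[OF ck'] by (intro has_sum_Sigma'[OF S]) auto
    moreover have "((\<lambda>n. f n z) has_sum S) UNIV"
    proof (rule has_sum_Sigma'[where f = "\<lambda>(n, k). c n k * z powi k"])
      show "((\<lambda>(n, k). c n k * z powi k) has_sum S) (UNIV \<times> UNIV)"
        using has_sum_swap[THEN iffD1, OF S] by (simp add: case_prod_unfold)
    qed (use fourier_expansion_has_sum[OF assms(1) z] in simp)
    hence "S = (\<Sum>n. f n z)" by (rule has_sum_unique) (rule fz(1)[OF z])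
    ultimately show "((\<lambda>k. (\<Sum>n. c n k) * z powi k) has_sum (\<Sum>n. f n z)) UNIV" by simp
  qed
qed

lemma l1_norm_add:
  assumes "c abs_summable_on UNIV" "d abs_summable_on UNIV"
  shows "l1_norm (\<lambda>k. c k + d k) \<le> l1_norm c + l1_norm d"
proof -
  have "(\<lambda>k. c k + d k) abs_summable_on UNIV"
    by (rule Infinite_Sum.abs_summable_on_comparison_test'[OF summable_on_add[OF assms]])
      (rule norm_triangle_ineq)
  hence "l1_norm (\<lambda>k. c k + d k) \<le> (\<Sum>\<^sub>\<infinity>k. cmod (c k) + cmod (d k))"
    unfolding l1_norm_def by (intro infsum_mono summable_on_add assms norm_triangle_ineq)
  also have "\<dots> = l1_norm c + l1_norm d"
    unfolding l1_norm_def using assms by (rule infsum_add)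
  finally show ?thesis .
qed

lemma l1_norm_cmult: "l1_norm (\<lambda>k. a * c k) = cmod a * l1_norm c"
  by (simp add: l1_norm_def norm_mult infsum_cmult_right')

lemma fourier_expansion_sum:
  assumes "finite A" "\<And>i. i \<in> A \<Longrightarrow> fourier_expansion (f i) (c i)"
  shows "fourier_expansion (\<lambda>z. \<Sum>i\<in>A. f i z) (\<lambda>k. \<Sum>i\<in>A. c i k)"
    and "l1_norm (\<lambda>k. \<Sum>i\<in>A. c i k) \<le> (\<Sum>i\<in>A. l1_norm (c i))"
proof -
  have "fourier_expansion (\<lambda>z. \<Sum>i\<in>A. f i z) (\<lambda>k. \<Sum>i\<in>A. c i k) \<and>
    l1_norm (\<lambda>k. \<Sum>i\<in>A. c i k) \<le> (\<Sum>i\<in>A. l1_norm (c i))"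
    using assms
  proof (induction A rule: finite_induct)
    case empty
    show ?case using fourier_expansion_const[of 0] by (simp add: l1_norm_def)
  next
    case (insert a A)
    hence IH: "fourier_expansion (\<lambda>z. \<Sum>i\<in>A. f i z) (\<lambda>k. \<Sum>i\<in>A. c i k)"
      "l1_norm (\<lambda>k. \<Sum>i\<in>A. c i k) \<le> (\<Sum>i\<in>A. l1_norm (c i))" by auto
    have a: "fourier_expansion (f a) (c a)" using insert by auto
    show ?case
      using fourier_expansion_add[OF a IH(1)] IH(2)
        l1_norm_add[OF fourier_expansion_abs[OF a] fourier_expansion_abs[OF IH(1)]] insert.hyps
      by simp
  qed
  thus "fourier_expansion (\<lambda>z. \<Sum>i\<in>A. f i z) (\<lambda>k. \<Sum>i\<in>A. c i k)"
    "l1_norm (\<lambda>k. \<Sum>i\<in>A. c i k) \<le> (\<Sum>i\<in>A. l1_norm (c i))" by auto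
qed

text \<open>A coefficient is the mean of \<open>z powi (-k) * f z\<close>, so the supremum bounds
  it, not just the larger \<open>l1_norm\<close>; the power estimate behind the logarithm depends on
  this.\<close>

lemma fourier_expansion_coeff_le:
  assumes "fourier_expansion f c" "\<And>z. z \<in> unit_circle \<Longrightarrow> cmod (f z) \<le> M"
  shows "cmod (c k) \<le> M"
proof -
  let ?I = "{0..0 + 2 * pi}"
  let ?g = "\<lambda>z. z powi (-k) * f z"
  note g = fourier_expansion_shift[OF assms(1), of "-k"]
  have "continuous_on ?I (\<lambda>x. ?g (cis x))"
    by (rule continuous_on_compose2[OF fourier_expansion_continuous[OF g]]) (auto intro!: continuous_intros)
  hence int: "set_integrable lborel ?I (\<lambda>x. ?g (cis x))"
    by (rule borel_integrable_atLeastAtMost')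
  have "2 * pi * cmod (c k) = cmod (LBINT x:?I. ?g (cis x))"
    unfolding fourier_expansion_integral[OF g] by (simp add: norm_mult)
  also have "\<dots> \<le> (LBINT x:?I. cmod (?g (cis x)))"
    by (rule set_integral_norm_bound[OF int])
  also have "\<dots> \<le> (LBINT x:?I. M)"
  proof (rule set_integral_mono)
    show "set_integrable lborel ?I (\<lambda>x. cmod (?g (cis x)))"
      by (rule set_integrable_norm[OF int])
    show "set_integrable lborel ?I (\<lambda>x. M)"
      by (intro borel_integrable_atLeastAtMost' continuous_intros)
    show "cmod (?g (cis x)) \<le> M" for x
      using assms(2)[of "cis x"] by (simp add: norm_mult norm_power_int)
  qed
  also have "\<dots> = 2 * pi * M" by (simp add: set_lebesgue_integral_def)
  finally show ?thesis by simp
qed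

section \<open>Spectral supports\<close>

text \<open>\<open>I\<close> is any set containing the spectrum, and membership in the Wiener
  algebra is included, so \<open>UNIV\<close> expresses that membership alone. With
  \<open>{0..}\<close> the function extends analytically to the disc; with \<open>{..0}\<close> it
  extends to the exterior, and its coefficient 0 is the value at infinity.\<close>

definition supported_on :: "(complex \<Rightarrow> complex) \<Rightarrow> int set \<Rightarrow> bool" where
  "supported_on f I \<longleftrightarrow> (\<exists>c. fourier_expansion f c \<and> (\<forall>k. k \<notin> I \<longrightarrow> c k = 0))"

lemma supported_on_cong:
  assumes "supported_on f I" "\<And>z. z \<in> unit_circle \<Longrightarrow> f z = g z"
  shows "supported_on g I"
proof -
  obtain c where c: "fourier_expansion f c" "\<forall>k. k \<notin> I \<longrightarrow> c k = 0"
    using assms(1) by (auto simp: supported_on_def)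
  have "fourier_expansion g c" by (rule fourier_expansion_cong[OF c(1) assms(2)])
  thus ?thesis using c(2) by (auto simp: supported_on_def)
qed

lemma
  assumes "supported_on f I"
  shows supported_on_expansion: "fourier_expansion f (fourier_coeff f)"
    and supported_on_coeff: "k \<notin> I \<Longrightarrow> fourier_coeff f k = 0"
proof -
  obtain c where c: "fourier_expansion f c" "\<And>k. k \<notin> I \<Longrightarrow> c k = 0"
    using assms by (auto simp: supported_on_def)
  hence "fourier_coeff f = c" by (intro ext fourier_coeff_eq)
  thus "fourier_expansion f (fourier_coeff f)" "k \<notin> I \<Longrightarrow> fourier_coeff f k = 0"
    using c by auto
qed

lemma supported_onI:
  assumes "supported_on f J" "\<And>k. k \<in> J \<Longrightarrow> k \<notin> I \<Longrightarrow> fourier_coeff f k = 0"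
  shows "supported_on f I"
  unfolding supported_on_def
proof (intro exI conjI allI impI)
  show "fourier_expansion f (fourier_coeff f)" by (rule supported_on_expansion[OF assms(1)])
  show "fourier_coeff f k = 0" if "k \<notin> I" for k
    using supported_on_coeff[OF assms(1)] assms(2) that by blast
qed

lemma supported_on_mono: "supported_on f J \<Longrightarrow> J \<subseteq> I \<Longrightarrow> supported_on f I"
  unfolding supported_on_def by blast

lemma supported_onI':
  assumes "fourier_expansion f c" "\<And>k. k \<notin> I \<Longrightarrow> c k = 0"
  shows "supported_on f I"
  using assms by (auto simp: supported_on_def)

lemma supported_on_add:
  assumes "supported_on f I" "supported_on g I"
  shows "supported_on (\<lambda>z. f z + g z) I"
  using assms[THEN supported_on_expansion]
  by (rule supported_onI'[OF fourier_expansion_add]) (simp add: assms[THEN supported_on_coeff])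

lemma supported_on_diff:
  assumes "supported_on f I" "supported_on g I"
  shows "supported_on (\<lambda>z. f z - g z) I"
  using assms[THEN supported_on_expansion]
  by (rule supported_onI'[OF fourier_expansion_diff]) (simp add: assms[THEN supported_on_coeff])

lemma supported_on_cmult:
  assumes "supported_on f I"
  shows "supported_on (\<lambda>z. a * f z) I"
  using assms[THEN supported_on_expansion]
  by (rule supported_onI'[OF fourier_expansion_cmult]) (simp add: supported_on_coeff[OF assms])

lemma supported_on_const: "0 \<in> I \<Longrightarrow> supported_on (\<lambda>z. a) I"
  by (rule supported_onI'[OF fourier_expansion_const]) auto

lemma supported_on_cnj:
  assumes "supported_on f I" "uminus ` I \<subseteq> J"
  shows "supported_on (\<lambda>z. cnj (f z)) J"
proof (rule supported_onI'[OF fourier_expansion_cnj[OF supported_on_expansion[OF assms(1)]]])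
  fix k assume "k \<notin> J"
  hence "- k \<notin> I" using assms(2) by force
  thus "cnj (fourier_coeff f (- k)) = 0" using supported_on_coeff[OF assms(1)] by simp
qed

lemma supported_on_shift:
  assumes "supported_on f I" "(\<lambda>k. k + m) ` I \<subseteq> J"
  shows "supported_on (\<lambda>z. z powi m * f z) J"
proof (rule supported_onI'[OF fourier_expansion_shift[OF supported_on_expansion[OF assms(1)]]])
  fix k assume "k \<notin> J"
  hence "k - m \<notin> I" using assms(2) by force
  thus "fourier_coeff f (k - m) = 0" using supported_on_coeff[OF assms(1)] by simp
qed

lemma supported_on_mult:
  assumes "supported_on f I" "supported_on g J" "\<And>i j. i \<in> I \<Longrightarrow> j \<in> J \<Longrightarrow> i + j \<in> K"
  shows "supported_on (\<lambda>z. f z * g z) K"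
proof -
  obtain c d where cd: "fourier_expansion f c" "fourier_expansion g d"
    "\<And>k. k \<notin> I \<Longrightarrow> c k = 0" "\<And>k. k \<notin> J \<Longrightarrow> d k = 0"
    using assms(1,2) by (auto simp: supported_on_def)
  have "convolution c d k = 0" if "k \<notin> K" for k
  proof -
    have "c l * d (k - l) = 0" for l
      using assms(3)[of l "k - l"] cd(3,4) that by auto
    thus ?thesis unfolding convolution_def by (intro infsum_0)
  qed
  thus ?thesis using fourier_expansion_mult[OF cd(1,2)] by (auto simp: supported_on_def)
qed

lemma supported_on_power:
  assumes "supported_on f I" "0 \<in> I" "\<And>i j. i \<in> I \<Longrightarrow> j \<in> I \<Longrightarrow> i + j \<in> I"
  shows "supported_on (\<lambda>z. f z ^ n) I"
proof (induction n)
  case (Suc n)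
  thus ?case using supported_on_mult[OF assms(1) Suc assms(3)] by simp
qed (use supported_on_const[OF assms(2)] in simp)

lemma fourier_coeff_mult:
  assumes "supported_on f I" "supported_on g J"
  shows "((\<lambda>l. fourier_coeff f l * fourier_coeff g (k - l)) has_sum fourier_coeff (\<lambda>z. f z * g z) k) UNIV"
proof -
  note e = assms[THEN supported_on_expansion]
  have "fourier_coeff (\<lambda>z. f z * g z) k = convolution (fourier_coeff f) (fourier_coeff g) k"
    by (rule fourier_coeff_eq[OF fourier_expansion_mult[OF e]])
  moreover have "(\<lambda>l. fourier_coeff f l * fourier_coeff g (k - l)) summable_on UNIV"
    by (rule abs_summable_summable[OF convolution_abs_summable(3)[OF e[THEN fourier_expansion_abs]]])
  ultimately show ?thesis by (simp add: convolution_def)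
qed

text \<open>With indices at most 0 in both factors, only the pair of zeros adds up to 0: the value
  at infinity is multiplicative.\<close>

lemma fourier_coeff_mult_nonpos:
  assumes "supported_on f {..0}" "supported_on g {..0}"
  shows "fourier_coeff (\<lambda>z. f z * g z) 0 = fourier_coeff f 0 * fourier_coeff g 0"
proof -
  have "fourier_coeff f l * fourier_coeff g (0 - l) = 0" if "l \<noteq> 0" for l
    using supported_on_coeff[OF assms(1), of l] supported_on_coeff[OF assms(2), of "-l"] that
    by (cases "l > 0") auto
  hence "((\<lambda>l. fourier_coeff f l * fourier_coeff g (0 - l)) has_sum fourier_coeff f 0 * fourier_coeff g (0 - 0)) UNIV"
    by (intro has_sum_finite_neutralI[of "{0}"]) auto
  from has_sum_unique[OF fourier_coeff_mult[OF assms, of 0] this] show ?thesis by simp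
qed

lemma fourier_expansion_power:
  assumes "fourier_expansion f c"
  shows "\<exists>d. fourier_expansion (\<lambda>z. f z ^ n) d \<and> l1_norm d \<le> l1_norm c ^ n"
proof (induction n)
  case 0
  have "l1_norm (\<lambda>k. if k = 0 then 1 else 0) = (\<Sum>\<^sub>\<infinity>k\<in>{0::int}. 1)"
    unfolding l1_norm_def by (rule infsum_cong_neutral) auto
  thus ?case using fourier_expansion_const[of 1]
    by (intro exI[of _ "\<lambda>k. if k = 0 then 1 else 0"]) auto
next
  case (Suc n)
  then obtain d where d: "fourier_expansion (\<lambda>z. f z ^ n) d" "l1_norm d \<le> l1_norm c ^ n" by auto
  have "l1_norm (convolution c d) \<le> l1_norm c * l1_norm d"
    by (intro convolution_abs_summable fourier_expansion_abs[OF assms] fourier_expansion_abs[OF d(1)])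
  also have "\<dots> \<le> l1_norm c * l1_norm c ^ n"
    by (intro mult_left_mono d l1_norm_nonneg)
  finally show ?case using fourier_expansion_mult[OF assms d(1)] by auto
qed

text \<open>The exponential series converges in \<open>l1_norm\<close> by submultiplicativity, and
  the powers of \<open>f\<close> stay supported on \<open>I\<close> because \<open>I\<close> is
  closed under addition. With \<open>{0..}\<close> this keeps the exponential of an analytic
  function analytic.\<close>

lemma supported_on_exp:
  assumes f: "supported_on f I" and I: "0 \<in> I" "\<And>i j. i \<in> I \<Longrightarrow> j \<in> I \<Longrightarrow> i + j \<in> I"
  shows "supported_on (\<lambda>z. exp (f z)) I"
proof -
  note e = supported_on_expansion[OF f]
  let ?C = "l1_norm (fourier_coeff f)"
  obtain d where d: "\<And>n. fourier_expansion (\<lambda>z. f z ^ n) (d n)" "\<And>n. l1_norm (d n) \<le> ?C ^ n"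
    using fourier_expansion_power[OF e] by metis
  have d0: "d n k = 0" if "k \<notin> I" for n k
    using supported_on_coeff[OF supported_on_power[OF assms] that] fourier_coeff_eq[OF d(1)] by metis
  have d': "fourier_expansion (\<lambda>z. (1 / fact n) * f z ^ n) (\<lambda>k. (1 / fact n) * d n k)" for n
    by (rule fourier_expansion_cmult[OF d(1)])
  have "summable (\<lambda>n. l1_norm (\<lambda>k. (1 / fact n) * d n k))"
  proof (rule summable_comparison_test'[OF summable_exp_generic[of ?C]])
    show "norm (l1_norm (\<lambda>k. (1 / fact n) * d n k)) \<le> ?C ^ n /\<^sub>R fact n" for n
      using d(2)[of n] l1_norm_nonneg[of "d n"]
      by (simp only: l1_norm_cmult) (simp add: norm_divide divide_simps)
  qed
  from fourier_expansion_series(1)[OF d' this]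
  have "fourier_expansion (\<lambda>z. \<Sum>n. 1 / fact n * f z ^ n) (\<lambda>k. \<Sum>n. 1 / fact n * d n k)" .
  hence "fourier_expansion (\<lambda>z. exp (f z)) (\<lambda>k. \<Sum>n. 1 / fact n * d n k)"
    by (simp add: exp_def scaleR_conv_of_real field_simps)
  thus ?thesis unfolding supported_on_def using d0 by (intro exI conjI) auto
qed

section \<open>The logarithm of a positive function\<close>

text \<open>The power has at most \<open>2 * D * n + 1\<close> nonzero coefficients, each bounded by
  its supremum, hence by \<open>M ^ n\<close>.\<close>

lemma trig_poly_power_norm:
  assumes "fourier_expansion p c" "\<And>k. \<bar>k\<bar> > int D \<Longrightarrow> c k = 0"
    and M: "\<And>z. z \<in> unit_circle \<Longrightarrow> cmod (p z) \<le> M"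
  shows "\<exists>d. fourier_expansion (\<lambda>z. p z ^ n) d \<and> l1_norm d \<le> real (2 * D * n + 1) * M ^ n"
proof -
  have "supported_on (\<lambda>z. p z ^ n) {-int (D * n)..int (D * n)}"
  proof (induction n)
    case (Suc n)
    have "supported_on p {-int D..int D}"
      unfolding supported_on_def using assms(1,2) by fastforce
    from supported_on_mult[OF this Suc, of "{-int (D * Suc n)..int (D * Suc n)}"]
    show ?case by (auto simp: algebra_simps)
  qed (use supported_on_const in auto)
  then obtain d where d: "fourier_expansion (\<lambda>z. p z ^ n) d" "\<And>k. k \<notin> {-int (D * n)..int (D * n)} \<Longrightarrow> d k = 0"
    by (auto simp: supported_on_def)
  have "l1_norm d = (\<Sum>\<^sub>\<infinity>k\<in>{-int (D * n)..int (D * n)}. cmod (d k))"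
    unfolding l1_norm_def by (rule infsum_cong_neutral) (use d in auto)
  also have "\<dots> = (\<Sum>k\<in>{-int (D * n)..int (D * n)}. cmod (d k))" by simp
  also have "\<dots> \<le> (\<Sum>k\<in>{-int (D * n)..int (D * n)}. M ^ n)"
    by (intro sum_mono fourier_expansion_coeff_le[OF d(1)]) (auto simp: norm_power intro!: power_mono M)
  also have "\<dots> = real (2 * D * n + 1) * M ^ n" by simp
  finally show ?thesis using d(1) by (intro exI[of _ d] conjI)
qed

text \<open>Write \<open>g = p + h\<close> with a trigonometric polynomial \<open>p\<close> and \<open>h\<close> of small norm.  Coefficients are
  bounded by the supremum, so the norm of \<open>p ^ i\<close> exceeds its supremum by a factor linear in \<open>i\<close> only.\<close>

lemma power_norm_summable:
  assumes g: "fourier_expansion g c" and r: "\<And>z. z \<in> unit_circle \<Longrightarrow> cmod (g z) \<le> r" "0 \<le> r" "r < 1"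
  shows "\<exists>d. (\<forall>n. fourier_expansion (\<lambda>z. g z ^ n) (d n)) \<and> summable (\<lambda>n. l1_norm (d n))"
proof -
  \<comment> \<open>Chosen so that \<open>r + 2 * \<eta> = (1 + r) / 2 < 1\<close>: one \<eta> is
    lost in the supremum of \<open>p\<close>, the other in the norm of the remainder.\<close>
  define \<eta> where "\<eta> = (1 - r) / 4"
  have \<eta>: "\<eta> > 0" using r by (simp add: \<eta>_def)
  note abs = fourier_expansion_abs[OF g]
  obtain X where X: "finite X" "dist (\<Sum>k\<in>X. cmod (c k)) (\<Sum>\<^sub>\<infinity>k. cmod (c k)) \<le> \<eta>"
    using infsum_finite_approximation[OF abs \<eta>] by auto
  define D where "D = Max (insert 0 ((\<lambda>k. nat \<bar>k\<bar>) ` X))"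
  have D: "\<bar>k\<bar> \<le> int D" if "k \<in> X" for k
  proof -
    have "nat \<bar>k\<bar> \<le> D" unfolding D_def using X that by (intro Max_ge) auto
    thus ?thesis by linarith
  qed
  define p where "p = (\<lambda>z. \<Sum>k\<in>X. c k * z powi k)"
  define cp where "cp = (\<lambda>k. if k \<in> X then c k else 0)"
  define ch where "ch = (\<lambda>k. if k \<in> X then 0 else c k)"
  have p: "fourier_expansion p cp"
  proof (rule fourier_expansionI)
    show "cp abs_summable_on UNIV"
      by (rule Infinite_Sum.abs_summable_on_comparison_test'[OF abs]) (auto simp: cp_def)
    show "((\<lambda>k. cp k * z powi k) has_sum p z) UNIV" for z
      by (rule has_sum_finite_neutralI[OF X(1)]) (auto simp: cp_def p_def)
  qed
  have h: "fourier_expansion (\<lambda>z. g z - p z) ch"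
    using fourier_expansion_diff[OF g p] by (simp add: cp_def ch_def if_distrib cong: if_cong)
  have h_norm: "l1_norm ch \<le> \<eta>"
  proof -
    have "(\<Sum>\<^sub>\<infinity>k. cmod (c k)) = l1_norm ch + (\<Sum>k\<in>X. cmod (c k))"
    proof -
      have "(\<Sum>\<^sub>\<infinity>k. cmod (c k)) = (\<Sum>\<^sub>\<infinity>k. cmod (ch k) + cmod (cp k))"
        by (rule infsum_cong) (auto simp: ch_def cp_def)
      also have "\<dots> = l1_norm ch + (\<Sum>\<^sub>\<infinity>k. cmod (cp k))"
        unfolding l1_norm_def by (rule infsum_add[OF fourier_expansion_abs[OF h] fourier_expansion_abs[OF p]])
      also have "(\<Sum>\<^sub>\<infinity>k. cmod (cp k)) = (\<Sum>\<^sub>\<infinity>k\<in>X. cmod (c k))"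
        by (rule infsum_cong_neutral) (auto simp: cp_def)
      finally show ?thesis using X by simp
    qed
    thus ?thesis using X(2) by (simp add: dist_real_def)
  qed
  have pM: "cmod (p z) \<le> r + \<eta>" if "z \<in> unit_circle" for z
  proof -
    have "cmod (p z) \<le> cmod (g z) + cmod (g z - p z)"
      by (metis norm_triangle_sub norm_minus_commute)
    thus ?thesis using r(1)[OF that] fourier_expansion_norm_le[OF h that] h_norm by simp
  qed
  have "\<exists>d. fourier_expansion (\<lambda>z. p z ^ n) d \<and> l1_norm d \<le> real (2 * D * n + 1) * (r + \<eta>) ^ n" for n
    by (rule trig_poly_power_norm[OF p _ pM]) (use D in \<open>force simp: cp_def\<close>)
  then obtain dp where dp: "\<And>n. fourier_expansion (\<lambda>z. p z ^ n) (dp n)"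
      "\<And>n. l1_norm (dp n) \<le> real (2 * D * n + 1) * (r + \<eta>) ^ n"
    by metis
  obtain dh where dh: "\<And>n. fourier_expansion (\<lambda>z. (g z - p z) ^ n) (dh n)"
      "\<And>n. l1_norm (dh n) \<le> l1_norm ch ^ n"
    using fourier_expansion_power[OF h] by metis
  define d where "d = (\<lambda>n k. \<Sum>i\<le>n. of_nat (n choose i) * convolution (dp i) (dh (n - i)) k)"
  have summand: "fourier_expansion (\<lambda>z. of_nat (n choose i) * (p z ^ i * (g z - p z) ^ (n - i)))
      (\<lambda>k. of_nat (n choose i) * convolution (dp i) (dh (n - i)) k)" for n i
    by (intro fourier_expansion_cmult fourier_expansion_mult dp dh)
  have 1: "fourier_expansion (\<lambda>z. g z ^ n) (d n)" for n
  proof -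
    have "g z ^ n = (\<Sum>i\<le>n. of_nat (n choose i) * (p z ^ i * (g z - p z) ^ (n - i)))" for z
      using binomial_ring[of "p z" "g z - p z" n] by (simp add: mult.assoc)
    thus ?thesis unfolding d_def using fourier_expansion_sum(1)[OF finite_atMost[of n] summand] by simp
  qed
  \<comment> \<open>The factor linear in \<open>i\<close> is bounded by
    \<open>(2 * D + 1) * Suc n\<close> for all \<open>i \<le> n\<close>; the binomial theorem sums
    the rest to \<open>((r + \<eta>) + \<eta>) ^ n\<close>.\<close>
  have 2: "l1_norm (d n) \<le> real (2 * D + 1) * (of_nat (Suc n) * (r + 2 * \<eta>) ^ n)" for n
  proof -
    have "l1_norm (d n) \<le> (\<Sum>i\<le>n. l1_norm (\<lambda>k. of_nat (n choose i) * convolution (dp i) (dh (n - i)) k))"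
      unfolding d_def by (rule fourier_expansion_sum(2)[OF finite_atMost summand])
    also have "\<dots> \<le> (\<Sum>i\<le>n. of_nat (n choose i) * ((real (2 * D + 1) * of_nat (Suc n) * (r + \<eta>) ^ i) * \<eta> ^ (n - i)))"
    proof (rule sum_mono)
      fix i assume i: "i \<in> {..n}"
      have "l1_norm (convolution (dp i) (dh (n - i))) \<le> l1_norm (dp i) * l1_norm (dh (n - i))"
        by (intro convolution_abs_summable fourier_expansion_abs[OF dp(1)] fourier_expansion_abs[OF dh(1)])
      also have "\<dots> \<le> (real (2 * D * i + 1) * (r + \<eta>) ^ i) * l1_norm ch ^ (n - i)"
        using r \<eta> by (intro mult_mono dp dh l1_norm_nonneg) auto
      also have "\<dots> \<le> (real (2 * D + 1) * of_nat (Suc n) * (r + \<eta>) ^ i) * \<eta> ^ (n - i)"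
      proof (intro mult_mono power_mono h_norm l1_norm_nonneg)
        have "2 * D * i \<le> 2 * D * n" using i by (intro mult_le_mono2) simp
        moreover have "(2 * D + 1) * Suc n = 2 * D * n + 2 * D + n + 1" by simp
        ultimately have "2 * D * i + 1 \<le> (2 * D + 1) * Suc n" by linarith
        hence "real (2 * D * i + 1) \<le> real ((2 * D + 1) * Suc n)" by (simp only: of_nat_le_iff)
        thus "real (2 * D * i + 1) \<le> real (2 * D + 1) * real (Suc n)"
          by (simp only: of_nat_mult)
      qed (use r \<eta> l1_norm_nonneg in auto)
      finally show "l1_norm (\<lambda>k. of_nat (n choose i) * convolution (dp i) (dh (n - i)) k)
        \<le> of_nat (n choose i) * ((real (2 * D + 1) * of_nat (Suc n) * (r + \<eta>) ^ i) * \<eta> ^ (n - i))"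
        by (simp only: l1_norm_cmult norm_of_nat) (rule mult_left_mono, simp_all)
    qed
    also have "\<dots> = real (2 * D + 1) * of_nat (Suc n) * (\<Sum>i\<le>n. of_nat (n choose i) * (r + \<eta>) ^ i * \<eta> ^ (n - i))"
      by (simp only: sum_distrib_left mult_ac)
    also have "(\<Sum>i\<le>n. of_nat (n choose i) * (r + \<eta>) ^ i * \<eta> ^ (n - i)) = (r + 2 * \<eta>) ^ n"
      using binomial_ring[of "r + \<eta>" \<eta> n] by (simp add: algebra_simps)
    finally show ?thesis by (simp only: mult.assoc)
  qed
  have "summable (\<lambda>n. real (2 * D + 1) * (of_nat (Suc n) * (r + 2 * \<eta>) ^ n))"
    using geometric_deriv_sums[of "r + 2 * \<eta>"] r by (intro summable_mult) (auto simp: sums_iff \<eta>_def field_simps)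
  hence "summable (\<lambda>n. l1_norm (d n))"
    by (rule summable_comparison_test'[of _ 0]) (use 2 l1_norm_nonneg in auto)
  thus ?thesis using 1 by blast
qed

text \<open>This is the Wiener--Levy theorem for the logarithm. After division by the maximum, the
  logarithm is a power series in \<open>1 - w z / w b\<close>, whose supremum is below 1 because
  \<open>w\<close> has a positive minimum; \<open>power_norm_summable\<close> gives convergence in
  the Wiener norm.\<close>

lemma supported_on_ln:
  fixes w :: "complex \<Rightarrow> real"
  assumes pos: "\<And>z. z \<in> unit_circle \<Longrightarrow> w z > 0"
    and w: "supported_on (\<lambda>z. complex_of_real (w z)) UNIV"
  shows "supported_on (\<lambda>z. complex_of_real (ln (w z))) UNIV"
proof -
  obtain c where c: "fourier_expansion (\<lambda>z. complex_of_real (w z)) c"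
    using w by (auto simp: supported_on_def)
  have "continuous_on unit_circle (\<lambda>z. Re (complex_of_real (w z)))"
    by (intro continuous_intros fourier_expansion_continuous[OF c])
  hence cont: "continuous_on unit_circle w" by simp
  have "(1::complex) \<in> unit_circle" by simp
  hence ne: "unit_circle \<noteq> {}" by blast
  obtain a where a: "a \<in> unit_circle" "\<And>z. z \<in> unit_circle \<Longrightarrow> w a \<le> w z"
    using continuous_attains_inf[OF _ ne cont] by auto
  obtain b where b: "b \<in> unit_circle" "\<And>z. z \<in> unit_circle \<Longrightarrow> w z \<le> w b"
    using continuous_attains_sup[OF _ ne cont] by auto
  define g where "g = (\<lambda>z. 1 - complex_of_real (w z) * (1 / w b))"
  have wb: "w b > 0" using pos b by auto
  have "fourier_expansion (\<lambda>z. 1 - complex_of_real (1 / w b) * complex_of_real (w z))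
      (\<lambda>k. (if k = 0 then 1 else 0) - complex_of_real (1 / w b) * c k)"
    by (intro fourier_expansion_diff fourier_expansion_const fourier_expansion_cmult c)
  hence g: "fourier_expansion g (\<lambda>k. (if k = 0 then 1 else 0) - complex_of_real (1 / w b) * c k)"
    by (simp add: g_def mult.commute)
  have g_eq: "g z = of_real (1 - w z / w b)" for z by (simp add: g_def)
  obtain d where d: "\<And>n. fourier_expansion (\<lambda>z. g z ^ n) (d n)" and sd: "summable (\<lambda>n. l1_norm (d n))"
  proof -
    have "cmod (g z) \<le> 1 - w a / w b" if "z \<in> unit_circle" for z
      unfolding g_eq norm_of_real using a(2)[OF that] b(2)[OF that] wb by (simp add: divide_right_mono)
    moreover have "0 \<le> 1 - w a / w b" "1 - w a / w b < 1"
      using a b(2)[OF a(1)] wb pos[OF a(1)] by auto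
    ultimately show ?thesis using power_norm_summable[OF g, of "1 - w a / w b"] that by blast
  qed
  have t: "fourier_expansion (\<lambda>z. (- 1 / of_nat (Suc n)) * g z ^ Suc n) (\<lambda>k. (- 1 / of_nat (Suc n)) * d (Suc n) k)" for n
    by (intro fourier_expansion_cmult d)
  have "summable (\<lambda>n. l1_norm (\<lambda>k. (- 1 / of_nat (Suc n)) * d (Suc n) k))"
  proof (rule summable_comparison_test'[OF summable_Suc_iff[THEN iffD2, OF sd]])
    show "norm (l1_norm (\<lambda>k. (- 1 / of_nat (Suc n)) * d (Suc n) k)) \<le> l1_norm (d (Suc n))" for n
      by (simp only: l1_norm_cmult norm_divide norm_minus_cancel norm_of_nat norm_one)
        (simp add: divide_simps l1_norm_nonneg distrib_left)
  qed
  from fourier_expansion_series(1)[OF t this]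
  have s: "supported_on (\<lambda>z. \<Sum>n. (- 1 / of_nat (Suc n)) * g z ^ Suc n) UNIV"
    by (auto simp: supported_on_def)
  have "supported_on (\<lambda>z. complex_of_real (ln (w b)) + (\<Sum>n. (- 1 / of_nat (Suc n)) * g z ^ Suc n)) UNIV"
    by (intro supported_on_add s supported_on_const) auto
  thus ?thesis
  proof (rule supported_on_cong)
    fix z assume z: "z \<in> unit_circle"
    let ?x = "w z / w b"
    have x: "0 < ?x" "?x \<le> 1" using pos[OF z] wb b(2)[OF z] by auto
    have eq: "(-1) ^ n * (1 / real (n + 1)) * (?x - 1) ^ Suc n = (- 1 / real (Suc n)) * (1 - ?x) ^ Suc n" for n
    proof -
      have "(?x - 1) ^ Suc n = (- 1) ^ Suc n * (1 - ?x) ^ Suc n"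
        by (subst power_mult_distrib[symmetric]) simp
      thus ?thesis by (simp add: power_mult_distrib[symmetric])
    qed
    have "ln ?x = (\<Sum>n. (- 1 / real (Suc n)) * (1 - ?x) ^ Suc n)"
      using ln_series[of ?x] x unfolding eq by simp
    moreover have "summable (\<lambda>n. (- 1 / real (Suc n)) * (1 - ?x) ^ Suc n)"
    proof (rule summable_comparison_test'[of "\<lambda>n. (1 - ?x) ^ Suc n" 0])
      show "summable (\<lambda>n. (1 - ?x) ^ Suc n)"
        using x by (subst summable_Suc_iff) (simp add: summable_geometric_iff abs_if)
      have le: "norm ((- 1 / real (Suc n)) * t ^ Suc n) \<le> t ^ Suc n" if "t \<ge> 0" for n and t :: real
      proof -
        have "norm ((- 1 / real (Suc n)) * t ^ Suc n) = (1 / real (Suc n)) * t ^ Suc n"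
          using that by (simp add: abs_mult power_abs)
        also have "\<dots> \<le> 1 * t ^ Suc n"
          by (intro mult_right_mono) (use that in auto)
        finally show ?thesis by simp
      qed
      show "norm ((- 1 / real (Suc n)) * (1 - ?x) ^ Suc n) \<le> (1 - ?x) ^ Suc n" for n
        by (rule le) (use x in simp)
    qed
    ultimately have "complex_of_real (ln ?x) = (\<Sum>n. complex_of_real ((- 1 / real (Suc n)) * (1 - ?x) ^ Suc n))"
      by (simp only: suminf_of_real)
    also have "\<dots> = (\<Sum>n. (- 1 / of_nat (Suc n)) * g z ^ Suc n)"
      unfolding g_eq by (intro suminf_cong) simp
    finally have L: "complex_of_real (ln ?x) = (\<Sum>n. (- 1 / of_nat (Suc n)) * g z ^ Suc n)" .
    show "complex_of_real (ln (w b)) + (\<Sum>n. (- 1 / of_nat (Suc n)) * g z ^ Suc n) = complex_of_real (ln (w z))"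
      unfolding L[symmetric] using pos[OF z] wb by (simp add: ln_div)
  qed
qed

section \<open>The Szego function\<close>

text \<open>The kernel is expanded in powers of \<open>q * z powi m\<close>, and the term of order
  \<open>n\<close> picks coefficient \<open>- m * int n\<close>. The Szego function needs
  \<open>m = -1\<close>, \<open>q = z\<close> inside the circle and \<open>m = 1\<close>,
  \<open>q = inverse z\<close> outside.\<close>

lemma fourier_expansion_geometric_integral:
  fixes q :: complex and m :: int
  assumes f: "fourier_expansion f c" and q: "cmod q < 1"
  shows "(LBINT x:{a..a + 2 * pi}. f (cis x) / (1 - q * cis x powi m)) =
    2 * pi * (\<Sum>n. q ^ n * c (- m * int n))"
proof -
  let ?g = "\<lambda>n z. q ^ n * (z powi (m * int n) * f z)"
  let ?d = "\<lambda>n k. q ^ n * c (k - m * int n)"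
  have g: "fourier_expansion (?g n) (?d n)" for n
    by (intro fourier_expansion_cmult fourier_expansion_shift f)
  have norm_shift: "l1_norm (\<lambda>k. c (k - j)) = l1_norm c" for j
    unfolding l1_norm_def
    by (rule infsum_reindex_bij_betw[of "\<lambda>k. k - j" UNIV UNIV "\<lambda>k. cmod (c k)"])
      (rule bij_betwI[of _ _ _ "\<lambda>k. k + j"], auto)
  have "l1_norm (?d n) = cmod q ^ n * l1_norm c" for n
    by (simp only: l1_norm_cmult norm_shift norm_power)
  hence "summable (\<lambda>n. l1_norm (?d n))"
    using q by (simp only:) (intro summable_mult2 summable_geometric, simp)
  note fourier_expansion_series(1)[OF g this]
  moreover have "(\<Sum>n. ?g n z) = f z / (1 - q * z powi m)" if z: "z \<in> unit_circle" for z
  proof -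
    have "cmod (q * z powi m) < 1" using q by (simp add: norm_mult norm_powi_circle[OF z])
    hence "(\<lambda>n. (q * z powi m) ^ n * f z) sums (1 / (1 - q * z powi m) * f z)"
      by (intro sums_mult2 geometric_sums)
    moreover have "(q * z powi m) ^ n * f z = ?g n z" for n
      by (simp add: power_mult_distrib power_int_mult)
    ultimately show ?thesis by (simp add: sums_iff)
  qed
  ultimately have "fourier_expansion (\<lambda>z. f z / (1 - q * z powi m)) (\<lambda>k. \<Sum>n. ?d n k)"
    by (rule fourier_expansion_cong)
  from fourier_expansion_integral[OF this, of a] show ?thesis by simp
qed

text \<open>Absolute summability gives uniform convergence up to and including 1, by the
  M-test.\<close>

lemma abel_limit:
  fixes a :: "nat \<Rightarrow> complex"
  assumes "summable (\<lambda>n. cmod (a n))"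
  shows "((\<lambda>r::real. \<Sum>n. a n * of_real r ^ n) \<longlongrightarrow> (\<Sum>n. a n)) (at_left 1)"
proof -
  have "continuous_on {0..1} (\<lambda>r::real. \<Sum>n. a n * of_real r ^ n)"
  proof (rule uniform_limit_theorem)
    show "uniform_limit {0..1} (\<lambda>N r. \<Sum>n<N. a n * complex_of_real r ^ n) (\<lambda>r. \<Sum>n. a n * of_real r ^ n) sequentially"
    proof (rule Weierstrass_m_test[OF _ assms])
      fix n and r :: real assume "r \<in> {0..1}"
      thus "cmod (a n * of_real r ^ n) \<le> cmod (a n)"
        by (simp add: norm_mult norm_power mult_left_le power_le_one)
    qed
  qed (auto intro!: always_eventually continuous_intros)
  from this[unfolded continuous_on_def, rule_format, of 1] show ?thesis by (simp add: at_within_Icc_at_left)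
qed

lemma supported_on_analytic_part:
  assumes "fourier_expansion f c"
  shows "fourier_expansion (\<lambda>z. \<Sum>n. c (int n) * z ^ n) (\<lambda>k. if k \<ge> 0 then c k else 0)"
    and "summable (\<lambda>n. cmod (c (int n)))"
proof -
  note abs = fourier_expansion_abs[OF assms]
  have range: "range int = {0..}" by (auto intro: image_eqI[of _ int "nat _"])
  have "(\<lambda>k. cmod (c k)) summable_on range int"
    by (rule summable_on_subset_banach[OF abs]) simp
  hence s: "(\<lambda>n. cmod (c (int n))) summable_on UNIV"
    by (subst (asm) summable_on_reindex) (auto simp: o_def)
  show s': "summable (\<lambda>n. cmod (c (int n)))"
    by (rule summable_on_imp_summable[OF s])
  show "fourier_expansion (\<lambda>z. \<Sum>n. c (int n) * z ^ n) (\<lambda>k. if k \<ge> 0 then c k else 0)"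
  proof (rule fourier_expansionI)
    show "(\<lambda>k. if k \<ge> 0 then c k else 0) abs_summable_on UNIV"
      by (rule Infinite_Sum.abs_summable_on_comparison_test'[OF abs]) auto
    fix z assume z: "z \<in> unit_circle"
    have n: "summable (\<lambda>n. cmod (c (int n) * z ^ n))"
      using s' z by (simp add: norm_mult norm_power)
    have "((\<lambda>n. c (int n) * z ^ n) has_sum (\<Sum>n. c (int n) * z ^ n)) UNIV"
      by (rule norm_summable_imp_has_sum[OF n summable_sums[OF summable_norm_cancel[OF n]]])
    hence "((\<lambda>k. c k * z powi k) has_sum (\<Sum>n. c (int n) * z ^ n)) (range int)"
      by (subst has_sum_reindex) (auto simp: o_def)
    thus "((\<lambda>k. (if k \<ge> 0 then c k else 0) * z powi k) has_sum (\<Sum>n. c (int n) * z ^ n)) UNIV"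
      unfolding range by (rule has_sum_cong_neutral[THEN iffD1, rotated -1]) auto
  qed
qed

text \<open>\<open>G\<close> is half the mean of \<open>ln w\<close> plus the part of its expansion
  with positive indices. Both branches of the Szego function are computed as power series and taken
  to the circle by Abel limits; the boundary values are \<open>exp (G z)\<close> from inside and
  \<open>exp (- cnj (G z))\<close> from outside.\<close>

lemma szego_factorization:
  fixes w :: "complex \<Rightarrow> real"
  assumes pos: "\<And>z. z \<in> unit_circle \<Longrightarrow> w z > 0"
    and w: "supported_on (\<lambda>z. complex_of_real (w z)) UNIV"
  obtains G where "supported_on G {0..}"
    "\<And>z. z \<in> unit_circle \<Longrightarrow> complex_of_real (w z) = exp (G z + cnj (G z))"
    "\<And>z. z \<in> unit_circle \<Longrightarrow> scattering w z = exp (G z - cnj (G z))"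
proof -
  define f where "f = (\<lambda>z. complex_of_real (ln (w z)))"
  define c where "c = fourier_coeff f"
  have f: "fourier_expansion f c"
    unfolding f_def c_def by (rule supported_on_expansion[OF supported_on_ln[OF pos w]])
  have c_cnj: "cnj (c (- k)) = c k" for k
  proof -
    have "(\<lambda>k. cnj (c (- k))) = c"
      by (rule fourier_expansion_unique[OF fourier_expansion_cnj[OF f] f]) (simp add: f_def)
    thus ?thesis by metis
  qed
  have c0: "cnj (c 0) = c 0" using c_cnj[of 0] by simp
  define P where "P = (\<lambda>z. \<Sum>n. c (int n) * z ^ n)"
  \<comment> \<open>\<open>P\<close> contains \<open>c 0\<close> in full; half of it is removed, so
    that \<open>G z + cnj (G z)\<close> counts it once.\<close>
  define G where "G = (\<lambda>z. P z - c 0 / 2)"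
  have sum_c: "summable (\<lambda>n. cmod (c (int n)))"
    by (rule supported_on_analytic_part[OF f])
  have G: "fourier_expansion G (\<lambda>k. (if k \<ge> 0 then c k else 0) - (if k = 0 then c 0 / 2 else 0))"
    unfolding G_def P_def
    by (rule fourier_expansion_diff[OF supported_on_analytic_part(1)[OF f] fourier_expansion_const])
  have "fourier_expansion (\<lambda>z. G z + cnj (G z)) c"
  proof -
    have "(\<lambda>k. ((if k \<ge> 0 then c k else 0) - (if k = 0 then c 0 / 2 else 0)) +
        cnj ((if - k \<ge> 0 then c (- k) else 0) - (if - k = 0 then c 0 / 2 else 0))) = c"
      by (rule ext) (auto simp: c_cnj c0 field_simps)
    thus ?thesis using fourier_expansion_add[OF G fourier_expansion_cnj[OF G]] by metis
  qed
  hence Gf: "G z + cnj (G z) = f z" if "z \<in> unit_circle" for z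
    using has_sum_unique fourier_expansion_has_sum[OF _ that] f by blast
  have kernel: "set_integrable lborel {0..2 * pi} (\<lambda>x. f (cis x))"
    by (intro borel_integrable_atLeastAtMost' continuous_on_compose2[OF fourier_expansion_continuous[OF f]])
      (auto intro!: continuous_intros)
  have geo: "set_integrable lborel {0..2 * pi} (\<lambda>x. f (cis x) / (1 - q * cis x powi m))" if "cmod q < 1" for q m
  proof (rule borel_integrable_atLeastAtMost')
    have "1 - q * cis x powi m \<noteq> 0" for x
    proof
      assume "1 - q * cis x powi m = 0"
      hence "cmod (q * cis x powi m) = 1" by (metis eq_iff_diff_eq_0 norm_one)
      thus False using that by (simp add: norm_mult norm_power_int)
    qed
    thus "continuous_on {0..2 * pi} (\<lambda>x. f (cis x) / (1 - q * cis x powi m))"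
      by (intro continuous_intros continuous_on_compose2[OF fourier_expansion_continuous[OF f]])
        (auto intro!: continuous_intros)
  qed
  have scale: "complex_of_real (1 / (4 * pi)) * (2 * (complex_of_real (2 * pi) * x)) = x"
    "complex_of_real (1 / (4 * pi)) * (complex_of_real (2 * pi) * x) = x / 2" for x by auto
  \<comment> \<open>The kernel equals \<open>2 / (1 - z / cis x) - 1\<close>.\<close>
  have inside: "szego_function w z = exp ((\<Sum>n. z ^ n * c (int n)) - c 0 / 2)" if z: "cmod z < 1" for z
  proof -
    have "(LBINT x:{0..2 * pi}. f (cis x) * ((cis x + z) / (cis x - z))) =
        (LBINT x:{0..2 * pi}. 2 * (f (cis x) / (1 - z * cis x powi (-1))) - f (cis x))"
    proof (rule set_lebesgue_integral_cong)
      show "\<forall>x. x \<in> {0..2 * pi} \<longrightarrow> f (cis x) * ((cis x + z) / (cis x - z)) =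
          2 * (f (cis x) / (1 - z * cis x powi (-1))) - f (cis x)"
      proof (intro allI impI)
        fix x :: real
        have "cis x - z \<noteq> 0" using z by (metis eq_iff_diff_eq_0 norm_cis less_irrefl)
        thus "f (cis x) * ((cis x + z) / (cis x - z)) =
          2 * (f (cis x) / (1 - z * cis x powi (-1))) - f (cis x)"
          by (simp add: field_simps)
      qed
    qed simp
    also have "\<dots> = 2 * (LBINT x:{0..2 * pi}. f (cis x) / (1 - z * cis x powi (-1))) - (LBINT x:{0..2 * pi}. f (cis x))"
      unfolding set_integral_mult_right[symmetric]
      by (rule set_integral_diff(2)) (intro set_integrable_mult_right geo z kernel)+
    also have "\<dots> = 2 * (2 * pi * (\<Sum>n. z ^ n * c (int n))) - 2 * pi * c 0"
      using fourier_expansion_geometric_integral[OF f z, of 0 "-1"] fourier_expansion_integral[OF f, of 0] by simp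
    finally have I: "(LBINT x:{0..2 * pi}. f (cis x) * ((cis x + z) / (cis x - z))) = \<dots>" .
    have "szego_function w z = exp (complex_of_real (1 / (4 * pi)) * (LBINT x:{0..2 * pi}. f (cis x) * ((cis x + z) / (cis x - z))))"
      by (simp add: szego_function_def f_def)
    thus ?thesis by (simp only: I right_diff_distrib scale)
  qed
  \<comment> \<open>Here the kernel equals \<open>1 - 2 / (1 - cis x / z)\<close>, and the series
    runs over the coefficients of nonpositive index.\<close>
  have outside: "szego_function w z = exp (c 0 / 2 - (\<Sum>n. inverse z ^ n * c (- int n)))" if z: "cmod z > 1" for z
  proof -
    have q: "cmod (inverse z) < 1" using z by (simp add: norm_inverse inverse_less_1_iff)
    have "(LBINT x:{0..2 * pi}. f (cis x) * ((cis x + z) / (cis x - z))) =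
        (LBINT x:{0..2 * pi}. f (cis x) - 2 * (f (cis x) / (1 - inverse z * cis x powi 1)))"
    proof (rule set_lebesgue_integral_cong)
      show "\<forall>x. x \<in> {0..2 * pi} \<longrightarrow> f (cis x) * ((cis x + z) / (cis x - z)) =
          f (cis x) - 2 * (f (cis x) / (1 - inverse z * cis x powi 1))"
      proof (intro allI impI)
        fix x :: real
        have "cis x - z \<noteq> 0" "z - cis x \<noteq> 0" using z by (metis eq_iff_diff_eq_0 norm_cis less_irrefl)+
        moreover have "z \<noteq> 0" using z by auto
        moreover have "1 - inverse z * cis x = (z - cis x) / z" using \<open>z \<noteq> 0\<close> by (simp add: field_simps)
        ultimately show "f (cis x) * ((cis x + z) / (cis x - z)) =
          f (cis x) - 2 * (f (cis x) / (1 - inverse z * cis x powi 1))"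
          by (simp add: divide_simps) (simp add: algebra_simps)
      qed
    qed simp
    also have "\<dots> = (LBINT x:{0..2 * pi}. f (cis x)) - 2 * (LBINT x:{0..2 * pi}. f (cis x) / (1 - inverse z * cis x powi 1))"
      unfolding set_integral_mult_right[symmetric]
      by (rule set_integral_diff(2)) (intro set_integrable_mult_right geo q kernel)+
    also have "\<dots> = 2 * pi * c 0 - 2 * (2 * pi * (\<Sum>n. inverse z ^ n * c (- int n)))"
      using fourier_expansion_geometric_integral[OF f q, of 0 1] fourier_expansion_integral[OF f, of 0] by simp
    finally have I: "(LBINT x:{0..2 * pi}. f (cis x) * ((cis x + z) / (cis x - z))) = \<dots>" .
    have "szego_function w z = exp (complex_of_real (1 / (4 * pi)) * (LBINT x:{0..2 * pi}. f (cis x) * ((cis x + z) / (cis x - z))))"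
      by (simp add: szego_function_def f_def)
    thus ?thesis by (simp only: I right_diff_distrib scale)
  qed
  have inner: "szego_inner w z = exp (G z)" if z: "z \<in> unit_circle" for z
  proof -
    have "summable (\<lambda>n. cmod (c (int n) * z ^ n))"
      using sum_c z by (simp add: norm_mult norm_power)
    from abel_limit[OF this]
    have "((\<lambda>r::real. exp ((\<Sum>n. c (int n) * z ^ n * of_real r ^ n) - c 0 / 2)) \<longlongrightarrow> exp (G z)) (at_left 1)"
      unfolding G_def P_def by (intro tendsto_intros)
    moreover have "eventually (\<lambda>r::real. exp ((\<Sum>n. c (int n) * z ^ n * of_real r ^ n) - c 0 / 2) = szego_function w (r * z)) (at_left 1)"
      using eventually_at_left_real[OF zero_less_one]
    proof eventually_elim
      case (elim r)
      have "cmod (r * z) < 1" using elim z by (simp add: norm_mult)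
      from inside[OF this] show ?case by (simp add: power_mult_distrib mult_ac)
    qed
    ultimately have "((\<lambda>r::real. szego_function w (r * z)) \<longlongrightarrow> exp (G z)) (at_left 1)"
      by (rule Lim_transform_eventually)
    thus ?thesis unfolding szego_inner_def by (intro tendsto_Lim) auto
  qed
  have outer: "szego_outer w z = exp (- cnj (G z))" if z: "z \<in> unit_circle" for z
  proof -
    have s: "summable (\<lambda>n. cmod (c (int n) * z ^ n))"
      using sum_c z by (simp add: norm_mult norm_power)
    hence s': "summable (\<lambda>n. cmod (cnj (c (int n) * z ^ n)))" by (simp only: complex_mod_cnj)
    \<comment> \<open>The substitution of \<open>inverse r\<close> for \<open>r\<close> turns the
      limit from outside into an Abel limit.\<close>
    have "filterlim (\<lambda>r::real. inverse r) (at_left 1) (at_right 1)"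
      unfolding filterlim_at
    proof
      show "((\<lambda>r::real. inverse r) \<longlongrightarrow> 1) (at_right 1)"
        by (rule tendsto_eq_intros) (auto intro!: tendsto_eq_intros)
      show "\<forall>\<^sub>F r::real in at_right 1. inverse r \<in> {..<1} \<and> inverse r \<noteq> 1"
        by (auto simp: eventually_at_right_field inverse_less_1_iff intro!: exI[of _ 2])
    qed
    from filterlim_compose[OF abel_limit[OF s'] this]
    have "((\<lambda>r::real. \<Sum>n. cnj (c (int n) * z ^ n) * of_real (inverse r) ^ n) \<longlongrightarrow> (\<Sum>n. cnj (c (int n) * z ^ n))) (at_right 1)" .
    moreover have "(\<Sum>n. cnj (c (int n) * z ^ n)) = cnj (P z)"
      unfolding P_def using bounded_linear.suminf[OF bounded_linear_cnj summable_norm_cancel[OF s]] by simp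
    ultimately have "((\<lambda>r::real. exp (c 0 / 2 - (\<Sum>n. cnj (c (int n) * z ^ n) * of_real (inverse r) ^ n))) \<longlongrightarrow> exp (c 0 / 2 - cnj (P z))) (at_right 1)"
      by (auto intro!: tendsto_intros)
    also have "c 0 / 2 - cnj (P z) = - cnj (G z)" by (simp add: G_def c0)
    finally have "((\<lambda>r::real. exp (c 0 / 2 - (\<Sum>n. cnj (c (int n) * z ^ n) * of_real (inverse r) ^ n))) \<longlongrightarrow> exp (- cnj (G z))) (at_right 1)" .
    moreover have "eventually (\<lambda>r::real. exp (c 0 / 2 - (\<Sum>n. cnj (c (int n) * z ^ n) * of_real (inverse r) ^ n)) = szego_function w (r * z)) (at_right 1)"
      using eventually_at_right_real[of 1 2, simplified]
    proof eventually_elim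
      case (elim r)
      have "cmod (r * z) > 1" using elim z by (simp add: norm_mult)
      from outside[OF this] show ?case using c_cnj[of "- int _"]
        by (simp add: power_mult_distrib mult_ac cnj_circle[OF z] power_inverse)
    qed
    ultimately have "((\<lambda>r::real. szego_function w (r * z)) \<longlongrightarrow> exp (- cnj (G z))) (at_right 1)"
      by (rule Lim_transform_eventually)
    thus ?thesis unfolding szego_outer_def by (intro tendsto_Lim) auto
  qed
  show ?thesis
  proof (rule that)
    show "supported_on G {0..}"
      by (rule supported_onI'[OF G]) auto
    show "complex_of_real (w z) = exp (G z + cnj (G z))" if "z \<in> unit_circle" for z
      using pos[OF that] by (simp add: Gf[OF that] f_def exp_of_real)
    show "scattering w z = exp (G z - cnj (G z))" if "z \<in> unit_circle" for z
      by (simp add: scattering_def f_plus_def f_minus_def inner[OF that] outer[OF that] exp_diff exp_minus field_simps)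
  qed
qed

section \<open>Weighted estimates\<close>

text \<open>This bounds a Hankel matrix on a weighted sequence space. The inequality
  \<open>sub\<close> distributes the weight at \<open>i\<close> over \<open>i + j\<close> and
  \<open>j\<close>; after exchanging the sums, each \<open>j\<close> meets distinct entries of
  \<open>x\<close>, all at indices above \<open>n\<close>, so only the tail bound \<open>E\<close>
  enters.\<close>

lemma hankel_sum_le:
  fixes x g \<omega> :: "nat \<Rightarrow> real"
  assumes x0: "\<And>k. x k \<ge> 0" and g0: "\<And>k. g k \<ge> 0" and \<omega>1: "\<And>k. \<omega> k \<ge> 1"
    and sub: "\<And>i j. \<omega> i \<le> \<omega> (i + j) * \<omega> j"
    and sx: "summable x" and sg: "summable (\<lambda>j. \<omega> j * g j)"
    and E: "\<And>J. finite J \<Longrightarrow> J \<subseteq> {n<..} \<Longrightarrow> (\<Sum>k\<in>J. \<omega> k * x k) \<le> E"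
    and I: "finite I" "\<And>i j. i \<in> I \<Longrightarrow> g j \<noteq> 0 \<Longrightarrow> n < i + j"
  shows "(\<Sum>i\<in>I. \<omega> i * (\<Sum>j. x (i + j) * g j)) \<le> E * (\<Sum>j. \<omega> j * g j)"
    and "summable (\<lambda>j. x (i + j) * g j)"
proof -
  have \<omega>0: "\<omega> k \<ge> 0" for k using \<omega>1[of k] by simp
  have gle: "g j \<le> \<omega> j * g j" for j
    using mult_right_mono[OF \<omega>1[of j] g0[of j]] by simp
  have sg': "summable g"
    by (rule summable_comparison_test'[OF sg, of 0]) (use g0 gle in auto)
  have xle: "x k \<le> suminf x" for k
    using sum_le_suminf[OF sx, of "{k}"] x0 by auto
  show s: "summable (\<lambda>j. x (i + j) * g j)" for i
    by (rule summable_comparison_test'[OF summable_mult[OF sg'], of 0 _ "suminf x"])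
      (use g0 x0 xle in \<open>auto intro!: mult_right_mono\<close>)
  have summand: "(\<Sum>i\<in>I. \<omega> i * (x (i + j) * g j)) \<le> E * (\<omega> j * g j)" for j
  proof (cases "g j = 0")
    case False
    have "(\<Sum>i\<in>I. \<omega> i * x (i + j)) \<le> (\<Sum>i\<in>I. \<omega> j * (\<omega> (i + j) * x (i + j)))"
      using sub x0 by (intro sum_mono) (metis mult.assoc mult.commute mult_right_mono)
    also have "\<dots> = \<omega> j * (\<Sum>k\<in>(\<lambda>i. i + j) ` I. \<omega> k * x k)"
      by (subst sum.reindex) (auto simp: sum_distrib_left)
    also have "\<dots> \<le> \<omega> j * E"
      using I False \<omega>0 by (intro mult_left_mono E) auto
    finally have "(\<Sum>i\<in>I. \<omega> i * x (i + j)) * g j \<le> \<omega> j * E * g j"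
      using g0 by (intro mult_right_mono) auto
    thus ?thesis by (simp add: sum_distrib_left sum_distrib_right mult_ac)
  qed auto
  have "(\<Sum>i\<in>I. \<omega> i * (\<Sum>j. x (i + j) * g j)) = (\<Sum>j. \<Sum>i\<in>I. \<omega> i * (x (i + j) * g j))"
    using s by (subst suminf_sum) (auto simp: suminf_mult summable_mult)
  also have "\<dots> \<le> (\<Sum>j. E * (\<omega> j * g j))"
    using summand s sg by (intro suminf_le summable_sum summable_mult) auto
  also have "\<dots> = E * (\<Sum>j. \<omega> j * g j)" using sg by (rule suminf_mult)
  finally show "(\<Sum>i\<in>I. \<omega> i * (\<Sum>j. x (i + j) * g j)) \<le> E * (\<Sum>j. \<omega> j * g j)" .
qed

text \<open>All that the estimates use about scattering, in absolute values. Later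
  \<open>x k\<close> belongs to the coefficient of \<open>S\<close> at \<open>- k\<close>,
  \<open>y n\<close> to \<open>\<alpha> n\<close>, and \<open>A n\<close>, \<open>B n\<close> to the
  coefficients of \<open>a n\<close>, \<open>b n\<close> at nonpositive indices, divided by the
  value of \<open>a n\<close> at infinity. \<open>B_le\<close> and \<open>A_le\<close> are the
  Marchenko equations, \<open>x_le\<close> is the first of them at index \<open>Suc n\<close> with
  \<open>x (Suc n)\<close> isolated, and the last two assumptions are the recurrence solved
  backwards.\<close>

locale scattering_bounds =
  fixes x y :: "nat \<Rightarrow> real" and A B :: "nat \<Rightarrow> nat \<Rightarrow> real"
  assumes x_nonneg: "x k \<ge> 0" and A_nonneg: "A n k \<ge> 0" and B_nonneg: "B n k \<ge> 0"
    and x_summable: "summable x" and A_summable: "summable (A n)" and B_summable: "summable (B n)"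
    and B_low: "k \<le> n \<Longrightarrow> B n k = 0" and A_0: "A n 0 = 1"
    and B_le: "k > n \<Longrightarrow> B n k \<le> (\<Sum>j. x (k + j) * A n j)"
    and A_le: "j > 0 \<Longrightarrow> A n j \<le> (\<Sum>k. x (j + k) * B n k)"
    and y_eq: "y n = B n (Suc n)"
    and x_le: "x (Suc n) \<le> y n + (\<Sum>j. x (Suc n + j) * (if j = 0 then 0 else A n j))"
    and A_step: "A n j \<le> A (Suc n) j + y n * B (Suc n) (Suc n + j)"
    and B_step: "k > n \<Longrightarrow> B n k \<le> B (Suc n) k + y n * A (Suc n) (k - Suc n)"

text \<open>\<open>submult'\<close> carries the symmetry of a two-sided weight over to natural
  indices: it is submultiplicativity for \<open>m = (m + n) + (- n)\<close>. The Hankel estimates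
  rest on it.\<close>

locale weight =
  fixes \<omega> :: "nat \<Rightarrow> real"
  assumes one: "\<omega> 0 = 1" and ge1: "\<omega> n \<ge> 1"
    and submult: "\<omega> (m + n) \<le> \<omega> m * \<omega> n"
    and submult': "\<omega> m \<le> \<omega> (m + n) * \<omega> n"
begin

text \<open>If the truncation takes effect in one factor on the right, that factor is
  \<open>M\<close> and the other at least 1, so the product dominates any truncated value.\<close>

lemma weight_min:
  assumes "M \<ge> 1"
  shows "weight (\<lambda>n. min (\<omega> n) M)"
proof -
  have *: "min a M \<le> min b M * min c M" if "a \<le> b * c" "b \<ge> 1" "c \<ge> 1" for a b c :: real
  proof (cases "b \<le> M \<and> c \<le> M")
    case True
    thus ?thesis using that by auto
  next
    case False
    hence "min b M = M \<or> min c M = M" by auto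
    moreover have "min b M \<ge> 1" "min c M \<ge> 1" using assms that by auto
    ultimately have "M * 1 \<le> min b M * min c M"
      using assms by (metis mult.commute mult_left_mono order_trans zero_le_one)
    thus ?thesis by simp
  qed
  show ?thesis
    by unfold_locales (use assms one ge1 submult submult' * in auto)
qed

end

section \<open>Majorants over a finite range of indices\<close>

context scattering_bounds
begin

text \<open>One sequence dominating \<open>A n\<close> for all \<open>n\<close> of a finite range;
  it is still summable, being bounded by a finite sum.\<close>

definition maxA :: "nat \<Rightarrow> nat \<Rightarrow> nat \<Rightarrow> real" where
  "maxA N L j = Max ((\<lambda>n. A n j) ` {N..L})"
definition maxB :: "nat \<Rightarrow> nat \<Rightarrow> nat \<Rightarrow> real" where
  "maxB N L j = Max ((\<lambda>n. B n j) ` {N..L})"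

context
  fixes N L :: nat assumes NL: "N \<le> L"
begin

lemma maxA_ge: "n \<in> {N..L} \<Longrightarrow> A n j \<le> maxA N L j"
  unfolding maxA_def by (intro Max_ge) auto

lemma maxB_ge: "n \<in> {N..L} \<Longrightarrow> B n j \<le> maxB N L j"
  unfolding maxB_def by (intro Max_ge) auto

lemma maxA_le: "(\<And>n. n \<in> {N..L} \<Longrightarrow> A n j \<le> C) \<Longrightarrow> maxA N L j \<le> C"
  unfolding maxA_def using NL by (intro Max.boundedI) auto

lemma maxB_le: "(\<And>n. n \<in> {N..L} \<Longrightarrow> B n j \<le> C) \<Longrightarrow> maxB N L j \<le> C"
  unfolding maxB_def using NL by (intro Max.boundedI) auto

lemma maxA_nonneg: "maxA N L j \<ge> 0"
  using order_trans[OF A_nonneg maxA_ge[of N j]] NL by auto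

lemma maxB_nonneg: "maxB N L j \<ge> 0"
  using order_trans[OF B_nonneg maxB_ge[of N j]] NL by auto

lemma maxA_0: "maxA N L 0 = 1"
  using maxA_ge[of N 0] NL by (intro antisym maxA_le) (auto simp: A_0)

lemma maxB_low: "k \<le> N \<Longrightarrow> maxB N L k = 0"
  by (intro antisym maxB_le maxB_nonneg) (auto simp: B_low)

lemma summable_maxA: "summable (maxA N L)"
  by (rule summable_comparison_test'[of "\<lambda>j. \<Sum>n\<in>{N..L}. A n j" 0])
    (auto intro!: summable_sum A_summable maxA_le member_le_sum A_nonneg simp: maxA_nonneg)

lemma summable_maxB: "summable (maxB N L)"
  by (rule summable_comparison_test'[of "\<lambda>j. \<Sum>n\<in>{N..L}. B n j" 0])
    (auto intro!: summable_sum B_summable maxB_le member_le_sum B_nonneg simp: maxB_nonneg)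

end

end

lemma sum_le_shifted_suminf:
  fixes f :: "nat \<Rightarrow> real"
  assumes "summable f" "\<And>k. f k \<ge> 0" "finite J" "J \<subseteq> {n..}"
  shows "sum f J \<le> (\<Sum>k. f (k + n))"
proof -
  have "inj_on (\<lambda>k. k - n) J"
    using assms(4) by (intro inj_onI) (metis atLeast_iff eq_diff_iff subsetD)
  hence "(\<Sum>k\<in>(\<lambda>k. k - n) ` J. f (k + n)) = (\<Sum>k\<in>J. f (k - n + n))"
    by (simp add: sum.reindex)
  also have "\<dots> = sum f J"
    using assms(4) by (intro sum.cong refl) (metis atLeast_iff le_add_diff_inverse2 subsetD)
  finally show ?thesis
    using sum_le_suminf[OF summable_ignore_initial_segment[OF assms(1)], of "(\<lambda>k. k - n) ` J" n]
      assms(2,3) by auto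
qed

text \<open>Index 0, where \<open>A n 0 = 1\<close>, has to be split off from the norms of
  \<open>A\<close>.\<close>

lemma summable_if_0:
  fixes f :: "nat \<Rightarrow> real"
  assumes "summable f"
  shows "summable (\<lambda>j. if j = 0 then 0 else f j)"
    and "(\<Sum>j. if j = 0 then 0 else f j) = suminf f - f 0"
proof -
  have eq: "(\<lambda>j. if j = 0 then 0 else f j) = (\<lambda>j. f j - (if j = 0 then f j else 0))" by auto
  have 1: "(\<lambda>j. if j = 0 then f j else 0) sums f 0" using sums_single[of 0 f] by simp
  show "summable (\<lambda>j. if j = 0 then 0 else f j)"
    unfolding eq using 1 assms by (intro summable_diff) (auto simp: sums_iff)
  show "(\<Sum>j. if j = 0 then 0 else f j) = suminf f - f 0"
    unfolding eq using 1 assms by (subst suminf_diff[symmetric]) (auto simp: sums_iff)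
qed

section \<open>Estimates for bounded weights\<close>

text \<open>Boundedness makes all weighted sums finite a priori, so that they can be absorbed into
  the other side of an inequality. The constants obtained are independent of
  \<open>M\<close>.\<close>

locale scattering_bounds_weight = scattering_bounds x y A B + weight \<omega>
  for x y A B \<omega> +
  fixes M :: real
  assumes bounded: "\<omega> n \<le> M"
begin

lemma nonneg: "\<omega> n \<ge> 0" using ge1[of n] by simp

lemma summable_weighted:
  assumes "summable f" "\<And>n. f n \<ge> 0"
  shows "summable (\<lambda>n. \<omega> n * f n)"
  by (rule summable_comparison_test'[OF summable_mult[OF assms(1), of M], of 0])
    (use assms nonneg bounded in \<open>auto intro: mult_right_mono\<close>)

text \<open>The right sides of the Marchenko inequalities grow when \<open>A n\<close>,
  \<open>B n\<close> are replaced by the majorants, and then no longer depend on \<open>n\<close>.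
  So the majorants satisfy the same inequalities, and the Hankel estimate turns them into
  inequalities between weighted norms. The 1 comes from index 0 of \<open>A\<close>.\<close>

lemma norm_bounds:
  assumes NL: "N \<le> L"
    and E: "\<And>J. finite J \<Longrightarrow> J \<subseteq> {N<..} \<Longrightarrow> (\<Sum>k\<in>J. \<omega> k * x k) \<le> E"
  shows "(\<Sum>k. \<omega> k * maxB N L k) \<le> E * (\<Sum>j. \<omega> j * maxA N L j)"
    and "(\<Sum>j. \<omega> j * maxA N L j) \<le> 1 + E * (\<Sum>k. \<omega> k * maxB N L k)"
proof -
  have sA: "summable (\<lambda>j. \<omega> j * maxA N L j)" and sB: "summable (\<lambda>j. \<omega> j * maxB N L j)"
    using NL by (auto intro!: summable_weighted summable_maxA summable_maxB maxA_nonneg maxB_nonneg)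
  \<comment> \<open>Instances with empty \<open>I\<close> extract only the summability.\<close>
  note h = hankel_sum_le[OF x_nonneg _ ge1 submult' x_summable _ E]
  have hA: "summable (\<lambda>j. x (i + j) * maxA N L j)" for i
    by (rule h(2)[OF _ sA, where I = "{}"]) (auto simp: NL maxA_nonneg)
  have hB: "summable (\<lambda>j. x (i + j) * maxB N L j)" for i
    by (rule h(2)[OF _ sB, where I = "{}"]) (auto simp: NL maxB_nonneg)
  have hA': "summable (\<lambda>j. x (i + j) * A n j)" for i n
    by (rule h(2)[OF _ summable_weighted[OF A_summable], where I = "{}"]) (auto simp: A_nonneg)
  have hB': "summable (\<lambda>j. x (i + j) * B n j)" for i n
    by (rule h(2)[OF _ summable_weighted[OF B_summable], where I = "{}"]) (auto simp: B_nonneg)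
  have B: "maxB N L k \<le> (\<Sum>j. x (k + j) * maxA N L j)" if "k > N" for k
  proof (rule maxB_le[OF NL])
    fix n assume n: "n \<in> {N..L}"
    show "B n k \<le> (\<Sum>j. x (k + j) * maxA N L j)"
    proof (cases "k > n")
      case True
      show ?thesis
        by (rule order_trans[OF B_le[OF True] suminf_le[OF _ hA' hA]])
          (use maxA_ge[OF NL n] x_nonneg in \<open>auto intro: mult_left_mono\<close>)
    next
      case False
      thus ?thesis using B_low[of k n] hA[of k] NL
        by (auto intro!: suminf_nonneg mult_nonneg_nonneg x_nonneg maxA_nonneg)
    qed
  qed
  have A: "maxA N L j \<le> (\<Sum>k. x (j + k) * maxB N L k)" if "j > 0" for j
  proof (rule maxA_le[OF NL])
    fix n assume n: "n \<in> {N..L}"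
    show "A n j \<le> (\<Sum>k. x (j + k) * maxB N L k)"
        by (rule order_trans[OF A_le[OF that] suminf_le[OF _ hB' hB]])
          (use maxB_ge[OF NL n] x_nonneg in \<open>auto intro: mult_left_mono\<close>)
  qed
  show "(\<Sum>k. \<omega> k * maxB N L k) \<le> E * (\<Sum>j. \<omega> j * maxA N L j)"
  proof (rule suminf_le_const[OF sB])
    fix K
    have "(\<Sum>k<K. \<omega> k * maxB N L k) = (\<Sum>k\<in>{N<..<K}. \<omega> k * maxB N L k)"
      by (rule sum.mono_neutral_right) (auto simp: maxB_low[OF NL])
    also have "\<dots> \<le> (\<Sum>k\<in>{N<..<K}. \<omega> k * (\<Sum>j. x (k + j) * maxA N L j))"
      using B nonneg by (intro sum_mono mult_left_mono) auto
    also have "\<dots> \<le> E * (\<Sum>j. \<omega> j * maxA N L j)"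
      by (rule h(1)[OF _ sA]) (auto simp: NL maxA_nonneg)
    finally show "(\<Sum>k<K. \<omega> k * maxB N L k) \<le> E * (\<Sum>j. \<omega> j * maxA N L j)" .
  qed
  have "(\<Sum>j. if j = 0 then 0 else \<omega> j * maxA N L j) \<le> E * (\<Sum>k. \<omega> k * maxB N L k)"
  proof (rule suminf_le_const[OF summable_if_0(1)[OF sA]])
    fix K
    have "(\<Sum>k<K. if k = 0 then 0 else \<omega> k * maxA N L k) = (\<Sum>k\<in>{0<..<K}. \<omega> k * maxA N L k)"
      by (rule sum.mono_neutral_cong_right) auto
    also have "\<dots> \<le> (\<Sum>k\<in>{0<..<K}. \<omega> k * (\<Sum>j. x (k + j) * maxB N L j))"
      using A nonneg by (intro sum_mono mult_left_mono) auto
    also have "\<dots> \<le> E * (\<Sum>j. \<omega> j * maxB N L j)"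
    proof (rule h(1)[OF _ sB])
      \<comment> \<open>All rows \<open>i > 0\<close> occur here; it is the vanishing of the
        majorant up to \<open>N\<close> that restricts \<open>x\<close> to its tail.\<close>
      show "N < i + j" if "maxB N L j \<noteq> 0" for i j
        using maxB_low[OF NL, of j] that by (cases "j \<le> N") auto
    qed (auto simp: NL maxB_nonneg)
    finally show "(\<Sum>k<K. if k = 0 then 0 else \<omega> k * maxA N L k) \<le> E * (\<Sum>j. \<omega> j * maxB N L j)" .
  qed
  thus "(\<Sum>j. \<omega> j * maxA N L j) \<le> 1 + E * (\<Sum>k. \<omega> k * maxB N L k)"
    using summable_if_0(2)[OF sA] maxA_0[OF NL] one by simp
qed

text \<open>Each \<open>y n\<close> is \<open>B n (Suc n)\<close>, hence at most the entry of the
  single sequence \<open>maxB N L\<close> at \<open>Suc n\<close>. These indices are distinct, so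
  the weighted sum is bounded by one norm.\<close>

lemma verblunsky_bound:
  assumes NL: "N \<le> L"
    and E: "\<And>J. finite J \<Longrightarrow> J \<subseteq> {N<..} \<Longrightarrow> (\<Sum>k\<in>J. \<omega> k * x k) \<le> 1/2"
  shows "(\<Sum>n\<in>{N..L}. \<omega> (Suc n) * y n) \<le> 1"
proof -
  let ?a = "\<Sum>j. \<omega> j * maxA N L j" and ?b = "\<Sum>j. \<omega> j * maxB N L j"
  have sB: "summable (\<lambda>j. \<omega> j * maxB N L j)"
    using NL by (auto intro!: summable_weighted summable_maxB maxB_nonneg)
  have "(\<Sum>n\<in>{N..L}. \<omega> (Suc n) * y n) \<le> (\<Sum>n\<in>{N..L}. \<omega> (Suc n) * maxB N L (Suc n))"
    using maxB_ge[OF NL] nonneg by (intro sum_mono mult_left_mono) (auto simp: y_eq)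
  also have "\<dots> = (\<Sum>k\<in>Suc ` {N..L}. \<omega> k * maxB N L k)"
    by (subst sum.reindex) auto
  also have "\<dots> \<le> ?b"
    using NL by (intro sum_le_suminf sB) (auto intro!: mult_nonneg_nonneg nonneg maxB_nonneg)
  \<comment> \<open>The two norm bounds with \<open>E = 1/2\<close> give
    \<open>?b \<le> 1/2 + ?b / 4\<close>, hence \<open>?b \<le> 2/3\<close>.\<close>
  also have "?b \<le> 1"
    using norm_bounds[OF NL E] by simp
  finally show ?thesis .
qed

text \<open>Iterating the backward recurrence from \<open>L\<close> down to \<open>N\<close> adds
  shifted copies of the majorants, multiplied by the \<open>y m\<close>; in the weighted norm their
  total cost is the factor \<open>e\<close>. As \<open>a\<close> omits index 0, the full norm for
  \<open>A\<close> is \<open>1 + a N\<close>.\<close>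

lemma toeplitz_bounds:
  assumes NL: "N \<le> L" and e: "(\<Sum>n\<in>{N..<L}. \<omega> (Suc n) * y n) \<le> e"
  defines "a \<equiv> \<lambda>N. \<Sum>j. if j = 0 then 0 else \<omega> j * maxA N L j"
    and "b \<equiv> \<lambda>N. \<Sum>k. \<omega> k * maxB N L k"
  shows "b N \<le> b L + e * (1 + a N)" and "a N \<le> a L + e * b N"
proof -
  have y0: "y n \<ge> 0" for n by (simp add: y_eq B_nonneg)
  have e0: "e \<ge> 0" using e
    by (rule order_trans[rotated]) (auto intro!: sum_nonneg mult_nonneg_nonneg nonneg y0)
  have sA: "summable (\<lambda>j. \<omega> j * maxA N L j)" and sB: "summable (\<lambda>j. \<omega> j * maxB N L j)"
    if "N \<le> L" for N
    using that by (auto intro!: summable_weighted summable_maxA summable_maxB maxA_nonneg maxB_nonneg)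
  have a_eq: "a N = (\<Sum>j. \<omega> j * maxA N L j) - 1"
    using summable_if_0(2)[OF sA[OF NL]] maxA_0[OF NL] one by (simp add: a_def)
  have maxL: "maxA L L j = A L j" "maxB L L j = B L j" for j
    by (auto simp: maxA_def maxB_def)
  \<comment> \<open>The induction descends from \<open>L\<close>; each step adds one term, in which
    \<open>B (Suc n)\<close> is replaced by the majorant.\<close>
  have A: "A n j \<le> A L j + (\<Sum>m\<in>{n..<L}. y m * maxB N L (Suc m + j))" if "N \<le> n" "n \<le> L" for n j
    using that(2,1)
  proof (induction n rule: inc_induct)
    case (step n)
    have "A n j \<le> A (Suc n) j + y n * B (Suc n) (Suc n + j)" by (rule A_step)
    also have "y n * B (Suc n) (Suc n + j) \<le> y n * maxB N L (Suc n + j)"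
      using step by (intro mult_left_mono maxB_ge[OF NL] y0) auto
    finally show ?case using step by (simp add: sum.atLeast_Suc_lessThan[of n L])
  qed simp
  have A': "maxA N L j \<le> A L j + (\<Sum>m\<in>{N..<L}. y m * maxB N L (Suc m + j))" for j
  proof (rule maxA_le[OF NL])
    fix n assume n: "n \<in> {N..L}"
    have "(\<Sum>m\<in>{n..<L}. y m * maxB N L (Suc m + j)) \<le> (\<Sum>m\<in>{N..<L}. y m * maxB N L (Suc m + j))"
      using n by (intro sum_mono2) (auto intro!: mult_nonneg_nonneg y0 maxB_nonneg NL)
    thus "A n j \<le> A L j + (\<Sum>m\<in>{N..<L}. y m * maxB N L (Suc m + j))"
      using A[of n j] n by simp
  qed
  \<comment> \<open>The value is 0 for \<open>k \<le> m\<close>, where \<open>B m k\<close> vanishes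
    and \<open>B_step\<close> makes no claim.\<close>
  let ?q = "\<lambda>m k. if Suc m \<le> k then y m * maxA N L (k - Suc m) else 0"
  have q0: "?q m k \<ge> 0" for m k by (auto intro!: mult_nonneg_nonneg y0 maxA_nonneg NL)
  have B: "B n k \<le> B L k + (\<Sum>m\<in>{n..<L}. ?q m k)" if "N \<le> n" "n \<le> L" for n k
    using that(2,1)
  proof (induction n rule: inc_induct)
    case (step n)
    have "B n k \<le> B (Suc n) k + ?q n k"
    proof (cases "k > n")
      case True
      have "y n * A (Suc n) (k - Suc n) \<le> y n * maxA N L (k - Suc n)"
        using step by (intro mult_left_mono maxA_ge[OF NL] y0) auto
      thus ?thesis using B_step[OF True] True by simp
    qed (use B_low B_nonneg in auto)
    thus ?case using step by (simp add: sum.atLeast_Suc_lessThan[of n L])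
  qed simp
  have B': "maxB N L k \<le> B L k + (\<Sum>m\<in>{N..<L}. ?q m k)" for k
  proof (rule maxB_le[OF NL])
    fix n assume n: "n \<in> {N..L}"
    have "(\<Sum>m\<in>{n..<L}. ?q m k) \<le> (\<Sum>m\<in>{N..<L}. ?q m k)"
      using n q0 by (intro sum_mono2) auto
    thus "B n k \<le> B L k + (\<Sum>m\<in>{N..<L}. ?q m k)" using B[of n k] n by simp
  qed
  have bN: "b N \<ge> 0" and aN: "(\<Sum>j. \<omega> j * maxA N L j) \<ge> 0"
    unfolding b_def using sA[OF NL] sB[OF NL]
    by (auto intro!: suminf_nonneg mult_nonneg_nonneg nonneg maxB_nonneg maxA_nonneg NL)
  show "a N \<le> a L + e * b N"
    unfolding a_def
  proof (rule suminf_le_const[OF summable_if_0(1)[OF sA[OF NL]]])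
    fix K
    have "(\<Sum>j<K. if j = 0 then 0 else \<omega> j * maxA N L j)
        \<le> (\<Sum>j<K. (if j = 0 then 0 else \<omega> j * maxA L L j)
             + (\<Sum>m\<in>{N..<L}. \<omega> (Suc m) * y m * (\<omega> (Suc m + j) * maxB N L (Suc m + j))))"
    proof (rule sum_mono)
      fix j
      have "\<omega> j * maxA N L j \<le> \<omega> j * (A L j + (\<Sum>m\<in>{N..<L}. y m * maxB N L (Suc m + j)))"
        by (intro mult_left_mono A' nonneg)
      also have "\<dots> = \<omega> j * A L j + (\<Sum>m\<in>{N..<L}. \<omega> j * (y m * maxB N L (Suc m + j)))"
        by (simp add: algebra_simps sum_distrib_left)
      \<comment> \<open>The entry moves from \<open>Suc m + j\<close> down to \<open>j\<close>,
        which requires \<open>submult'\<close>; in the estimate for \<open>b\<close> it moves up,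
        and \<open>submult\<close> serves.\<close>
      also have "(\<Sum>m\<in>{N..<L}. \<omega> j * (y m * maxB N L (Suc m + j)))
          \<le> (\<Sum>m\<in>{N..<L}. (\<omega> (j + Suc m) * \<omega> (Suc m)) * (y m * maxB N L (Suc m + j)))"
        by (intro sum_mono mult_right_mono submult' mult_nonneg_nonneg y0 maxB_nonneg NL)
      finally have "\<omega> j * maxA N L j \<le> \<omega> j * maxA L L j
          + (\<Sum>m\<in>{N..<L}. \<omega> (Suc m) * y m * (\<omega> (Suc m + j) * maxB N L (Suc m + j)))"
        by (simp add: maxL mult_ac add_ac)
      moreover have "(\<Sum>m\<in>{N..<L}. \<omega> (Suc m) * y m * (\<omega> (Suc m + j) * maxB N L (Suc m + j))) \<ge> 0"
        by (intro sum_nonneg mult_nonneg_nonneg nonneg y0 maxB_nonneg NL)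
      ultimately show "(if j = 0 then 0 else \<omega> j * maxA N L j)
        \<le> (if j = 0 then 0 else \<omega> j * maxA L L j)
             + (\<Sum>m\<in>{N..<L}. \<omega> (Suc m) * y m * (\<omega> (Suc m + j) * maxB N L (Suc m + j)))"
        by auto
    qed
    also have "\<dots> = (\<Sum>j<K. if j = 0 then 0 else \<omega> j * maxA L L j)
        + (\<Sum>m\<in>{N..<L}. \<omega> (Suc m) * y m * (\<Sum>j<K. \<omega> (Suc m + j) * maxB N L (Suc m + j)))"
      by (subst sum.distrib, subst sum.swap) (simp add: sum_distrib_left)
    also have "(\<Sum>j<K. if j = 0 then 0 else \<omega> j * maxA L L j) \<le> a L"
      unfolding a_def by (intro sum_le_suminf summable_if_0 sA) (auto intro!: mult_nonneg_nonneg nonneg maxA_nonneg)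
    also have "(\<Sum>m\<in>{N..<L}. \<omega> (Suc m) * y m * (\<Sum>j<K. \<omega> (Suc m + j) * maxB N L (Suc m + j)))
        \<le> (\<Sum>m\<in>{N..<L}. \<omega> (Suc m) * y m * b N)"
    proof (intro sum_mono mult_left_mono mult_nonneg_nonneg nonneg y0)
      fix m
      have "(\<Sum>j<K. \<omega> (Suc m + j) * maxB N L (Suc m + j)) = (\<Sum>k\<in>(+) (Suc m) ` {..<K}. \<omega> k * maxB N L k)"
        by (subst sum.reindex) auto
      also have "\<dots> \<le> b N" unfolding b_def
        by (intro sum_le_suminf sB NL) (auto intro!: mult_nonneg_nonneg nonneg maxB_nonneg NL)
      finally show "(\<Sum>j<K. \<omega> (Suc m + j) * maxB N L (Suc m + j)) \<le> b N" .
    qed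
    also have "\<dots> \<le> e * b N"
      unfolding sum_distrib_right[symmetric] using e bN by (intro mult_right_mono) auto
    finally show "(\<Sum>j<K. if j = 0 then 0 else \<omega> j * maxA N L j)
        \<le> (\<Sum>j. if j = 0 then 0 else \<omega> j * maxA L L j) + e * b N" by (simp add: a_def)
  qed
  show "b N \<le> b L + e * (1 + a N)"
    unfolding b_def
  proof (rule suminf_le_const[OF sB[OF NL]])
    fix K
    have "(\<Sum>k<K. \<omega> k * maxB N L k)
        \<le> (\<Sum>k<K. \<omega> k * maxB L L k + (\<Sum>m\<in>{N..<L}. \<omega> k * ?q m k))"
      using mult_left_mono[OF B' nonneg] by (intro sum_mono) (simp add: algebra_simps sum_distrib_left maxL)
    also have "\<dots> = (\<Sum>k<K. \<omega> k * maxB L L k) + (\<Sum>m\<in>{N..<L}. \<Sum>k<K. \<omega> k * ?q m k)"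
      by (subst sum.distrib, subst sum.swap) simp
    also have "(\<Sum>k<K. \<omega> k * maxB L L k) \<le> b L"
      unfolding b_def by (intro sum_le_suminf sB) (auto intro!: mult_nonneg_nonneg nonneg maxB_nonneg)
    also have "(\<Sum>m\<in>{N..<L}. \<Sum>k<K. \<omega> k * ?q m k) \<le> (\<Sum>m\<in>{N..<L}. \<omega> (Suc m) * y m * (1 + a N))"
    proof (rule sum_mono)
      fix m
      have "(\<Sum>k<K. \<omega> k * ?q m k) = (\<Sum>k\<in>{Suc m..<K}. \<omega> k * (y m * maxA N L (k - Suc m)))"
        by (rule sum.mono_neutral_cong_right) auto
      also have "\<dots> \<le> (\<Sum>k\<in>{Suc m..<K}. (\<omega> (Suc m) * \<omega> (k - Suc m)) * (y m * maxA N L (k - Suc m)))"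
        using submult[of "Suc m"] by (intro sum_mono mult_right_mono mult_nonneg_nonneg y0 maxA_nonneg NL)
            (metis atLeastLessThan_iff le_add_diff_inverse)
      also have "\<dots> = \<omega> (Suc m) * y m * (\<Sum>k\<in>{Suc m..<K}. \<omega> (k - Suc m) * maxA N L (k - Suc m))"
        by (simp add: sum_distrib_left mult_ac)
      also have "(\<Sum>k\<in>{Suc m..<K}. \<omega> (k - Suc m) * maxA N L (k - Suc m))
          = (\<Sum>k\<in>(\<lambda>k. k - Suc m) ` {Suc m..<K}. \<omega> k * maxA N L k)"
        by (subst sum.reindex) (auto intro!: inj_onI)
      also have "\<omega> (Suc m) * y m * (\<Sum>k\<in>(\<lambda>k. k - Suc m) ` {Suc m..<K}. \<omega> k * maxA N L k)
          \<le> \<omega> (Suc m) * y m * (1 + a N)"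
        unfolding a_eq
        using sum_le_suminf[OF sA[OF NL], of "(\<lambda>k. k - Suc m) ` {Suc m..<K}"]
        by (intro mult_left_mono mult_nonneg_nonneg nonneg y0) (auto simp: nonneg maxA_nonneg[OF NL])
      finally show "(\<Sum>k<K. \<omega> k * ?q m k) \<le> \<omega> (Suc m) * y m * (1 + a N)" .
    qed
    also have "\<dots> \<le> e * (1 + a N)"
      unfolding sum_distrib_right[symmetric] using e aN by (intro mult_right_mono) (auto simp: a_eq)
    finally show "(\<Sum>k<K. \<omega> k * maxB N L k) \<le> (\<Sum>k. \<omega> k * maxB L L k) + e * (1 + a N)"
      by (simp add: b_def)
  qed
qed

text \<open>Far out, at some \<open>L\<close>, the tail of \<open>x\<close> is small merely because
  the weight is bounded, so the Marchenko equations control \<open>A\<close> and \<open>B\<close>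
  there. The backward recurrence carries this control to all \<open>n\<close> from \<open>N\<close>
  to \<open>L\<close>, using only the small tail of \<open>y\<close>, and then \<open>x_le\<close>
  can be solved for \<open>x\<close> above \<open>N\<close>. The size of \<open>L\<close> does not
  enter the final bound.\<close>

lemma scattering_bound:
  assumes e: "\<And>L. (\<Sum>n\<in>{N..<L}. \<omega> (Suc n) * y n) \<le> 1/8"
  shows "(\<Sum>k\<in>{N<..<K}. \<omega> k * x k) \<le> 1/2"
proof -
  have sx: "summable (\<lambda>k. \<omega> k * x k)" by (intro summable_weighted x_summable x_nonneg)
  define T where "T = (\<lambda>n. \<Sum>k. \<omega> (k + n) * x (k + n))"
  have T0: "T n \<ge> 0" for n unfolding T_def using summable_ignore_initial_segment[OF sx]
    by (intro suminf_nonneg) (auto intro!: mult_nonneg_nonneg nonneg x_nonneg)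
  have Tge: "(\<Sum>k\<in>J. \<omega> k * x k) \<le> T n" if "finite J" "J \<subseteq> {n..}" for J n
    unfolding T_def using that
    by (intro sum_le_shifted_suminf[OF sx]) (auto intro!: mult_nonneg_nonneg nonneg x_nonneg)
  have "T \<longlonglongrightarrow> 0" unfolding T_def using suminf_exist_split2[OF sx] .
  hence "eventually (\<lambda>n. T n < 1/8) sequentially"
    by (rule order_tendstoD) simp
  then obtain L where L: "L \<ge> N" "T L < 1/8"
    using eventually_happens'[OF sequentially_bot eventually_conj[OF _ eventually_ge_at_top[of N]]] by blast
  define a where "a = (\<lambda>N. \<Sum>j. if j = 0 then 0 else \<omega> j * maxA N L j)"
  define b where "b = (\<lambda>N. \<Sum>k. \<omega> k * maxB N L k)"
  have sA: "summable (\<lambda>j. \<omega> j * maxA N L j)"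
    if "N \<le> L" for N
    using that by (auto intro!: summable_weighted summable_maxA maxA_nonneg)
  have a_eq: "(\<Sum>j. \<omega> j * maxA N L j) = 1 + a N" if "N \<le> L" for N
    using summable_if_0(2)[OF sA[OF that]] maxA_0[OF that] one by (simp add: a_def)
  have TL: "(\<Sum>k\<in>J. \<omega> k * x k) \<le> 1/8" if "finite J" "J \<subseteq> {L<..}" for J
    using Tge[of J L] that L(2) by (auto simp: subset_iff less_imp_le)
  have "b L \<le> 1/8 * (1 + a L)" "1 + a L \<le> 1 + 1/8 * b L"
    using norm_bounds[of L L "1/8", OF order.refl TL] by (simp_all add: a_eq b_def)
  moreover have "b N \<le> b L + 1/8 * (1 + a N)" "a N \<le> a L + 1/8 * b N"
    using toeplitz_bounds[OF L(1) e] by (simp_all add: a_def b_def)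
  \<comment> \<open>The four linear inequalities even give a value below 1/20; 1/4 is enough for the
    absorption below.\<close>
  ultimately have aN: "a N \<le> 1/4" by argo
  \<comment> \<open>The term with \<open>A n 0 = 1\<close> is the left side itself, so only the
    small part \<open>a N\<close> of the norm will multiply the tail of \<open>x\<close>.\<close>
  have low: "x (Suc n) \<le> y n + (\<Sum>j. x (Suc n + j) * (if j = 0 then 0 else maxA N L j))"
    if n: "n \<in> {N..<L}" for n
  proof -
    have "(\<Sum>j. x (Suc n + j) * (if j = 0 then 0 else A n j))
        \<le> (\<Sum>j. x (Suc n + j) * (if j = 0 then 0 else maxA N L j))"
    proof (rule suminf_le)
      show "x (Suc n + j) * (if j = 0 then 0 else A n j) \<le> x (Suc n + j) * (if j = 0 then 0 else maxA N L j)" for j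
        using maxA_ge[OF L(1), of n j] n x_nonneg by (intro mult_left_mono) auto
      show "summable (\<lambda>j. x (Suc n + j) * (if j = 0 then 0 else A n j))"
        using hankel_sum_le(2)[OF x_nonneg _ ge1 submult' x_summable
            summable_weighted[OF summable_if_0(1)[OF A_summable[of n]]] _ , of 0 "T 0" "{}" "Suc n"] Tge[of _ 0]
        by (auto simp: A_nonneg)
      show "summable (\<lambda>j. x (Suc n + j) * (if j = 0 then 0 else maxA N L j))"
        using hankel_sum_le(2)[OF x_nonneg _ ge1 submult' x_summable
            summable_weighted[OF summable_if_0(1)[OF summable_maxA[OF L(1)]]] _ , of 0 "T 0" "{}" "Suc n"] Tge[of _ 0]
        by (auto simp: maxA_nonneg[OF L(1)])
    qed
    thus ?thesis using x_le[of n] by linarith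
  qed
  have split: "T (Suc N) = (\<Sum>k\<in>{Suc N..<Suc L}. \<omega> k * x k) + T (Suc L)"
  proof -
    have sx': "summable (\<lambda>k. \<omega> (k + Suc N) * x (k + Suc N))"
      by (rule summable_ignore_initial_segment[OF sx])
    have "T (Suc N) = (\<Sum>k. \<omega> (k + (L - N) + Suc N) * x (k + (L - N) + Suc N))
        + (\<Sum>k<L - N. \<omega> (k + Suc N) * x (k + Suc N))"
      unfolding T_def by (rule suminf_split_initial_segment[OF sx'])
    also have "(\<Sum>k. \<omega> (k + (L - N) + Suc N) * x (k + (L - N) + Suc N)) = T (Suc L)"
      unfolding T_def using L(1) by simp
    also have "(\<Sum>k<L - N. \<omega> (k + Suc N) * x (k + Suc N)) = (\<Sum>k\<in>{Suc N..<Suc L}. \<omega> k * x k)"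
      by (rule sum.reindex_bij_witness[of _ "\<lambda>k. k - Suc N" "\<lambda>k. k + Suc N"]) auto
    finally show ?thesis by simp
  qed
  have "T (Suc N) = (\<Sum>n\<in>{N..<L}. \<omega> (Suc n) * x (Suc n)) + T (Suc L)"
    unfolding split sum.shift_bounds_Suc_ivl ..
  also have "(\<Sum>n\<in>{N..<L}. \<omega> (Suc n) * x (Suc n)) \<le> (\<Sum>n\<in>{N..<L}. \<omega> (Suc n) * y n) +
      (\<Sum>n\<in>{N..<L}. \<omega> (Suc n) * (\<Sum>j. x (Suc n + j) * (if j = 0 then 0 else maxA N L j)))"
    unfolding sum.distrib[symmetric] distrib_left[symmetric]
    by (intro sum_mono mult_left_mono low nonneg)
  also have "(\<Sum>n\<in>{N..<L}. \<omega> (Suc n) * (\<Sum>j. x (Suc n + j) * (if j = 0 then 0 else maxA N L j)))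
     = (\<Sum>n\<in>Suc ` {N..<L}. \<omega> n * (\<Sum>j. x (n + j) * (if j = 0 then 0 else maxA N L j)))"
    by (subst sum.reindex) auto
  also have "\<dots> \<le> T (Suc N) * (\<Sum>j. \<omega> j * (if j = 0 then 0 else maxA N L j))"
    by (rule hankel_sum_le[OF x_nonneg _ ge1 submult' x_summable, where n = N])
      (use maxA_nonneg[OF L(1)] summable_if_0(1)[OF summable_maxA[OF L(1)]] Tge[of _ "Suc N"]
        in \<open>auto intro!: summable_weighted simp: subset_iff Suc_le_eq\<close>)
  also have "(\<Sum>j. \<omega> j * (if j = 0 then 0 else maxA N L j)) = a N"
    unfolding a_def by (intro suminf_cong) auto
  also have "T (Suc N) * a N \<le> T (Suc N) * (1/4)" by (intro mult_left_mono aN T0)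
  also have "T (Suc L) \<le> T L"
    unfolding T_def
    using suminf_split_head[OF summable_ignore_initial_segment[OF sx, of L]] nonneg[of L] x_nonneg[of L]
    by simp
  \<comment> \<open>The chain amounts to \<open>T (Suc N) \<le> 1/8 + T (Suc N) / 4 + 1/8\<close>,
    the last term bounding \<open>T L\<close>.\<close>
  finally have "T (Suc N) \<le> 1/2" using e[of L] L(2) by simp
  thus ?thesis using Tge[of "{N<..<K}" "Suc N"] by (auto simp: subset_iff)
qed

end

section \<open>Removal of the truncation\<close>

context scattering_bounds
begin

text \<open>In each direction \<open>N\<close> makes a tail small for \<open>\<omega>\<close>
  itself, and so for all truncations. A partial sum up to \<open>L\<close> sees finitely many
  weights, hence is unchanged by a suitable truncation, and its bound depends on neither
  \<open>M\<close> nor \<open>L\<close>.\<close>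

theorem summable_iff:
  assumes "weight \<omega>"
  shows "summable (\<lambda>n. \<omega> (Suc n) * y n) \<longleftrightarrow> summable (\<lambda>k. \<omega> k * x k)"
proof -
  interpret w: weight \<omega> by fact
  have y0: "y n \<ge> 0" for n by (simp add: y_eq B_nonneg)
  have \<omega>0: "\<omega> n \<ge> 0" for n using w.ge1[of n] by simp
  have sbw: "scattering_bounds_weight x y A B (\<lambda>n. min (\<omega> n) M) M" if "M \<ge> 1" for M
    unfolding scattering_bounds_weight_def scattering_bounds_weight_axioms_def
    using scattering_bounds_axioms w.weight_min[OF that] by auto
  have crit: "summable f" if "\<And>n. f n \<ge> 0" "\<And>L. (\<Sum>n\<in>{N..<L}. f n) \<le> C" for f :: "nat \<Rightarrow> real" and N C
  proof (rule summableI_nonneg_bounded[of f "(\<Sum>n<N. f n) + C"])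
    fix L
    have "(\<Sum>n<L. f n) \<le> (\<Sum>n\<in>{..<N} \<union> {N..<L}. f n)"
      using that by (intro sum_mono2) auto
    also have "\<dots> = (\<Sum>n<N. f n) + (\<Sum>n\<in>{N..<L}. f n)" by (rule sum.union_disjoint) auto
    finally show "(\<Sum>n<L. f n) \<le> (\<Sum>n<N. f n) + C" using that(2)[of L] by simp
  qed (use that in auto)
  have tail: "\<exists>N. \<forall>J. finite J \<longrightarrow> J \<subseteq> {N..} \<longrightarrow> (\<Sum>n\<in>J. f n) \<le> r"
    if sf: "summable f" and r: "r > 0" and pos: "\<And>n. f n \<ge> 0" for f :: "nat \<Rightarrow> real" and r
  proof -
    obtain N where N: "(\<Sum>n. f (n + N)) < r"
      using suminf_exist_split[OF r sf] by (metis abs_le_D1 linorder_not_less order.refl order_le_less_trans real_norm_def)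
    have "(\<Sum>n\<in>J. f n) \<le> r" if J: "finite J" "J \<subseteq> {N..}" for J
      using sum_le_shifted_suminf[OF sf pos J] N by simp
    thus ?thesis by blast
  qed
  have big: "\<exists>M\<ge>1. \<forall>n\<le>L. min (\<omega> n) M = \<omega> n" for L
  proof (intro exI[of _ "Max (\<omega> ` {..L})"] conjI allI impI)
    show "Max (\<omega> ` {..L}) \<ge> 1" using w.ge1[of 0] by (intro Max_ge_iff[THEN iffD2]) auto
    show "min (\<omega> n) (Max (\<omega> ` {..L})) = \<omega> n" if "n \<le> L" for n
      using that by (intro min_absorb1 Max_ge) auto
  qed
  show ?thesis
  proof
    assume "summable (\<lambda>k. \<omega> k * x k)"
    from tail[OF this, of "1/2"] obtain N where
      N: "\<And>J. finite J \<Longrightarrow> J \<subseteq> {N..} \<Longrightarrow> (\<Sum>n\<in>J. \<omega> n * x n) \<le> 1/2"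
      using \<omega>0 x_nonneg by auto
    show "summable (\<lambda>n. \<omega> (Suc n) * y n)"
    proof (rule crit[of _ N 1])
      fix L
      obtain M where M: "M \<ge> 1" "\<forall>n\<le>Suc L. min (\<omega> n) M = \<omega> n" using big by blast
      interpret s: scattering_bounds_weight x y A B "\<lambda>n. min (\<omega> n) M" M by (rule sbw) fact
      show "(\<Sum>n\<in>{N..<L}. \<omega> (Suc n) * y n) \<le> 1"
      proof (cases "N \<le> L")
        case True
        have "(\<Sum>n\<in>{N..<L}. \<omega> (Suc n) * y n) \<le> (\<Sum>n\<in>{N..L}. \<omega> (Suc n) * y n)"
          by (intro sum_mono2) (auto intro!: mult_nonneg_nonneg \<omega>0 y0)
        also have "\<dots> = (\<Sum>n\<in>{N..L}. min (\<omega> (Suc n)) M * y n)" using M by simp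
        also have "\<dots> \<le> 1"
        proof (rule s.verblunsky_bound[OF True])
          fix J assume J: "finite J" "J \<subseteq> {N<..}"
          have "(\<Sum>k\<in>J. min (\<omega> k) M * x k) \<le> (\<Sum>k\<in>J. \<omega> k * x k)"
            by (intro sum_mono mult_right_mono x_nonneg) auto
          also have "\<dots> \<le> 1/2" using J by (intro N) auto
          finally show "(\<Sum>k\<in>J. min (\<omega> k) M * x k) \<le> 1/2" .
        qed
        finally show ?thesis .
      qed auto
    qed (auto intro!: mult_nonneg_nonneg \<omega>0 y0)
  next
    assume "summable (\<lambda>n. \<omega> (Suc n) * y n)"
    from tail[OF this, of "1/8"] obtain N where
      N: "\<And>J. finite J \<Longrightarrow> J \<subseteq> {N..} \<Longrightarrow> (\<Sum>n\<in>J. \<omega> (Suc n) * y n) \<le> 1/8"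
      using \<omega>0 y0 by auto
    show "summable (\<lambda>n. \<omega> n * x n)"
    proof (rule crit[of _ "Suc N" "1/2"])
      fix L
      obtain M where M: "M \<ge> 1" "\<forall>n\<le>L. min (\<omega> n) M = \<omega> n" using big by blast
      interpret s: scattering_bounds_weight x y A B "\<lambda>n. min (\<omega> n) M" M by (rule sbw) fact
      have "(\<Sum>n\<in>{Suc N..<L}. \<omega> n * x n) = (\<Sum>n\<in>{N<..<L}. min (\<omega> n) M * x n)"
        using M by (intro sum.cong) auto
      also have "\<dots> \<le> 1/2"
      proof (rule s.scattering_bound)
        fix L
        have "(\<Sum>k\<in>{N..<L}. min (\<omega> (Suc k)) M * y k) \<le> (\<Sum>k\<in>{N..<L}. \<omega> (Suc k) * y k)"
          by (intro sum_mono mult_right_mono y0) auto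
        also have "\<dots> \<le> 1/8" by (intro N) auto
        finally show "(\<Sum>k\<in>{N..<L}. min (\<omega> (Suc k)) M * y k) \<le> 1/8" .
      qed
      finally show "(\<Sum>n\<in>{Suc N..<L}. \<omega> n * x n) \<le> 1/2" .
    qed (auto intro!: mult_nonneg_nonneg \<omega>0 x_nonneg)
  qed
qed

end

section \<open>Orthogonal polynomials and the Marchenko equations\<close>

lemma fourier_coeff_0: "fourier_coeff f 0 = (LBINT x:{-pi..pi}. f (cis x)) / (2 * pi)"
  by (simp add: fourier_coeff_def)

lemma fourier_coeff_cmult: "fourier_coeff (\<lambda>z. a * f z) k = a * fourier_coeff f k"
proof -
  have "(\<lambda>x. cis (- of_int k * x) * (a * f (cis x))) = (\<lambda>x. a * (cis (- of_int k * x) * f (cis x)))"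
    by (simp add: mult_ac)
  thus ?thesis unfolding fourier_coeff_def by (simp only: set_integral_mult_right) simp
qed

lemma fourier_coeff_cong:
  assumes "\<And>z. z \<in> unit_circle \<Longrightarrow> f z = g z"
  shows "fourier_coeff f k = fourier_coeff g k"
  using assms by (simp add: fourier_coeff_def)

lemma fourier_coeff_add:
  assumes "supported_on f I" "supported_on g J"
  shows "fourier_coeff (\<lambda>z. f z + g z) k = fourier_coeff f k + fourier_coeff g k"
  by (rule fourier_coeff_eq[OF fourier_expansion_add[OF assms[THEN supported_on_expansion]]])

lemma fourier_coeff_diff:
  assumes "supported_on f I" "supported_on g J"
  shows "fourier_coeff (\<lambda>z. f z - g z) k = fourier_coeff f k - fourier_coeff g k"
  by (rule fourier_coeff_eq[OF fourier_expansion_diff[OF assms[THEN supported_on_expansion]]])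

lemma fourier_coeff_shift:
  assumes "supported_on f I"
  shows "fourier_coeff (\<lambda>z. z powi m * f z) k = fourier_coeff f (k - m)"
  by (rule fourier_coeff_eq[OF fourier_expansion_shift[OF supported_on_expansion[OF assms]]])

lemma fourier_coeff_cnj:
  assumes "supported_on f I"
  shows "fourier_coeff (\<lambda>z. cnj (f z)) k = cnj (fourier_coeff f (- k))"
  by (rule fourier_coeff_eq[OF fourier_expansion_cnj[OF supported_on_expansion[OF assms]]])

lemma fourier_coeff_const: "fourier_coeff (\<lambda>_. a) k = (if k = 0 then a else 0)"
  by (rule fourier_coeff_eq[OF fourier_expansion_const])

lemma supported_on_poly:
  "supported_on (poly p) {0..int (degree p)}" and fourier_coeff_poly: "fourier_coeff (poly p) (int k) = coeff p k"
proof -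
  have "fourier_expansion (poly p) (\<lambda>k. if k \<ge> 0 then coeff p (nat k) else 0)"
  proof (rule fourier_expansionI)
    show "(\<lambda>k. if k \<ge> 0 then coeff p (nat k) else 0) abs_summable_on UNIV"
      by (rule finite_nonzero_values_imp_summable_on, rule finite_subset[of _ "{0..int (degree p)}"])
        (auto dest: le_degree)
    fix z
    show "((\<lambda>k. (if k \<ge> 0 then coeff p (nat k) else 0) * z powi k) has_sum poly p z) UNIV"
    proof (rule has_sum_finite_neutralI[of "int ` {..degree p}"])
      show "(if k \<ge> 0 then coeff p (nat k) else 0) * z powi k = 0" if k: "k \<in> UNIV - int ` {..degree p}" for k
      proof -
        have "nat k > degree p" if "k \<ge> 0"
        proof (rule ccontr)
          assume "\<not> nat k > degree p"
          hence "k \<in> int ` {..degree p}" using that by (intro image_eqI[of _ _ "nat k"]) auto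
          thus False using k by simp
        qed
        thus ?thesis by (auto simp: coeff_eq_0)
      qed
      show "poly p z = (\<Sum>k\<in>int ` {..degree p}. (if k \<ge> 0 then coeff p (nat k) else 0) * z powi k)"
        by (subst sum.reindex) (auto simp: poly_altdef)
    qed auto
  qed
  note e = this
  show "fourier_coeff (poly p) (int k) = coeff p k"
    using fourier_coeff_eq[OF e] by simp
  show "supported_on (poly p) {0..int (degree p)}"
  proof (rule supported_onI'[OF e])
    fix k assume "k \<notin> {0..int (degree p)}"
    thus "(if k \<ge> 0 then coeff p (nat k) else 0) = 0" by (auto intro: coeff_eq_0)
  qed
qed

lemma supported_on_summable:
  assumes "supported_on f I"
  shows "summable (\<lambda>j. cmod (fourier_coeff f (- int j)))"
  using supported_on_analytic_part(2)[OF fourier_expansion_cnj[OF supported_on_expansion[OF assms]]] by simp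

text \<open>As \<open>g\<close> has no negative indices, the convolution at \<open>- k\<close>
  involves \<open>f\<close> only at the indices \<open>- (k + j)\<close>: a Hankel sum.\<close>

lemma norm_fourier_coeff_mult_le:
  assumes f: "supported_on f I" and g: "supported_on g {0..}"
  shows "cmod (fourier_coeff (\<lambda>z. f z * g z) (- int k)) \<le>
    (\<Sum>j. cmod (fourier_coeff f (- int (k + j))) * cmod (fourier_coeff g (int j)))" (is ?le)
    and "summable (\<lambda>j. cmod (fourier_coeff f (- int (k + j))) * cmod (fourier_coeff g (int j)))" (is ?sum)
proof -
  let ?h = "\<lambda>l. fourier_coeff f l * fourier_coeff g (- int k - l)"
  let ?\<phi> = "\<lambda>j::nat. - int (k + j)"
  have sf: "summable (\<lambda>j. cmod (fourier_coeff f (- int (k + j))))"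
    using summable_ignore_initial_segment[OF supported_on_summable[OF f], of k] by (simp add: add.commute)
  have "(?h has_sum fourier_coeff (\<lambda>z. f z * g z) (- int k)) UNIV"
    by (rule fourier_coeff_mult[OF f g])
  hence "(?h has_sum fourier_coeff (\<lambda>z. f z * g z) (- int k)) (range ?\<phi>)"
  proof (rule has_sum_cong_neutral[THEN iffD1, rotated -1])
    fix l assume l: "l \<in> UNIV - range ?\<phi>"
    have "- int k - l < 0"
    proof (rule ccontr)
      assume "\<not> - int k - l < 0"
      hence "l = ?\<phi> (nat (- int k - l))" by simp
      thus False using l by blast
    qed
    thus "?h l = 0" using supported_on_coeff[OF g, of "- int k - l"] by simp
  qed auto
  hence 1: "((\<lambda>j. fourier_coeff f (- int (k + j)) * fourier_coeff g (int j)) has_sum fourier_coeff (\<lambda>z. f z * g z) (- int k)) UNIV"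
    by (subst (asm) has_sum_reindex) (auto simp: o_def inj_on_def)
  let ?m = "\<lambda>j. cmod (fourier_coeff f (- int (k + j))) * cmod (fourier_coeff g (int j))"
  have "cmod (fourier_coeff g m) \<le> l1_norm (fourier_coeff g)" for m
    using fourier_expansion_coeff_le[OF supported_on_expansion[OF g] fourier_expansion_norm_le[OF supported_on_expansion[OF g]]]
    by blast
  thus ?sum
    by (intro summable_comparison_test'[OF summable_mult2[OF sf, of "l1_norm (fourier_coeff g)"], of 0])
      (auto intro: mult_left_mono)
  hence "(?m has_sum suminf ?m) UNIV"
    by (intro norm_summable_imp_has_sum summable_sums) (auto simp: abs_mult)
  from norm_infsum_le[OF 1 this] show ?le by (simp add: norm_mult)
qed

text \<open>The constant term goes to \<open>g\<close>; a shift by one index and back obtains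
  \<open>h\<close> from an analytic part.\<close>

lemma supported_on_split:
  assumes "supported_on f UNIV"
  obtains g h where "supported_on g {..0}" "supported_on h {1..}" "\<And>z. z \<in> unit_circle \<Longrightarrow> f z = g z + h z"
proof -
  let ?c = "fourier_coeff f"
  note e = supported_on_expansion[OF assms]
  note e' = fourier_expansion_shift[OF e, of "-1"]
  obtain P where P: "fourier_expansion P (\<lambda>k. if k \<ge> 0 then ?c (k + 1) else 0)"
    using supported_on_analytic_part(1)[OF e', unfolded diff_minus_eq_add] by blast
  define h where "h = (\<lambda>z. z powi 1 * P z)"
  have "(\<lambda>k. if k - 1 \<ge> 0 then ?c (k - 1 + 1) else 0) = (\<lambda>k. if k \<ge> 1 then ?c k else 0)"
    by (rule ext) simp
  hence h: "fourier_expansion h (\<lambda>k. if k \<ge> 1 then ?c k else 0)"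
    using fourier_expansion_shift[OF P, of 1] unfolding h_def by (simp only:)
  show ?thesis
  proof (rule that)
    show "supported_on (\<lambda>z. f z - h z) {..0}"
      by (rule supported_onI'[OF fourier_expansion_diff[OF e h]]) auto
    show "supported_on h {1..}" by (rule supported_onI'[OF h]) auto
  qed simp
qed

section \<open>The factorized weight and its Jost functions\<close>

locale szego_weight =
  fixes w :: "complex \<Rightarrow> real" and G :: "complex \<Rightarrow> complex"
  assumes pos: "z \<in> unit_circle \<Longrightarrow> w z > 0"
    and G: "supported_on G {0..}"
    and w_eq: "z \<in> unit_circle \<Longrightarrow> complex_of_real (w z) = exp (G z + cnj (G z))"
begin

abbreviation "W \<equiv> \<lambda>z. complex_of_real (w z)"
abbreviation "D \<equiv> \<lambda>z. exp (G z)"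
abbreviation "D' \<equiv> \<lambda>z. cnj (exp (G z))"
abbreviation "S \<equiv> \<lambda>z. exp (G z - cnj (G z))"

lemma D: "supported_on D {0..}"
  by (rule supported_on_exp[OF G]) auto

lemma D': "supported_on D' {..0}"
  by (rule supported_on_cnj[OF D]) auto

lemma D_inverse: "supported_on (\<lambda>z. exp (- G z)) {0..}"
  using supported_on_exp[OF supported_on_cmult[OF G, of "-1"]] by simp

lemma W_eq: "z \<in> unit_circle \<Longrightarrow> W z = D z * D' z"
  by (simp add: w_eq exp_add exp_cnj)

lemma S_eq: "S z = D z / D' z"
  by (simp add: exp_diff exp_cnj)

lemma W: "supported_on W UNIV"
  by (rule supported_on_cong[OF supported_on_mult[OF D D']]) (auto simp: W_eq)

lemma S: "supported_on S UNIV"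
proof (rule supported_on_cong[OF supported_on_mult[OF D supported_on_cnj[OF D_inverse]]])
  show "exp (G z) * cnj (exp (- G z)) = S z" for z
    by (simp add: exp_diff exp_cnj exp_minus field_simps)
qed auto

text \<open>A continuous nonnegative function with integral 0 vanishes identically, whereas
  \<open>p\<close> has only finitely many zeros.\<close>

lemma weighted_norm_pos:
  assumes "p \<noteq> 0"
  obtains \<rho> where "\<rho> > 0" "fourier_coeff (\<lambda>z. poly p z * cnj (poly p z) * W z) 0 = complex_of_real \<rho>"
proof -
  define h where "h = (\<lambda>x. (cmod (poly p (cis x)))\<^sup>2 * w (cis x))"
  have "continuous_on unit_circle (\<lambda>z. Re (W z))"
    by (intro continuous_intros fourier_expansion_continuous[OF supported_on_expansion[OF W]])
  hence "continuous_on unit_circle w" by simp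
  hence "continuous_on {-pi..pi} (\<lambda>x. w (cis x))"
    by (rule continuous_on_compose2) (auto intro!: continuous_intros)
  hence cont: "continuous_on {-pi..pi} h" unfolding h_def
    by (intro continuous_intros)
  have h0: "h x \<ge> 0" for x unfolding h_def using pos[of "cis x"] by simp
  have "(LBINT x:{-pi..pi}. h x) = integral {-pi..pi} h"
    by (intro set_borel_integral_eq_integral borel_integrable_atLeastAtMost' cont)
  moreover have "integral {-pi..pi} h \<ge> 0"
    by (intro integral_nonneg integrable_continuous_real cont h0)
  moreover have "integral {-pi..pi} h \<noteq> 0"
  proof
    assume "integral {-pi..pi} h = 0"
    hence "h x = 0" if "x \<in> {-pi..pi}" for x
      using integral_eq_0_iff[OF cont] h0 that by auto
    hence "poly p (cis x) = 0" if "x \<in> {-pi..pi}" for x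
      using that pos[of "cis x"] by (fastforce simp: h_def)
    \<comment> \<open>Half of the circle already contains infinitely many points, and
      \<open>cis\<close> is injective there because the cosine is.\<close>
    hence "cis ` {0..pi} \<subseteq> {z. poly p z = 0}" by auto
    hence "finite (cis ` {0..pi})" using poly_roots_finite[OF assms] finite_subset by blast
    moreover have "inj_on cis {0..pi}"
      by (rule inj_onI) (metis atLeastAtMost_iff cis.sel(1) cos_inj_pi)
    ultimately have "finite {0..pi}" using finite_imageD by blast
    thus False using infinite_Icc[OF pi_gt_zero] by simp
  qed
  ultimately have I: "(LBINT x:{-pi..pi}. h x) > 0" by linarith
  have "fourier_coeff (\<lambda>z. poly p z * cnj (poly p z) * W z) 0 = (LBINT x:{-pi..pi}. complex_of_real (h x)) / (2 * pi)"
    by (simp only: fourier_coeff_0 h_def of_real_mult complex_norm_square)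
  also have "\<dots> = complex_of_real ((LBINT x:{-pi..pi}. h x) / (2 * pi))"
    by (simp add: set_integral_complex_of_real)
  finally show ?thesis using I by (intro that[of "(LBINT x:{-pi..pi}. h x) / (2 * pi)"]) simp_all
qed

text \<open>\<open>reversed_OP\<close> for an arbitrary polynomial, so that the recurrence can be
  built before its polynomials are identified with \<open>monic_OP\<close>.\<close>

definition reversed :: "complex poly \<Rightarrow> complex poly" where
  "reversed p = reflect_poly (map_poly cnj p)"

lemma poly_reversed:
  assumes "z \<in> unit_circle"
  shows "poly (reversed p) z = z ^ degree p * cnj (poly p z)"
proof -
  have "cnj (inverse z) = z" using cnj_circle[OF assms] by (metis complex_cnj_cnj)
  thus ?thesis using circle_nonzero[OF assms]
    by (simp add: reversed_def poly_reflect_poly_nz degree_map_poly)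
qed

lemma degree_reversed: "degree (reversed p) \<le> degree p"
  unfolding reversed_def using degree_reflect_poly_le[of "map_poly cnj p"] by (simp add: degree_map_poly)

text \<open>On the circle, \<open>z ^ n * cnj (poly p z)\<close> is \<open>\<Phi>\<^sub>n\<^sup>*\<close> when \<open>p\<close> is \<open>\<Phi>\<^sub>n\<close>.\<close>

definition jost :: "nat \<Rightarrow> complex poly \<Rightarrow> (complex \<Rightarrow> complex) \<Rightarrow> (complex \<Rightarrow> complex) \<Rightarrow> bool" where
  "jost n p a b \<longleftrightarrow> degree p = n \<and> lead_coeff p = 1 \<and> supported_on a {..0} \<and>
     supported_on b {..- int n - 1} \<and>
     (\<forall>z\<in>unit_circle. z ^ n * cnj (poly p z) * W z = a z * D' z - cnj (b z) * D z)"

text \<open>For \<open>p = 1\<close> the equation is a splitting of \<open>W\<close>: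
  \<open>a\<close> is the part with indices at most 0 divided by \<open>D'\<close>, and
  \<open>- cnj (b z)\<close> the part with positive indices divided by \<open>D\<close>. The
  inverses are again exponentials with the right support.\<close>

lemma jost_base: "\<exists>a b. jost 0 1 a b"
proof -
  obtain g h where gh: "supported_on g {..0}" "supported_on h {1..}" "\<And>z. z \<in> unit_circle \<Longrightarrow> W z = g z + h z"
    using supported_on_split[OF W] by blast
  have inv: "supported_on (\<lambda>z. cnj (exp (- G z))) {..0}"
    by (rule supported_on_cnj[OF D_inverse]) auto
  have "jost 0 1 (\<lambda>z. g z * cnj (exp (- G z))) (\<lambda>z. - 1 * cnj (h z * exp (- G z)))"
    unfolding jost_def
  proof (intro conjI ballI)
    show "supported_on (\<lambda>z. g z * cnj (exp (- G z))) {..0}"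
      by (rule supported_on_mult[OF gh(1) inv]) auto
    have "supported_on (\<lambda>z. h z * exp (- G z)) {1..}"
      by (rule supported_on_mult[OF gh(2) D_inverse]) auto
    thus "supported_on (\<lambda>z. - 1 * cnj (h z * exp (- G z))) {..- int 0 - 1}"
      by (intro supported_on_cmult supported_on_cnj) auto
    show "z ^ 0 * cnj (poly 1 z) * W z = g z * cnj (exp (- G z)) * D' z - cnj (- 1 * cnj (h z * exp (- G z))) * D z"
      if "z \<in> unit_circle" for z
      using gh(3)[OF that] by (simp add: exp_cnj exp_minus mult.assoc)
  qed auto
  thus ?thesis by blast
qed

text \<open>The product is the squared norm of \<open>p\<close> with respect to \<open>W\<close>, as
  a mean. When the defining equation is multiplied by \<open>z powi (- int n) * poly p z\<close>,
  the term with \<open>b\<close> gets only positive indices, and at index 0 the other term is a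
  product of values at infinity.\<close>

lemma jost_norm:
  assumes "jost n p a b"
  obtains \<rho> where "\<rho> > 0" "fourier_coeff a 0 * fourier_coeff D' 0 = complex_of_real \<rho>"
proof -
  have p: "degree p = n" "lead_coeff p = 1" and a: "supported_on a {..0}" and b: "supported_on b {..- int n - 1}"
    and eq: "\<And>z. z \<in> unit_circle \<Longrightarrow> z ^ n * cnj (poly p z) * W z = a z * D' z - cnj (b z) * D z"
    using assms by (auto simp: jost_def)
  have p0: "p \<noteq> 0" using p(2) by auto
  obtain \<rho> where \<rho>: "\<rho> > 0" "fourier_coeff (\<lambda>z. poly p z * cnj (poly p z) * W z) 0 = complex_of_real \<rho>"
    using weighted_norm_pos[OF p0] by blast
  let ?v = "\<lambda>z. z powi (- int n) * poly p z"
  have v: "supported_on ?v {..0}"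
    by (rule supported_on_shift[OF supported_on_poly]) (auto simp: p)
  have v0: "fourier_coeff ?v 0 = 1"
    using fourier_coeff_shift[OF supported_on_poly, of "- int n" p 0] fourier_coeff_poly[of p n] p by simp
  have v': "supported_on ?v {- int n..}"
    by (rule supported_on_shift[OF supported_on_poly]) auto
  have aD: "supported_on (\<lambda>z. a z * D' z) {..0}" by (rule supported_on_mult[OF a D']) auto
  have b': "supported_on (\<lambda>z. cnj (b z)) {int n + 1..}" by (rule supported_on_cnj[OF b]) auto
  have bD: "supported_on (\<lambda>z. cnj (b z) * D z) {int n + 1..}" by (rule supported_on_mult[OF b' D]) auto
  have vaD: "supported_on (\<lambda>z. ?v z * (a z * D' z)) {..0}" by (rule supported_on_mult[OF v aD]) auto
  have vbD: "supported_on (\<lambda>z. ?v z * (cnj (b z) * D z)) {1..}"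
    by (rule supported_on_mult[OF v' bD]) auto
  have "complex_of_real \<rho> = fourier_coeff (\<lambda>z. ?v z * (a z * D' z) - ?v z * (cnj (b z) * D z)) 0"
    unfolding \<rho>(2)[symmetric]
  proof (rule fourier_coeff_cong)
    fix z assume z: "z \<in> unit_circle"
    have "?v z * (z ^ n * cnj (poly p z) * W z) = poly p z * cnj (poly p z) * W z"
      using circle_nonzero[OF z] by (simp add: power_int_minus field_simps)
    thus "poly p z * cnj (poly p z) * W z = ?v z * (a z * D' z) - ?v z * (cnj (b z) * D z)"
      unfolding eq[OF z] by (simp only: right_diff_distrib)
  qed
  also have "\<dots> = fourier_coeff (\<lambda>z. ?v z * (a z * D' z)) 0"
    using fourier_coeff_diff[OF vaD vbD] supported_on_coeff[OF vbD] by simp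
  also have "\<dots> = fourier_coeff a 0 * fourier_coeff D' 0"
    using fourier_coeff_mult_nonpos[OF v aD] fourier_coeff_mult_nonpos[OF a D'] v0 by simp
  finally show ?thesis using \<rho>(1) that by metis
qed

text \<open>The choice of \<alpha> cancels the coefficient of the new \<open>b\<close> at
  \<open>- int (Suc n)\<close>. The Szego recurrence combines the defining equation with its
  conjugate, which exchanges the roles of \<open>a\<close> and \<open>b\<close>.\<close>

lemma jost_step:
  assumes "jost n p a b"
  defines "\<alpha> \<equiv> - cnj (fourier_coeff b (- int (Suc n)) / fourier_coeff a 0)"
  shows "jost (Suc n) (pCons 0 p - smult (cnj \<alpha>) (reversed p))
    (\<lambda>z. a z + \<alpha> * (z powi (int (Suc n)) * b z)) (\<lambda>z. b z + cnj \<alpha> * (z powi (- int (Suc n)) * a z))"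
proof -
  have p: "degree p = n" "lead_coeff p = 1" and a: "supported_on a {..0}" and b: "supported_on b {..- int n - 1}"
    and eq: "\<And>z. z \<in> unit_circle \<Longrightarrow> z ^ n * cnj (poly p z) * W z = a z * D' z - cnj (b z) * D z"
    using assms by (auto simp: jost_def)
  obtain \<rho> where "\<rho> > 0" "fourier_coeff a 0 * fourier_coeff D' 0 = complex_of_real \<rho>"
    by (rule jost_norm[OF assms(1)])
  hence a0: "fourier_coeff a 0 \<noteq> 0" by auto
  let ?p' = "pCons 0 p - smult (cnj \<alpha>) (reversed p)"
  have p0: "p \<noteq> 0" using p(2) by auto
  have deg: "degree (smult (cnj \<alpha>) (reversed p)) \<le> n"
    using degree_reversed[of p] p(1) degree_smult_le order_trans by blast
  have "coeff (reversed p) (Suc n) = 0"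
    using degree_reversed[of p] p(1) by (intro coeff_eq_0) simp
  hence coeff: "coeff ?p' (Suc n) = 1"
    using p by simp
  have deg': "degree ?p' = Suc n"
  proof (rule antisym)
    show "degree ?p' \<le> Suc n"
      using deg p p0 by (intro degree_diff_le) auto
    show "Suc n \<le> degree ?p'" using coeff by (intro le_degree) simp
  qed
  have zb: "supported_on (\<lambda>z. z powi (int (Suc n)) * b z) {..0}"
    by (rule supported_on_shift[OF b]) auto
  have za: "supported_on (\<lambda>z. z powi (- int (Suc n)) * a z) {..- int n - 1}"
    by (rule supported_on_shift[OF a]) auto
  have b'': "supported_on (\<lambda>z. b z + cnj \<alpha> * (z powi (- int (Suc n)) * a z)) {..- int n - 1}"
    by (intro supported_on_add b supported_on_cmult za)
  show ?thesis unfolding jost_def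
  proof (intro conjI ballI)
    show "lead_coeff ?p' = 1" using coeff deg' by simp
    show "supported_on (\<lambda>z. a z + \<alpha> * (z powi (int (Suc n)) * b z)) {..0}"
      by (intro supported_on_add a supported_on_cmult zb)
    \<comment> \<open>The support \<open>{..- int n - 1}\<close> is known; a single index remains to
      be removed.\<close>
    show "supported_on (\<lambda>z. b z + cnj \<alpha> * (z powi (- int (Suc n)) * a z)) {..- int (Suc n) - 1}"
    proof (rule supported_onI[OF b''])
      fix k assume "k \<in> {..- int n - 1}" "k \<notin> {..- int (Suc n) - 1}"
      hence k: "k = - int (Suc n)" by auto
      have "fourier_coeff (\<lambda>z. b z + cnj \<alpha> * (z powi (- int (Suc n)) * a z)) k =
          fourier_coeff b k + cnj \<alpha> * fourier_coeff a (k - - int (Suc n))"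
        by (simp only: fourier_coeff_add[OF b supported_on_cmult[OF za]] fourier_coeff_cmult fourier_coeff_shift[OF a])
      also have "\<dots> = 0" using a0 by (simp add: k \<alpha>_def)
      finally show "fourier_coeff (\<lambda>z. b z + cnj \<alpha> * (z powi (- int (Suc n)) * a z)) k = 0" .
    qed
    fix z assume z: "z \<in> unit_circle"
    let ?v = "z ^ n * cnj (poly p z)"
    have z0: "z \<noteq> 0" by (rule circle_nonzero[OF z])
    have cz: "cnj z = inverse z" by (rule cnj_circle[OF z])
    have "z ^ Suc n * cnj (poly ?p' z) = ?v - \<alpha> * z ^ Suc n * cnj ?v"
      using z0 p(1) by (simp add: poly_reversed[OF z] cz right_diff_distrib)
    hence "z ^ Suc n * cnj (poly ?p' z) * W z = ?v * W z - \<alpha> * z ^ Suc n * cnj (?v * W z)"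
      by (simp add: left_diff_distrib)
    also have "\<dots> = (a z * D' z - cnj (b z) * D z) - \<alpha> * z ^ Suc n * cnj (a z * D' z - cnj (b z) * D z)"
      unfolding eq[OF z] ..
    also have "\<dots> = (a z + \<alpha> * (z powi (int (Suc n)) * b z)) * D' z
        - cnj (b z + cnj \<alpha> * (z powi (- int (Suc n)) * a z)) * D z"
    proof -
      have 1: "z powi int (Suc n) = z ^ Suc n" by (rule power_int_of_nat)
      have 2: "cnj (z powi (- int (Suc n))) = z ^ Suc n"
        by (simp only: power_int_minus power_int_of_nat complex_cnj_inverse complex_cnj_power cz
            power_inverse inverse_inverse_eq)
      show ?thesis
        by (simp only: 1 2 complex_cnj_add complex_cnj_mult complex_cnj_cnj complex_cnj_diff)
          (simp add: algebra_simps)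
    qed
    finally show "z ^ Suc n * cnj (poly ?p' z) * W z = (a z + \<alpha> * (z powi (int (Suc n)) * b z)) * D' z
        - cnj (b z + cnj \<alpha> * (z powi (- int (Suc n)) * a z)) * D z" .
  qed (rule deg')
qed

end

text \<open>\<open>t\<close> will be the modulus of \<open>a n\<close> at infinity, so that the
  Hankel bound is one for normalized coefficients.\<close>

lemma scaled_fourier_coeff_mult_cnj_le:
  assumes f: "supported_on f I" and g: "supported_on g {..0}" and t: "t \<ge> 0"
  shows "cmod (fourier_coeff (\<lambda>z. f z * cnj (g z)) (- int k)) / t \<le>
    (\<Sum>j. cmod (fourier_coeff f (- int (k + j))) * (cmod (fourier_coeff g (- int j)) / t))"
proof -
  have cg: "supported_on (\<lambda>z. cnj (g z)) {0..}" by (rule supported_on_cnj[OF g]) auto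
  note le = norm_fourier_coeff_mult_le[OF f cg, of k, unfolded fourier_coeff_cnj[OF g] complex_mod_cnj]
  show ?thesis
    using divide_right_mono[OF le(1) t] suminf_divide[OF le(2), of t] by simp
qed

section \<open>Marchenko equations and the Szego recurrence\<close>

context szego_weight
begin

text \<open>These are the Marchenko equations. Dividing the defining equation and its conjugate by
  \<open>D'\<close> leaves \<open>D\<close> times \<open>z ^ n * cnj (poly p z)\<close> or its
  conjugate, whose supports are known.\<close>

lemma jost_scattering:
  assumes "jost n p a b"
  shows "supported_on (\<lambda>z. S z * cnj (a z) - b z) {- int n..}"
    and "supported_on (\<lambda>z. a z - S z * cnj (b z)) {0..}"
proof -
  have p: "degree p = n"
    and eq: "\<And>z. z \<in> unit_circle \<Longrightarrow> z ^ n * cnj (poly p z) * W z = a z * D' z - cnj (b z) * D z"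
    using assms by (auto simp: jost_def)
  let ?v = "\<lambda>z. z powi int n * cnj (poly p z)"
  have cp: "supported_on (\<lambda>z. cnj (poly p z)) {- int n..0}"
    by (rule supported_on_cnj[OF supported_on_poly]) (auto simp: p)
  have v: "supported_on ?v {0..}"
    by (rule supported_on_shift[OF cp]) auto
  have v': "supported_on (\<lambda>z. cnj (?v z)) {- int n..}"
    by (rule supported_on_cnj[OF supported_on_shift[OF cp order.refl]]) auto
  have D0: "D z \<noteq> 0" "D' z \<noteq> 0" for z by auto
  have eq': "?v z * D z * D' z = a z * D' z - cnj (b z) * D z" if z: "z \<in> unit_circle" for z
    using eq[OF z] by (simp add: W_eq[OF z] mult.assoc)
  show "supported_on (\<lambda>z. a z - S z * cnj (b z)) {0..}"
  proof (rule supported_on_cong[OF supported_on_mult[OF v D]])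
    show "?v z * D z = a z - S z * cnj (b z)" if "z \<in> unit_circle" for z
      using arg_cong[OF eq'[OF that], of "\<lambda>u. u / D' z"] D0[of z]
      unfolding S_eq by (simp add: diff_divide_distrib mult.commute)
  qed auto
  show "supported_on (\<lambda>z. S z * cnj (a z) - b z) {- int n..}"
  proof (rule supported_on_cong[OF supported_on_mult[OF v' D]])
    show "cnj (?v z) * D z = S z * cnj (a z) - b z" if z: "z \<in> unit_circle" for z
    proof -
      have "cnj (?v z) * D' z * D z = cnj (a z) * D z - b z * D' z"
        using arg_cong[OF eq'[OF z], of cnj] by simp
      from arg_cong[OF this, of "\<lambda>u. u / D' z"] show ?thesis using D0[of z]
        unfolding S_eq by (simp add: diff_divide_distrib mult.commute)
    qed
  qed auto
qed

lemma jost_sequence: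
  obtains P a b \<alpha> where
    "\<And>n. jost n (P n) (a n) (b n)"
    "\<And>n. \<alpha> n = - cnj (fourier_coeff (b n) (- int (Suc n)) / fourier_coeff (a n) 0)"
    "\<And>n. P (Suc n) = pCons 0 (P n) - smult (cnj (\<alpha> n)) (reversed (P n))"
    "\<And>n. a (Suc n) = (\<lambda>z. a n z + \<alpha> n * (z powi (int (Suc n)) * b n z))"
    "\<And>n. b (Suc n) = (\<lambda>z. b n z + cnj (\<alpha> n) * (z powi (- int (Suc n)) * a n z))"
proof -
  let ?J = "\<lambda>n (p, a, b). jost n p a b"
  let ?\<alpha> = "\<lambda>n (p :: complex poly, a, b). - cnj (fourier_coeff b (- int (Suc n)) / fourier_coeff a 0)"
  let ?Q = "\<lambda>n (p, a, b) (p', a', b').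
    p' = pCons 0 p - smult (cnj (?\<alpha> n (p, a, b))) (reversed p) \<and>
    a' = (\<lambda>z. a z + ?\<alpha> n (p, a, b) * (z powi (int (Suc n)) * b z)) \<and>
    b' = (\<lambda>z. b z + cnj (?\<alpha> n (p, a, b)) * (z powi (- int (Suc n)) * a z))"
  have "\<exists>f. \<forall>n. ?J n (f n) \<and> ?Q n (f n) (f (Suc n))"
  proof (rule dependent_nat_choice)
    show "\<exists>x. ?J 0 x" using jost_base by auto
    show "\<exists>y. ?J (Suc n) y \<and> ?Q n x y" if J: "?J n x" for x n
    proof -
      obtain p a b where x: "x = (p, a, b)" by (cases x) auto
      have "jost n p a b" using J by (simp add: x)
      from jost_step[OF this] show ?thesis
        by (intro exI[of _ "(pCons 0 p - smult (cnj (?\<alpha> n (p, a, b))) (reversed p),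
          \<lambda>z. a z + ?\<alpha> n (p, a, b) * (z powi (int (Suc n)) * b z),
          \<lambda>z. b z + cnj (?\<alpha> n (p, a, b)) * (z powi (- int (Suc n)) * a z))"]) (simp add: x)
    qed
  qed
  then obtain f where f: "\<forall>n. ?J n (f n) \<and> ?Q n (f n) (f (Suc n))" by (rule exE)
  have J: "?J n (f n)" and Q: "?Q n (f n) (f (Suc n))" for n
    using spec[OF f, of n] by (rule conjunct1, rule conjunct2)
  show ?thesis
    by (rule that[of "\<lambda>n. fst (f n)" "\<lambda>n. fst (snd (f n))" "\<lambda>n. snd (snd (f n))" "\<lambda>n. ?\<alpha> n (f n)"])
      (use J Q in \<open>simp_all add: case_prod_unfold\<close>)
qed

context
  fixes P :: "nat \<Rightarrow> complex poly" and a b :: "nat \<Rightarrow> complex \<Rightarrow> complex" and \<alpha> :: "nat \<Rightarrow> complex"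
  assumes J: "\<And>n. jost n (P n) (a n) (b n)"
    and \<alpha>: "\<And>n. \<alpha> n = - cnj (fourier_coeff (b n) (- int (Suc n)) / fourier_coeff (a n) 0)"
    and a_Suc: "\<And>n. a (Suc n) = (\<lambda>z. a n z + \<alpha> n * (z powi (int (Suc n)) * b n z))"
    and b_Suc: "\<And>n. b (Suc n) = (\<lambda>z. b n z + cnj (\<alpha> n) * (z powi (- int (Suc n)) * a n z))"
begin

lemma a: "supported_on (a n) {..0}" and b: "supported_on (b n) {..- int n - 1}"
  using J[of n] by (auto simp: jost_def)

text \<open>By the choice of \<alpha>, \<open>b n\<close> has coefficient
  \<open>- (cnj (\<alpha> n) * fourier_coeff (a n) 0)\<close> at \<open>- int (Suc n)\<close>; the
  recurrence turns it into the factor. The factor is positive as a ratio of two squared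
  norms.\<close>

lemma norming_constant:
  shows "fourier_coeff (a n) 0 \<noteq> 0"
    and "fourier_coeff (a (Suc n)) 0 = complex_of_real (1 - (cmod (\<alpha> n))\<^sup>2) * fourier_coeff (a n) 0"
    and "cmod (\<alpha> n) < 1"
proof -
  let ?t = "\<lambda>n. fourier_coeff (a n) 0"
  obtain \<rho> where \<rho>: "\<rho> > 0" "?t n * fourier_coeff D' 0 = complex_of_real \<rho>"
    by (rule jost_norm[OF J])
  obtain \<rho>' where \<rho>': "\<rho>' > 0" "?t (Suc n) * fourier_coeff D' 0 = complex_of_real \<rho>'"
    by (rule jost_norm[OF J])
  show t0: "?t n \<noteq> 0" using \<rho> by auto
  have zb: "supported_on (\<lambda>z. z powi (int (Suc n)) * b n z) {..0}"
    by (rule supported_on_shift[OF b]) auto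
  have bn: "fourier_coeff (b n) (- int (Suc n)) = - (cnj (\<alpha> n) * ?t n)"
    using t0 by (simp add: \<alpha>)
  have "?t (Suc n) = ?t n + \<alpha> n * fourier_coeff (b n) (0 - int (Suc n))"
    unfolding a_Suc
    by (simp only: fourier_coeff_add[OF a supported_on_cmult[OF zb]] fourier_coeff_cmult fourier_coeff_shift[OF b])
  also have "\<dots> = (1 - \<alpha> n * cnj (\<alpha> n)) * ?t n"
    by (simp only: diff_0 bn) (simp add: algebra_simps)
  also have "1 - \<alpha> n * cnj (\<alpha> n) = complex_of_real (1 - (cmod (\<alpha> n))\<^sup>2)"
    by (simp only: of_real_diff complex_norm_square of_real_1)
  finally show t: "?t (Suc n) = complex_of_real (1 - (cmod (\<alpha> n))\<^sup>2) * ?t n" .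
  have "complex_of_real \<rho>' = complex_of_real ((1 - (cmod (\<alpha> n))\<^sup>2) * \<rho>)"
    by (simp only: of_real_mult \<rho>(2)[symmetric] \<rho>'(2)[symmetric] t mult.assoc)
  hence "\<rho>' = (1 - (cmod (\<alpha> n))\<^sup>2) * \<rho>" by (simp only: of_real_eq_iff)
  hence "(cmod (\<alpha> n))\<^sup>2 < 1"
    using \<rho>(1) \<rho>'(1) zero_less_mult_pos2 by fastforce
  thus "cmod (\<alpha> n) < 1" by (simp add: power_less_one_iff abs_square_less_1)
qed

definition coeff_a :: "nat \<Rightarrow> nat \<Rightarrow> real" where
  "coeff_a n j = cmod (fourier_coeff (a n) (- int j)) / cmod (fourier_coeff (a n) 0)"

definition coeff_b :: "nat \<Rightarrow> nat \<Rightarrow> real" where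
  "coeff_b n k = cmod (fourier_coeff (b n) (- int k)) / cmod (fourier_coeff (a n) 0)"

text \<open>The bounds are the Marchenko equations and the inverted recurrence, read
  coefficientwise. Inverting the recurrence produces the determinant
  \<open>1 - (cmod (\<alpha> n))\<^sup>2\<close>, which is the ratio of consecutive values at
  infinity and so disappears after normalization.\<close>

lemma scattering_bounds_jost:
  "scattering_bounds (\<lambda>k. cmod (fourier_coeff S (- int k))) (\<lambda>n. cmod (\<alpha> n)) coeff_a coeff_b"
proof
  fix n j k :: nat
  let ?t = "\<lambda>n. fourier_coeff (a n) 0"
  let ?x = "\<lambda>k. cmod (fourier_coeff S (- int k))"
  note t0 = norming_constant(1)
  have bj: "coeff_b n k = 0" if "k \<le> n" for k n
    using supported_on_coeff[OF b[of n], of "- int k"] that by (simp add: coeff_b_def)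
  show "0 \<le> ?x k" "0 \<le> coeff_a n k" "0 \<le> coeff_b n k" by (auto simp: coeff_a_def coeff_b_def)
  show "summable ?x" by (rule supported_on_summable[OF S])
  show "summable (coeff_a n)" "summable (coeff_b n)"
    unfolding coeff_a_def coeff_b_def by (intro summable_divide supported_on_summable[OF a] supported_on_summable[OF b])+
  show "k \<le> n \<Longrightarrow> coeff_b n k = 0" by (rule bj)
  show "coeff_a n 0 = 1" using t0[of n] by (simp add: coeff_a_def)
  show "cmod (\<alpha> n) = coeff_b n (Suc n)" by (simp add: coeff_b_def \<alpha> norm_divide)
  have b0: "supported_on (b n) {..0}" by (rule supported_on_mono[OF b]) auto
  have ca: "supported_on (\<lambda>z. cnj (a n z)) {0..}" by (rule supported_on_cnj[OF a]) auto
  have cb: "supported_on (\<lambda>z. cnj (b n z)) {0..}" by (rule supported_on_cnj[OF b]) auto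
  have Sa: "supported_on (\<lambda>z. S z * cnj (a n z)) UNIV" by (rule supported_on_mult[OF S ca]) auto
  have Sb: "supported_on (\<lambda>z. S z * cnj (b n z)) UNIV" by (rule supported_on_mult[OF S cb]) auto
  have b_eq: "fourier_coeff (b n) (- int k) = fourier_coeff (\<lambda>z. S z * cnj (a n z)) (- int k)" if "k > n" for k
    using supported_on_coeff[OF jost_scattering(1)[OF J[of n]], of "- int k"] that
    by (simp add: fourier_coeff_diff[OF Sa b])
  have a_eq: "fourier_coeff (a n) (- int j) = fourier_coeff (\<lambda>z. S z * cnj (b n z)) (- int j)" if "j > 0" for j
    using supported_on_coeff[OF jost_scattering(2)[OF J[of n]], of "- int j"] that
    by (simp add: fourier_coeff_diff[OF a Sb])
  show "coeff_b n k \<le> (\<Sum>j. ?x (k + j) * coeff_a n j)" if "n < k"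
    using scaled_fourier_coeff_mult_cnj_le[OF S a, of "cmod (?t n)" n k] b_eq[OF that]
    by (simp add: coeff_a_def coeff_b_def)
  show "coeff_a n j \<le> (\<Sum>k. ?x (j + k) * coeff_b n k)" if "0 < j"
    using scaled_fourier_coeff_mult_cnj_le[OF S b0, of "cmod (?t n)" j] a_eq[OF that]
    by (simp add: coeff_a_def coeff_b_def)
  show "?x (Suc n) \<le> cmod (\<alpha> n) + (\<Sum>j. ?x (Suc n + j) * (if j = 0 then 0 else coeff_a n j))"
  proof -
    \<comment> \<open>Splitting off the value at infinity isolates the term with
      \<open>?x (Suc n)\<close> in the Marchenko equation.\<close>
    let ?g = "\<lambda>z. a n z - ?t n"
    have g: "supported_on ?g {..0}" by (intro supported_on_diff a supported_on_const) simp
    have Sg: "supported_on (\<lambda>z. S z * cnj (?g z)) UNIV"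
      by (rule supported_on_mult[OF S supported_on_cnj[OF g order.refl]]) auto
    let ?k = "- int (Suc n)"
    have "fourier_coeff (\<lambda>z. S z * cnj (a n z)) ?k
        = fourier_coeff (\<lambda>z. S z * cnj (?g z) + cnj (?t n) * S z) ?k"
      by (rule fourier_coeff_cong) (simp add: algebra_simps)
    also have "\<dots> = fourier_coeff (\<lambda>z. S z * cnj (?g z)) ?k + cnj (?t n) * fourier_coeff S ?k"
      by (simp only: fourier_coeff_add[OF Sg supported_on_cmult[OF S]] fourier_coeff_cmult)
    finally have eq: "cnj (?t n) * fourier_coeff S ?k = fourier_coeff (b n) ?k - fourier_coeff (\<lambda>z. S z * cnj (?g z)) ?k"
      using b_eq[of "Suc n"] by simp
    have "cmod (?t n) * ?x (Suc n) = cmod (cnj (?t n) * fourier_coeff S ?k)"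
      by (simp only: norm_mult complex_mod_cnj)
    also have "\<dots> \<le> cmod (fourier_coeff (b n) ?k) + cmod (fourier_coeff (\<lambda>z. S z * cnj (?g z)) ?k)"
      unfolding eq by (rule norm_triangle_ineq4)
    finally have "cmod (?t n) * ?x (Suc n) \<le> cmod (fourier_coeff (b n) ?k) + cmod (fourier_coeff (\<lambda>z. S z * cnj (?g z)) ?k)" .
    from divide_right_mono[OF this, of "cmod (?t n)"]
    have "?x (Suc n) \<le> cmod (\<alpha> n) + cmod (fourier_coeff (\<lambda>z. S z * cnj (?g z)) ?k) / cmod (?t n)"
      using t0[of n] by (simp add: add_divide_distrib \<alpha> norm_divide)
    also have "cmod (fourier_coeff (\<lambda>z. S z * cnj (?g z)) ?k) / cmod (?t n) \<le>
        (\<Sum>j. ?x (Suc n + j) * (cmod (fourier_coeff ?g (- int j)) / cmod (?t n)))"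
      by (rule scaled_fourier_coeff_mult_cnj_le[OF S g]) simp
    also have "(\<lambda>j. cmod (fourier_coeff ?g (- int j)) / cmod (?t n)) = (\<lambda>j. if j = 0 then 0 else coeff_a n j)"
      by (rule ext) (simp add: fourier_coeff_diff[OF a supported_on_const[OF UNIV_I]] fourier_coeff_const coeff_a_def)
    finally show ?thesis by simp
  qed
  let ?c = "1 - (cmod (\<alpha> n))\<^sup>2"
  have c0: "?c > 0" using norming_constant(3)[of n] by (simp add: abs_square_less_1)
  have t': "cmod (?t (Suc n)) = ?c * cmod (?t n)"
    by (simp only: norming_constant(2) norm_mult norm_of_real abs_of_pos[OF c0])
  have scale: "u / cmod (?t n) = ?c * u / cmod (?t (Suc n))" for u
    unfolding t' using c0 by simp
  \<comment> \<open>Used for both recurrences, with \<open>\<alpha>'\<close> equal to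
    \<open>\<alpha> n\<close> or to its conjugate; \<open>?c\<close> cancels through
    \<open>scale\<close>.\<close>
  have step: "cmod u / cmod (?t n) \<le> cmod v / cmod (?t (Suc n)) + cmod (\<alpha> n) * (cmod v' / cmod (?t (Suc n)))"
    if "complex_of_real ?c * u = v - \<alpha>' * v'" "cmod \<alpha>' = cmod (\<alpha> n)" for u v v' \<alpha>'
  proof -
    have "?c * cmod u = cmod (complex_of_real ?c * u)" using c0 by (simp add: norm_mult del: of_real_diff)
    also have "\<dots> \<le> cmod v + cmod (\<alpha> n) * cmod v'"
      unfolding that(1) using norm_triangle_ineq4[of v "\<alpha>' * v'"] that(2) by (simp add: norm_mult)
    finally show ?thesis unfolding scale
      by (simp add: divide_right_mono flip: add_divide_distrib)
  qed
  have c_eq: "complex_of_real ?c = 1 - \<alpha> n * cnj (\<alpha> n)"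
    by (simp only: of_real_diff complex_norm_square of_real_1)
  have zp: "z powi (int (Suc n)) * z powi (- int (Suc n)) = 1" if "z \<in> unit_circle" for z :: complex
    using circle_nonzero[OF that] by (simp only: power_int_minus) simp
  have zb: "supported_on (\<lambda>z. z powi (int (Suc n)) * b (Suc n) z) UNIV"
    and za: "supported_on (\<lambda>z. z powi (- int (Suc n)) * a (Suc n) z) UNIV"
    by (rule supported_on_shift[OF b] supported_on_shift[OF a], simp)+
  show "coeff_a n j \<le> coeff_a (Suc n) j + cmod (\<alpha> n) * coeff_b (Suc n) (Suc n + j)"
    unfolding coeff_a_def coeff_b_def
  proof (rule step)
    have "complex_of_real ?c * fourier_coeff (a n) (- int j)
        = fourier_coeff (\<lambda>z. a (Suc n) z - \<alpha> n * (z powi (int (Suc n)) * b (Suc n) z)) (- int j)"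
      unfolding fourier_coeff_cmult[symmetric]
    proof (rule fourier_coeff_cong)
      fix z assume z: "z \<in> unit_circle"
      \<comment> \<open>When the forward recurrences are inserted, the terms with \<open>b n\<close>
        cancel.\<close>
      have "a (Suc n) z - \<alpha> n * (z powi (int (Suc n)) * b (Suc n) z)
        = a n z - \<alpha> n * cnj (\<alpha> n) * (z powi (int (Suc n)) * z powi (- int (Suc n))) * a n z"
        unfolding a_Suc b_Suc by (simp only: ring_distribs) (simp only: algebra_simps)
      thus "complex_of_real ?c * a n z = a (Suc n) z - \<alpha> n * (z powi (int (Suc n)) * b (Suc n) z)"
        unfolding zp[OF z] c_eq by (simp add: left_diff_distrib)
    qed
    also have "\<dots> = fourier_coeff (a (Suc n)) (- int j) - \<alpha> n * fourier_coeff (b (Suc n)) (- int j - int (Suc n))"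
      by (simp only: fourier_coeff_diff[OF a supported_on_cmult[OF zb]] fourier_coeff_cmult fourier_coeff_shift[OF b])
    also have "- int j - int (Suc n) = - int (Suc n + j)" by simp
    finally show "complex_of_real ?c * fourier_coeff (a n) (- int j)
      = fourier_coeff (a (Suc n)) (- int j) - \<alpha> n * fourier_coeff (b (Suc n)) (- int (Suc n + j))" .
  qed simp
  show "coeff_b n k \<le> coeff_b (Suc n) k + cmod (\<alpha> n) * coeff_a (Suc n) (k - Suc n)" if k: "n < k"
    unfolding coeff_a_def coeff_b_def
  proof (rule step)
    have "complex_of_real ?c * fourier_coeff (b n) (- int k)
        = fourier_coeff (\<lambda>z. b (Suc n) z - cnj (\<alpha> n) * (z powi (- int (Suc n)) * a (Suc n) z)) (- int k)"
      unfolding fourier_coeff_cmult[symmetric]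
    proof (rule fourier_coeff_cong)
      fix z assume z: "z \<in> unit_circle"
      have "b (Suc n) z - cnj (\<alpha> n) * (z powi (- int (Suc n)) * a (Suc n) z)
        = b n z - \<alpha> n * cnj (\<alpha> n) * (z powi (int (Suc n)) * z powi (- int (Suc n))) * b n z"
        unfolding a_Suc b_Suc by (simp only: ring_distribs) (simp only: algebra_simps)
      thus "complex_of_real ?c * b n z = b (Suc n) z - cnj (\<alpha> n) * (z powi (- int (Suc n)) * a (Suc n) z)"
        unfolding zp[OF z] c_eq by (simp add: left_diff_distrib)
    qed
    also have "\<dots> = fourier_coeff (b (Suc n)) (- int k) - cnj (\<alpha> n) * fourier_coeff (a (Suc n)) (- int k - - int (Suc n))"
      by (simp only: fourier_coeff_diff[OF b supported_on_cmult[OF za]] fourier_coeff_cmult fourier_coeff_shift[OF a])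
    also have "- int k - - int (Suc n) = - int (k - Suc n)" using k by simp
    finally show "complex_of_real ?c * fourier_coeff (b n) (- int k)
      = fourier_coeff (b (Suc n)) (- int k) - cnj (\<alpha> n) * fourier_coeff (a (Suc n)) (- int (k - Suc n))" .
  qed simp
qed

end

section \<open>Identification with the monic orthogonal polynomials\<close>

text \<open>The integral is pulled back along \<open>cis\<close>. The factor \<open>2 * pi\<close>
  arises because \<open>arc_measure\<close> has mass \<open>2 * pi\<close>, while coefficients are
  means.\<close>

lemma integral_weighted_arc:
  fixes f :: "complex \<Rightarrow> complex"
  assumes "continuous_on unit_circle f"
  shows "(\<integral>z. f z \<partial>density arc_measure (\<lambda>z. ennreal (w z))) = 2 * pi * fourier_coeff (\<lambda>z. f z * W z) 0"
proof -
  let ?C = "restrict_space borel unit_circle :: complex measure"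
  let ?I = "restrict_space lborel {-pi..pi}"
  have sets: "sets arc_measure = sets ?C" by (simp add: arc_measure_def)
  have cis: "cis \<in> measurable ?I ?C"
  proof (rule measurable_restrict_space2)
    have "cis \<in> borel_measurable borel"
      by (intro borel_measurable_continuous_onI continuous_intros)
    thus "cis \<in> measurable ?I borel" by (intro measurable_restrict_space1) simp
  qed auto
  have "continuous_on unit_circle (\<lambda>z. Re (W z))"
    by (intro continuous_intros fourier_expansion_continuous[OF supported_on_expansion[OF W]])
  hence cw: "continuous_on unit_circle w" by simp
  have f: "f \<in> borel_measurable ?C" and w: "w \<in> borel_measurable ?C"
    by (intro borel_measurable_continuous_on_restrict assms cw)+
  have "(\<integral>z. f z \<partial>density arc_measure (\<lambda>z. ennreal (w z))) = (\<integral>z. w z *\<^sub>R f z \<partial>arc_measure)"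
  proof (rule integral_density)
    show "f \<in> borel_measurable arc_measure" "w \<in> borel_measurable arc_measure"
      using f w by (simp_all cong: measurable_cong_sets add: sets)
    have "w z \<ge> 0" if "z \<in> space arc_measure" for z
      using that pos[of z] by (simp add: arc_measure_def space_restrict_space)
    thus "AE z in arc_measure. 0 \<le> w z" by (rule AE_I2)
  qed
  also have "\<dots> = (\<integral>x. w (cis x) *\<^sub>R f (cis x) \<partial>?I)"
    unfolding arc_measure_def using f w
    by (intro integral_distr cis borel_measurable_scaleR)
  also have "\<dots> = (LBINT x:{-pi..pi}. w (cis x) *\<^sub>R f (cis x))"
    unfolding set_lebesgue_integral_def by (rule integral_restrict_space) simp
  also have "\<dots> = 2 * pi * fourier_coeff (\<lambda>z. f z * W z) 0"
    by (simp add: fourier_coeff_0 scaleR_conv_of_real mult.commute)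
  finally show ?thesis .
qed

text \<open>Conjugating the defining equation and multiplying by \<open>z ^ n\<close> shows that
  \<open>poly p z * W z\<close> has no coefficients at \<open>0, ..., n - 1\<close>. The factor
  \<open>cnj (poly q z)\<close> lowers indices by at most \<open>degree q < n\<close>, so index 0 is
  never reached.\<close>

lemma jost_orthogonal:
  assumes "jost n p a b" "degree q < n"
  shows "fourier_coeff (\<lambda>z. poly p z * cnj (poly q z) * W z) 0 = 0"
proof -
  have p: "degree p = n" and a: "supported_on a {..0}" and b: "supported_on b {..- int n - 1}"
    and eq: "\<And>z. z \<in> unit_circle \<Longrightarrow> z ^ n * cnj (poly p z) * W z = a z * D' z - cnj (b z) * D z"
    using assms(1) by (auto simp: jost_def)
  have 1: "supported_on (\<lambda>z. z powi int n * cnj (a z * D' z)) ({int n..} \<union> {..-1})"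
    by (rule supported_on_shift[OF supported_on_cnj[OF supported_on_mult[OF a D', of "{..0}"] order.refl]]) auto
  have cb: "supported_on (\<lambda>z. cnj (b z)) {int n + 1..}" by (rule supported_on_cnj[OF b]) auto
  have 2: "supported_on (\<lambda>z. z powi int n * cnj (cnj (b z) * D z)) ({int n..} \<union> {..-1})"
    by (rule supported_on_shift[OF supported_on_cnj[OF supported_on_mult[OF cb D, of "{int n + 1..}"] order.refl]]) auto
  have pw: "supported_on (\<lambda>z. poly p z * W z) ({int n..} \<union> {..-1})"
  proof (rule supported_on_cong[OF supported_on_diff[OF 1 2]])
    fix z assume z: "z \<in> unit_circle"
    have "poly p z * W z = z ^ n * cnj (z ^ n * cnj (poly p z) * W z)"
      using circle_nonzero[OF z] by (simp add: cnj_circle[OF z] power_inverse)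
    thus "z powi int n * cnj (a z * D' z) - z powi int n * cnj (cnj (b z) * D z) = poly p z * W z"
      unfolding eq[OF z] by (simp add: right_diff_distrib)
  qed
  have q: "supported_on (\<lambda>z. cnj (poly q z)) {- int (degree q)..0}"
    by (rule supported_on_cnj[OF supported_on_poly]) auto
  have "supported_on (\<lambda>z. poly p z * W z * cnj (poly q z)) (UNIV - {0})"
    by (rule supported_on_mult[OF pw q]) (use assms(2) in auto)
  from supported_on_coeff[OF this, of 0] show ?thesis by (simp add: mult_ac)
qed

text \<open>For uniqueness, the difference of two candidates has degree below \<open>n\<close>, so
  it is orthogonal to itself, which \<open>weighted_norm_pos\<close> forbids unless it is 0.\<close>

lemma monic_OP_jost:
  assumes "jost n p a b"
  shows "monic_OP (density arc_measure (\<lambda>z. ennreal (w z))) n = p"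
  unfolding monic_OP_def
proof (rule the_equality)
  let ?\<mu> = "density arc_measure (\<lambda>z. ennreal (w z))"
  let ?ip = "\<lambda>p q. fourier_coeff (\<lambda>z. poly p z * cnj (poly q z) * W z) 0"
  have int: "(\<integral>z. poly p z * cnj (poly q z) \<partial>?\<mu>) = 2 * pi * ?ip p q" for p q
    by (rule integral_weighted_arc) (intro continuous_intros)
  have p: "degree p = n" "lead_coeff p = 1" using assms by (auto simp: jost_def)
  have orth: "?ip p q = 0" if "degree q < n" for q by (rule jost_orthogonal[OF assms that])
  show "degree p = n \<and> lead_coeff p = 1 \<and> (\<forall>q. degree q < n \<longrightarrow> (\<integral>z. poly p z * cnj (poly q z) \<partial>?\<mu>) = 0)"
    using p orth unfolding int by simp
  fix p' assume p': "degree p' = n \<and> lead_coeff p' = 1 \<and> (\<forall>q. degree q < n \<longrightarrow> (\<integral>z. poly p' z * cnj (poly q z) \<partial>?\<mu>) = 0)"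
  hence orth': "?ip p' q = 0" if "degree q < n" for q using that unfolding int by simp
  show "p' = p"
  proof (rule ccontr)
    assume "p' \<noteq> p"
    hence ne: "p' - p \<noteq> 0" by simp
    have "degree (p' - p) \<le> n" using p p' by (intro degree_diff_le) auto
    moreover have "coeff (p' - p) n = 0" using p p' by auto
    hence "degree (p' - p) \<noteq> n" using ne leading_coeff_0_iff by blast
    ultimately have deg: "degree (p' - p) < n" by simp
    have s: "supported_on (\<lambda>z. poly p z * cnj (poly q z) * W z) UNIV" for p q
    proof (rule supported_on_mult[OF _ W])
      show "supported_on (\<lambda>z. poly p z * cnj (poly q z)) UNIV"
        by (rule supported_on_mult[OF supported_on_poly supported_on_cnj[OF supported_on_poly order.refl]]) simp
    qed simp
    have "?ip (p' - p) (p' - p) = ?ip p' (p' - p) - ?ip p (p' - p)"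
      using fourier_coeff_diff[OF s s, of p' "p' - p" p "p' - p" 0] by (simp add: left_diff_distrib)
    also have "\<dots> = 0" using orth[OF deg] orth'[OF deg] by simp
    finally have z: "?ip (p' - p) (p' - p) = 0" .
    obtain \<rho> where "\<rho> > 0" "?ip (p' - p) (p' - p) = complex_of_real \<rho>"
      by (rule weighted_norm_pos[OF ne])
    thus False using z by simp
  qed
qed

text \<open>The numbers \<alpha> built from the Jost functions satisfy the recurrence of the monic
  orthogonal polynomials, hence are the Verblunsky coefficients. The weight index is
  \<open>Suc n\<close> because \<open>\<alpha> n\<close> is read off from \<open>b n\<close> at
  \<open>- int (Suc n)\<close>.\<close>

lemma summable_verblunsky_iff:
  assumes "weight \<omega>"
  shows "summable (\<lambda>n. \<omega> (Suc n) * cmod (verblunsky (density arc_measure (\<lambda>z. ennreal (w z))) n)) \<longleftrightarrow>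
    summable (\<lambda>k. \<omega> k * cmod (fourier_coeff S (- int k)))"
proof -
  let ?\<mu> = "density arc_measure (\<lambda>z. ennreal (w z))"
  obtain P a b \<alpha> where J: "\<And>n. jost n (P n) (a n) (b n)"
    and rec0: "\<And>n. \<alpha> n = - cnj (fourier_coeff (b n) (- int (Suc n)) / fourier_coeff (a n) 0)"
    and P: "\<And>n. P (Suc n) = pCons 0 (P n) - smult (cnj (\<alpha> n)) (reversed (P n))"
    and rec: "\<And>n. a (Suc n) = (\<lambda>z. a n z + \<alpha> n * (z powi (int (Suc n)) * b n z))"
    "\<And>n. b (Suc n) = (\<lambda>z. b n z + cnj (\<alpha> n) * (z powi (- int (Suc n)) * a n z))"
    using jost_sequence by blast
  have OP: "monic_OP ?\<mu> n = P n" for n by (rule monic_OP_jost[OF J])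
  have "verblunsky ?\<mu> n = \<alpha> n" for n
  proof (rule verblunsky_eq(1))
    show "monic_OP ?\<mu> (Suc n) = pCons 0 (monic_OP ?\<mu> n) - smult (cnj (\<alpha> n)) (reversed_OP ?\<mu> n)"
      unfolding reversed_OP_def OP P reversed_def ..
    show "lead_coeff (monic_OP ?\<mu> n) = 1" using J[of n] unfolding OP jost_def by blast
  qed
  thus ?thesis
    using scattering_bounds.summable_iff[OF scattering_bounds_jost[OF J rec0 rec] assms] by simp
qed

end

section \<open>Return to two-sided sequences and function algebras\<close>

lemma beurling_weight_nat:
  assumes "beurling_weight \<nu>"
  shows "weight (\<lambda>n. \<nu> (int n))"
proof
  have sym: "\<nu> (- k) = \<nu> k" and sub: "\<nu> (k + l) \<le> \<nu> k * \<nu> l" for k l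
    using assms by (auto simp: beurling_weight_def)
  show "\<nu> (int 0) = 1" "\<nu> (int n) \<ge> 1" for n using assms by (auto simp: beurling_weight_def)
  show "\<nu> (int (m + n)) \<le> \<nu> (int m) * \<nu> (int n)" for m n using sub[of "int m" "int n"] by simp
  show "\<nu> (int m) \<le> \<nu> (int (m + n)) * \<nu> (int n)" for m n
    using sub[of "int (m + n)" "- int n"] sym[of "int n"] by simp
qed

text \<open>Moving by one index changes the weight at most by the factor \<open>\<nu> 1\<close>, in
  one direction by \<open>submult\<close>, in the other by \<open>submult'\<close>.\<close>

lemma two_sided_in_ell:
  assumes "weight (\<lambda>n. \<nu> (int n))"
  shows "two_sided \<alpha> \<in> ell \<nu> \<longleftrightarrow> summable (\<lambda>n. \<nu> (int (Suc n)) * cmod (\<alpha> n))"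
proof -
  interpret weight "\<lambda>n. \<nu> (int n)" by fact
  have nn: "\<nu> (int n) \<ge> 0" for n using ge1[of n] by simp
  have range: "range int = {0..}" by (auto intro: image_eqI[of _ int "nat _"])
  have "two_sided \<alpha> \<in> ell \<nu> \<longleftrightarrow> (\<lambda>k. \<nu> k * cmod (two_sided \<alpha> k)) summable_on range int"
    unfolding ell_def mem_Collect_eq range
    by (rule summable_on_cong_neutral) (auto simp: two_sided_def)
  also have "\<dots> \<longleftrightarrow> (\<lambda>n. \<nu> (int n) * cmod (\<alpha> n)) summable_on UNIV"
    by (subst summable_on_reindex) (auto simp: o_def two_sided_def)
  also have "\<dots> \<longleftrightarrow> summable (\<lambda>n. \<nu> (int n) * cmod (\<alpha> n))"
    by (rule summable_on_UNIV_nonneg_real_iff) (simp add: nn)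
  also have "\<dots> \<longleftrightarrow> summable (\<lambda>n. \<nu> (int (Suc n)) * cmod (\<alpha> n))"
  proof
    assume s: "summable (\<lambda>n. \<nu> (int n) * cmod (\<alpha> n))"
    show "summable (\<lambda>n. \<nu> (int (Suc n)) * cmod (\<alpha> n))"
    proof (rule summable_comparison_test'[OF summable_mult[OF s, of "\<nu> (int 1)"], of 0])
      show "norm (\<nu> (int (Suc n)) * cmod (\<alpha> n)) \<le> \<nu> (int 1) * (\<nu> (int n) * cmod (\<alpha> n))" for n
        using mult_right_mono[OF submult[of 1 n], of "cmod (\<alpha> n)"] nn[of "Suc n"] by (simp add: abs_mult mult_ac)
    qed
  next
    assume s: "summable (\<lambda>n. \<nu> (int (Suc n)) * cmod (\<alpha> n))"
    show "summable (\<lambda>n. \<nu> (int n) * cmod (\<alpha> n))"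
    proof (rule summable_comparison_test'[OF summable_mult[OF s, of "\<nu> (int 1)"], of 0])
      show "norm (\<nu> (int n) * cmod (\<alpha> n)) \<le> \<nu> (int 1) * (\<nu> (int (Suc n)) * cmod (\<alpha> n))" for n
        using mult_right_mono[OF submult'[of n 1], of "cmod (\<alpha> n)"] nn[of n] by (simp add: abs_mult mult_ac)
    qed
  qed
  finally show ?thesis .
qed

text \<open>As \<open>\<nu> k \<ge> 1\<close>, any expansion witnessing membership is absolutely
  summable, hence by uniqueness equals the coefficients \<open>d\<close> of nonpositive index; the
  symmetry of \<nu> then replaces the weight at \<open>- k\<close> by that at
  \<open>k\<close>.\<close>

lemma P_minus_in_beurling_algebra_minus:
  assumes S: "supported_on S UNIV" and \<nu>: "beurling_weight \<nu>"
  shows "P_minus S \<in> beurling_algebra_minus \<nu> \<longleftrightarrow> summable (\<lambda>k. \<nu> (int k) * cmod (fourier_coeff S (- int k)))"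
proof -
  have \<nu>1: "\<nu> k \<ge> 1" and sym: "\<nu> (- k) = \<nu> k" for k
    using \<nu> by (auto simp: beurling_weight_def)
  have \<nu>0: "\<nu> k \<ge> 0" for k using \<nu>1[of k] by simp
  define d where "d = (\<lambda>k. if k \<le> 0 then fourier_coeff S k else 0)"
  note e = supported_on_expansion[OF S]
  have d: "fourier_expansion (P_minus S) d"
  proof (rule fourier_expansionI)
    show "d abs_summable_on UNIV"
      by (rule Infinite_Sum.abs_summable_on_comparison_test'[OF fourier_expansion_abs[OF e]]) (simp add: d_def)
    fix z assume z: "z \<in> unit_circle"
    have "(\<lambda>k. fourier_coeff S k * z powi k) summable_on {..0}"
      using has_sum_imp_summable[OF fourier_expansion_has_sum[OF e z]] by (rule summable_on_subset_banach) simp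
    hence "((\<lambda>k. fourier_coeff S k * z powi k) has_sum P_minus S z) {..0}"
      by (simp add: P_minus_def)
    thus "((\<lambda>k. d k * z powi k) has_sum P_minus S z) UNIV"
      by (rule has_sum_cong_neutral[THEN iffD1, rotated -1]) (auto simp: d_def)
  qed
  have "P_minus S \<in> beurling_algebra_minus \<nu> \<longleftrightarrow> d \<in> ell \<nu>"
  proof
    assume "d \<in> ell \<nu>"
    hence "P_minus S \<in> beurling_algebra \<nu>"
      unfolding beurling_algebra_def using fourier_expansion_has_sum[OF d] by blast
    moreover have "fourier_coeff (P_minus S) k = 0" if "k > 0" for k
      using that by (simp add: fourier_coeff_eq[OF d] d_def)
    ultimately show "P_minus S \<in> beurling_algebra_minus \<nu>" by (simp add: beurling_algebra_minus_def)
  next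
    assume "P_minus S \<in> beurling_algebra_minus \<nu>"
    then obtain c where c: "c \<in> ell \<nu>" "\<And>z. z \<in> unit_circle \<Longrightarrow> ((\<lambda>k. c k * z powi k) has_sum P_minus S z) UNIV"
      unfolding beurling_algebra_minus_def beurling_algebra_def by blast
    have "fourier_expansion (P_minus S) c"
    proof (rule fourier_expansionI[OF _ c(2)])
      have "(\<lambda>k. \<nu> k * cmod (c k)) summable_on UNIV" using c(1) by (simp add: ell_def)
      thus "c abs_summable_on UNIV"
      proof (rule Infinite_Sum.abs_summable_on_comparison_test')
        show "cmod (c k) \<le> \<nu> k * cmod (c k)" for k
          using mult_right_mono[OF \<nu>1[of k] norm_ge_zero[of "c k"]] by simp
      qed
    qed
    from fourier_expansion_unique[OF this d refl] c(1) show "d \<in> ell \<nu>" by simp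
  qed
  also have "\<dots> \<longleftrightarrow> (\<lambda>k. \<nu> k * cmod (d k)) summable_on range (\<lambda>n. - int n)"
    unfolding ell_def mem_Collect_eq
  proof (rule summable_on_cong_neutral)
    fix k assume "k \<in> UNIV - range (\<lambda>n. - int n)"
    moreover have "k \<in> range (\<lambda>n. - int n)" if "k \<le> 0"
      using that by (intro image_eqI[of _ _ "nat (- k)"]) auto
    ultimately have "k > 0" by force
    thus "\<nu> k * cmod (d k) = 0" by (simp add: d_def)
  qed auto
  also have "\<dots> \<longleftrightarrow> (\<lambda>k. \<nu> (int k) * cmod (fourier_coeff S (- int k))) summable_on UNIV"
    by (subst summable_on_reindex) (auto simp: inj_on_def o_def d_def sym)
  also have "\<dots> \<longleftrightarrow> summable (\<lambda>k. \<nu> (int k) * cmod (fourier_coeff S (- int k)))"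
    by (rule summable_on_UNIV_nonneg_real_iff) (simp add: \<nu>0)
  finally show ?thesis .
qed

theorem theorem2:
  fixes w :: "complex \<Rightarrow> real" and \<mu> :: "complex measure" and \<nu> :: "int \<Rightarrow> real"
  assumes w_pos: "\<And>z. z \<in> unit_circle \<Longrightarrow> w z > 0"
    and w_wiener: "(\<lambda>z. complex_of_real (w z)) \<in> wiener_algebra"
    and \<mu>: "\<mu> = density arc_measure (\<lambda>z. ennreal (w z))"
    and normalized: "1 / (2 * pi) * measure \<mu> (space \<mu>) = 1"
    and \<nu>: "beurling_weight \<nu>"
  shows "two_sided (verblunsky \<mu>) \<in> ell \<nu> \<longleftrightarrow>
         P_minus (scattering w) \<in> beurling_algebra_minus \<nu>"
proof -
  have w: "supported_on (\<lambda>z. complex_of_real (w z)) UNIV"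
    using w_wiener by (auto simp: beurling_algebra_def ell_def supported_on_def fourier_expansion_def)
  obtain G where G': "supported_on G {0..}"
    "\<And>z. z \<in> unit_circle \<Longrightarrow> complex_of_real (w z) = exp (G z + cnj (G z))"
    "\<And>z. z \<in> unit_circle \<Longrightarrow> scattering w z = exp (G z - cnj (G z))"
    using szego_factorization[OF w_pos w] by blast
  interpret szego_weight w G
    by unfold_locales (use w_pos G' in auto)
  have S': "supported_on (scattering w) UNIV"
    by (rule supported_on_cong[OF S]) (simp add: G'(3))
  have coeff: "fourier_coeff (scattering w) k = fourier_coeff S k" for k
    by (rule fourier_coeff_cong) (simp add: G'(3))
  note wt = beurling_weight_nat[OF \<nu>]
  show ?thesis
    unfolding two_sided_in_ell[OF wt] P_minus_in_beurling_algebra_minus[OF S' \<nu>] coeff \<mu>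
    by (rule summable_verblunsky_iff[OF wt])
qed

end
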